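(* Let $p>0$, let $\mathbb{T}$ be a $p$-periodic time scale, $t_0\in\mathbb{T}$, and let $A:\mathbb{T}\to\mathbb{R}^{n\times n}$ be regressive and $p$-periodic. Let $$R(t)=\lim_{s\searrow\mu(t)}\frac1s\left(\Phi_A(t_0+p,t_0)^{s/p}-I\right)$$ and let $\{\gamma_i(t)\}_{i=1}^n$ be the eigenvalues of $R(t)$. Then the solutions of the system $x^\Delta(t)=A(t)x(t)$, $x(t_0)=x_0$, have the following properties: (i) if $\mathrm{Re}_\mu\gamma_i(t)<0$ for all $i=1,\dots,n$ (and all $t\in\mathbb{T}$), then the system $x^\Delta=A(t)x$ is exponentially stable; (ii) if $\mathrm{Re}_\mu\gamma_i(t)=0$ for all $i=1,\dots,n$, then in the case when only simple elementary divisors correspond to the $\gamma_i(t)$, the system $x^\Delta=A(t)x$ is stable; if among the elementary divisors there are multiple ones, the system is unstable, growing at rates of generalized polynomials of $t$ (that is, there are unbounded solutions on $[t_0,\infty)\cap\mathbb{T}$, and the norm of every solution is bounded for $t\ge t_0$ by a finite linear combination of the generalized polynomials $h_k(t,t_0)$); (iii) if $\mathrm{Re}_\mu\gamma_i(t)>0$ for some $i\in\{1,\dots,n\}$, then the system $x^\Delta=A(t)x$ is unstable.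
   Context: A time scale $\mathbb{T}$ is a nonempty closed subset of $\mathbb{R}$; $\sigma(t)=\inf\{s\in\mathbb{T}:s>t\}$, $\mu(t)=\sigma(t)-t$, $f^\Delta$ is the delta (Hilger) derivative. $\mathbb{T}$ is $p$-periodic if for all $t\in\mathbb{T}$: $t+p\in\mathbb{T}$ and $\mu(t)=\mu(t+p)$; it is assumed that $0\le\mu(t)\le p$. $A$ is $p$-periodic if $A(t+p)=A(t)$, and regressive if it is rd-continuous and $I+\mu(t)A(t)$ is invertible for all $t$. $\Phi_A(t,\tau)$ is the unique solution of $X^\Delta=A(t)X$, $X(\tau)=I$. Real power of a nonsingular $n\times n$ matrix $M$: let $\lambda_1,\dots,\lambda_k$ be the distinct eigenvalues with multiplicities $m_i$, $c(\lambda)=\prod_i(\lambda-\lambda_i)^{m_i}$ the characteristic polynomial, $a_i$ ($\deg a_i<m_i$) defined by $\frac1{c(\lambda)}=\sum_i\frac{a_i(\lambda)}{(\lambda-\lambda_i)^{m_i}}$, $b_i(\lambda)=\prod_{j\ne i}(\lambda-\lambda_j)^{m_j}$, $P_i(M)=a_i(M)b_i(M)$. Then for $r\in\mathbb{R}$, $M^r=\sum_{i=1}^kP_i(M)\lambda_i^r\left[\sum_{j=0}^{m_i-1}\binom rj\left(\frac{M-\lambda_iI}{\lambda_i}\right)^j\right]$ with principal values of $\lambda_i^r$, where $\binom rj=\frac{\Gamma(r+1)}{j!\,\Gamma(r-j+1)}$. The eigenvalues of $R(t)$ are listed with multiplicity as $\gamma_i(t)=\lim_{s\searrow\mu(t)}\frac{\lambda_i^{s/p}-1}{s}$,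 $\lambda_1,\dots,\lambda_n$ being the eigenvalues of $\Phi_A(t_0+p,t_0)$. An elementary divisor corresponding to $\gamma_i(t)$ is simple if the corresponding Jordan block (of $R(t)$, equivalently of $\Phi_A(t_0+p,t_0)$) is $1\times1$, and multiple otherwise. Hilger real part: $\mathrm{Re}_\mu(z)=\frac{|1+\mu(t)z|-1}{\mu(t)}$ if $\mu(t)>0$ and $\mathrm{Re}_\mu(z)=\mathrm{Re}\,z$ if $\mu(t)=0$. Generalized polynomials: $h_0(t,s)=1$, $h_{k+1}(t,s)=\int_s^th_k(\tau,s)\Delta\tau$. Stability: the system is stable if there is $C>0$ with $\|x(t)\|\le C\|x(t_0)\|$ for all $t\ge t_0$, any $t_0\in\mathbb{T}$, and any solution; exponentially stable if there are $C,\lambda>0$ with $1-\lambda\mu(t)>0$ for all $t\in\mathbb{T}$ and $\|x(t)\|\le C e_{-\lambda}(t,t_0)\|x(t_0)\|$ for all $t\ge t_0$, any $t_0\in\mathbb{T}$, and any solution, where $e_{-\lambda}(\cdot,t_0)$ solves $y^\Delta=-\lambda y$, $y(t_0)=1$; unstable if not stable. *)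

theory Defs
  imports
    "HOL-Analysis.Analysis"
    "Jordan_Normal_Form.Jordan_Normal_Form"
begin

(* Matrices are the Cartesian-product matrices of HOL-Analysis; Jordan_Normal_Form is used
   only through jnf_of below. *)
hide_const (open) Matrix.mat Matrix.vec Matrix.row Matrix.col Determinant.det
hide_type (open) Matrix.mat Matrix.vec
no_notation vec_index (infixl "$" 100)

section \<open>Time scales\<close>

definition time_scale :: "real set \<Rightarrow> bool" where
  "time_scale T \<longleftrightarrow> T \<noteq> {} \<and> closed T"

(* Usual conventions inf {} = sup T and sup {} = inf T: an end point of T is its own
   successor/predecessor. (A periodic time scale has no maximum.) *)
definition sigma :: "real set \<Rightarrow> real \<Rightarrow> real" where
  "sigma T t = (if \<exists>s\<in>T. t < s then Inf {s \<in> T. t < s} else t)"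

definition rho :: "real set \<Rightarrow> real \<Rightarrow> real" where
  "rho T t = (if \<exists>s\<in>T. s < t then Sup {s \<in> T. s < t} else t)"

definition mu :: "real set \<Rightarrow> real \<Rightarrow> real" where
  "mu T t = sigma T t - t"

definition periodic_time_scale :: "real \<Rightarrow> real set \<Rightarrow> bool" where
  "periodic_time_scale p T \<longleftrightarrow> time_scale T \<and>
     (\<forall>t\<in>T. t + p \<in> T \<and> mu T t = mu T (t + p) \<and> 0 \<le> mu T t \<and> mu T t \<le> p)"

definition has_delta_derivative ::
  "real set \<Rightarrow> (real \<Rightarrow> 'a::real_normed_vector) \<Rightarrow> 'a \<Rightarrow> real \<Rightarrow> bool" where
  "has_delta_derivative T f D t \<longleftrightarrow>
     (\<forall>\<epsilon>>0. \<exists>\<delta>>0. \<forall>s\<in>T. \<bar>s - t\<bar> < \<delta> \<longrightarrow>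
        norm (f (sigma T t) - f s - (sigma T t - s) *\<^sub>R D) \<le> \<epsilon> * \<bar>sigma T t - s\<bar>)"

(* Cauchy delta integral: increment of a delta antiderivative. *)
definition delta_integral ::
  "real set \<Rightarrow> (real \<Rightarrow> 'a::real_normed_vector) \<Rightarrow> real \<Rightarrow> real \<Rightarrow> 'a" where
  "delta_integral T f a b =
     (THE I. \<exists>F. (\<forall>t\<in>T. has_delta_derivative T F (f t) t) \<and> I = F b - F a)"

primrec gen_poly :: "real set \<Rightarrow> nat \<Rightarrow> real \<Rightarrow> real \<Rightarrow> real" where
  "gen_poly T 0 = (\<lambda>t s. 1)"
| "gen_poly T (Suc k) = (\<lambda>t s. delta_integral T (\<lambda>\<tau>. gen_poly T k \<tau> s) s t)"

definition hilger_Re :: "real set \<Rightarrow> real \<Rightarrow> complex \<Rightarrow> real" where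
  "hilger_Re T t z =
     (if mu T t > 0 then (cmod (1 + of_real (mu T t) * z) - 1) / mu T t else Re z)"

definition rd_continuous :: "real set \<Rightarrow> (real \<Rightarrow> 'a::topological_space) \<Rightarrow> bool" where
  "rd_continuous T f \<longleftrightarrow>
     (\<forall>t\<in>T. (sigma T t = t \<longrightarrow> continuous (at t within T) f) \<and>
            ((\<exists>s\<in>T. s < t) \<and> rho T t = t \<longrightarrow> (\<exists>l. (f \<longlongrightarrow> l) (at t within (T \<inter> {..<t})))))"

section \<open>Linear dynamic systems\<close>

definition regressive :: "real set \<Rightarrow> (real \<Rightarrow> real^'n^'n) \<Rightarrow> bool" where
  "regressive T A \<longleftrightarrow> rd_continuous T A \<and> (\<forall>t\<in>T. invertible (mat 1 + mu T t *\<^sub>R A t))"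

definition periodic_on :: "real \<Rightarrow> real set \<Rightarrow> (real \<Rightarrow> 'a) \<Rightarrow> bool" where
  "periodic_on p T f \<longleftrightarrow> (\<forall>t\<in>T. f (t + p) = f t)"

(* The unique solution on T of y' = F(t,y), y(tau) = y0. Functions are total in HOL, so
   uniqueness only makes sense once the values off T are pinned down by extensional. *)
definition ivp_solution ::
  "real set \<Rightarrow> (real \<Rightarrow> 'a \<Rightarrow> 'a::real_normed_vector) \<Rightarrow> real \<Rightarrow> 'a \<Rightarrow> real \<Rightarrow> 'a" where
  "ivp_solution T F \<tau> y0 =
     (THE y. y \<in> extensional T \<and> (\<forall>t\<in>T. has_delta_derivative T y (F t (y t)) t) \<and> y \<tau> = y0)"

definition transition_matrix ::
  "real set \<Rightarrow> (real \<Rightarrow> real^'n^'n) \<Rightarrow> real \<Rightarrow> real \<Rightarrow> real^'n^'n" where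
  "transition_matrix T A t \<tau> = ivp_solution T (\<lambda>s X. A s ** X) \<tau> (mat 1) t"

definition ts_exp :: "real set \<Rightarrow> real \<Rightarrow> real \<Rightarrow> real \<Rightarrow> real" where
  "ts_exp T a t \<tau> = ivp_solution T (\<lambda>s y. a * y) \<tau> 1 t"

definition is_solution :: "real set \<Rightarrow> (real \<Rightarrow> real^'n^'n) \<Rightarrow> (real \<Rightarrow> real^'n) \<Rightarrow> bool" where
  "is_solution T A x \<longleftrightarrow> (\<forall>t\<in>T. has_delta_derivative T x (A t *v x t) t)"

definition dyn_stable :: "real set \<Rightarrow> (real \<Rightarrow> real^'n^'n) \<Rightarrow> bool" where
  "dyn_stable T A \<longleftrightarrow>
     (\<exists>C>0. \<forall>\<tau>\<in>T. \<forall>x. is_solution T A x \<longrightarrow>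
        (\<forall>t\<in>T. \<tau> \<le> t \<longrightarrow> norm (x t) \<le> C * norm (x \<tau>)))"

definition dyn_exp_stable :: "real set \<Rightarrow> (real \<Rightarrow> real^'n^'n) \<Rightarrow> bool" where
  "dyn_exp_stable T A \<longleftrightarrow>
     (\<exists>C>0. \<exists>a>0. (\<forall>t\<in>T. 1 - a * mu T t > 0) \<and>
        (\<forall>\<tau>\<in>T. \<forall>x. is_solution T A x \<longrightarrow>
           (\<forall>t\<in>T. \<tau> \<le> t \<longrightarrow> norm (x t) \<le> C * ts_exp T (- a) t \<tau> * norm (x \<tau>))))"

abbreviation dyn_unstable :: "real set \<Rightarrow> (real \<Rightarrow> real^'n^'n) \<Rightarrow> bool" where
  "dyn_unstable T A \<equiv> \<not> dyn_stable T A"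

section \<open>Characteristic polynomial, Jordan blocks and real powers\<close>

(* The same matrix with rows and columns renumbered by an arbitrary enumeration of the finite
   index type; characteristic polynomial and Jordan blocks do not depend on the choice. *)
definition jnf_of :: "'a^'n^'n \<Rightarrow> 'a Matrix.mat" where
  "jnf_of M = (let e = (SOME e :: nat \<Rightarrow> 'n. bij_betw e {..<CARD('n)} UNIV)
     in Matrix.mat CARD('n) CARD('n) (\<lambda>(i, j). M $ e i $ e j))"

definition charpoly :: "complex^'n^'n \<Rightarrow> complex poly" where
  "charpoly M = char_poly (jnf_of M)"

(* M has a k x k Jordan block with eigenvalue a. *)
definition has_jordan_block :: "complex^'n^'n \<Rightarrow> complex \<Rightarrow> nat \<Rightarrow> bool" where
  "has_jordan_block M a k \<longleftrightarrow> (\<exists>bs. jordan_nf (jnf_of M) bs \<and> (k, a) \<in> set bs)"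

(* The matrix product is **; the type-class power ^ on vectors is componentwise. *)
definition matpow :: "complex^'n^'n \<Rightarrow> nat \<Rightarrow> complex^'n^'n" where
  "matpow M k = (((**) M) ^^ k) (mat 1)"

definition poly_mat :: "complex poly \<Rightarrow> complex^'n^'n \<Rightarrow> complex^'n^'n" where
  "poly_mat q M = (\<Sum>k\<le>degree q. mat (coeff q k) ** matpow M k)"

(* The numerators a_i of the partial fraction decomposition of 1/c for monic c, indexed by the
   roots of c themselves and 0 elsewhere. *)
definition pfd_numerators :: "complex poly \<Rightarrow> complex \<Rightarrow> complex poly" where
  "pfd_numerators c = (THE a.
     (\<forall>r. if poly c r = 0 then degree (a r) < order r c else a r = 0) \<and>
     (\<forall>z. poly c z \<noteq> 0 \<longrightarrow>
        1 / poly c z = (\<Sum>r | poly c r = 0. poly (a r) z / (z - r) ^ order r c)))"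

definition spectral_proj :: "complex^'n^'n \<Rightarrow> complex \<Rightarrow> complex^'n^'n" where
  "spectral_proj M l = (let c = charpoly M in
     poly_mat (pfd_numerators c l) M **
     poly_mat (\<Prod>r\<in>{r. poly c r = 0} - {l}. [:- r, 1:] ^ order r c) M)"

(* powr is the principal value, and r gchoose j is Gamma(r+1) / (j! Gamma(r-j+1)); see
   gbinomial_Gamma. *)
definition real_matpow :: "complex^'n^'n \<Rightarrow> real \<Rightarrow> complex^'n^'n" where
  "real_matpow M r = (let c = charpoly M in
     \<Sum>l | poly c l = 0. spectral_proj M l ** (mat (l powr of_real r) **
       (\<Sum>j<order l c. mat (of_real (r gchoose j)) ** matpow (mat (1 / l) ** (M - mat l)) j)))"

(* R(t); the base point t0 and the monodromy matrix Phi_A(t0+p,t0) enter through T, A, p, t0. *)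
definition floquet_R ::
  "real set \<Rightarrow> (real \<Rightarrow> real^'n^'n) \<Rightarrow> real \<Rightarrow> real \<Rightarrow> real \<Rightarrow> complex^'n^'n" where
  "floquet_R T A p t0 t =
     Lim (at_right (mu T t)) (\<lambda>s. (1 / s) *\<^sub>R
       (real_matpow (map_matrix of_real (transition_matrix T A (t0 + p) t0)) (s / p) - mat 1))"

end

theory Submission
  imports
    "Jordan_Normal_Form.Jordan_Normal_Form_Existence"
    "Jordan_Normal_Form.Jordan_Normal_Form_Uniqueness"
    Defs
begin

text \<open>
By periodicity a solution satisfies $x(t_0 + jp) = \Phi^j x(t_0)$, where $\Phi = \Phi_A(t_0+p,t_0)$
is the monodromy matrix, and within one period solutions grow by a bounded factor, uniformly in the
starting point. So everything is decided by the growth of the powers $\Phi^j$, that is, by the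
moduli of the eigenvalues $\lambda$ of $\Phi$ and, for $|\lambda| = 1$, by whether $\Phi$ has a
Jordan chain $\Phi w = \lambda w$, $\Phi v = \lambda v + w$ with $w \neq 0$.

Real powers act on eigenvectors by $\lambda^r$ and on chains by
$v \mapsto \lambda^r (v + (r / \lambda) w)$. In the limit, $R(t)$ commutes with $\Phi$, maps
eigenvectors to eigenvectors with $1 + \mu\gamma = \lambda^{\mu/p}$ (or $\gamma = \log\lambda / p$
if $\mu = 0$), and maps chains to chains up to a nonzero factor. Hence the sign of the Hilger real
part of $\gamma$ is that of $|\lambda| - 1$, and $R(t)$ has a multiple elementary divisor
if and only if $\Phi$ has one.

Exponential decay is compared with $e_{-a}(\tau + kp, \tau) \ge (1 - ap)^k$, and polynomial growth
with $h_k(t_0 + mp, t_0) \ge p^k {m \choose k}$.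
\<close>

hide_const (open) Coset.order module.smult
hide_const (open) Matrix.mat Matrix.vec Matrix.row Matrix.col Determinant.det
hide_type (open) Matrix.mat Matrix.vec
hide_fact (open) Matrix.vec_eq_iff Matrix.mat_def
no_notation vec_index (infixl "$" 100)

section \<open>Calculus on an unbounded time scale\<close>

text \<open>Periodicity only gives t + p in T: the time scale may or may not have a least point,
  while stability ranges over all starting points, also those left of t0. Moreover the transition
  matrix, the exponential and the delta integral are definite descriptions, so existence and
  uniqueness on all of T have to come first. Hence analysis is done on the half-lines
  \<open>T \<inter> {c..}\<close>, where integrals can start at c, and then glued along T. Backward
  existence comes from regressivity: the forward solution map is injective, hence surjective in
  finite dimension. On the algebraic side the partial fraction formula is used through few facts:
  the projections sum to the identity, are polynomials in the matrix, and by Cayley-Hamilton their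
  ranges are killed by a power of M - l. Chains of length two replace the full Jordan form because
  they pass through the limit defining R(t), whereas a Jordan basis would have to be tracked.
  Eigenvectors are complex and solutions real, so unboundedness has to be moved to a real or
  imaginary part.\<close>

locale unbounded_time_scale =
  fixes T :: "real set"
  assumes closed_T: "closed T"
    and unbounded_T: "\<And>t. t \<in> T \<Longrightarrow> \<exists>s\<in>T. t < s"
begin

section \<open>The forward jump operator and induction along a time scale\<close>

lemma sigma_eq_Inf: "t \<in> T \<Longrightarrow> sigma T t = Inf {s \<in> T. t < s}"
  using unbounded_T by (auto simp: sigma_def)

lemma sigma_ge: "t \<in> T \<Longrightarrow> t \<le> sigma T t"
  using unbounded_T[of t] by (auto simp: sigma_eq_Inf intro!: cInf_greatest)

lemma sigma_le: "\<lbrakk>t \<in> T; s \<in> T; t < s\<rbrakk> \<Longrightarrow> sigma T t \<le> s"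
  by (auto simp: sigma_eq_Inf intro!: cInf_lower bdd_belowI[of _ t])

lemma sigma_in: assumes "t \<in> T" shows "sigma T t \<in> T"
proof -
  have "Inf {s \<in> T. t < s} \<in> closure {s \<in> T. t < s}"
    using unbounded_T[OF assms] by (intro closure_contains_Inf bdd_belowI[of _ t]) auto
  also have "\<dots> \<subseteq> closure T" by (rule closure_mono) auto
  finally show ?thesis using closed_T assms by (simp add: sigma_eq_Inf)
qed

lemma right_dense_ex:
  assumes "t \<in> T" "sigma T t = t" "0 < d"
  obtains s where "s \<in> T" "t < s" "s < t + d"
proof -
  have "\<exists>s\<in>{s \<in> T. t < s}. s < t + d"
  proof (rule ccontr)
    assume "\<not> ?thesis"
    then have "t + d \<le> Inf {s \<in> T. t < s}"
      using unbounded_T[OF assms(1)] by (intro cInf_greatest) auto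
    then show False using assms by (simp add: sigma_eq_Inf)
  qed
  then show ?thesis using that by auto
qed

text \<open>Let m be the infimum of the failures of P from c on; closedness puts it in T. If P m
  holds, failures accumulate at m from the right, which is impossible at a right-scattered point and
  excluded by \<open>right_dense\<close> otherwise. If P m fails, m is either a limit from the left,
  or the successor of the last point r before it.\<close>

lemma time_scale_induct [consumes 3, case_names base scattered right_dense left_dense]:
  assumes "t \<in> T" "c \<le> t" and cT: "c \<in> T"
    and base: "P c"
    and scattered: "\<And>t. \<lbrakk>t \<in> T; c \<le> t; t < sigma T t; P t\<rbrakk> \<Longrightarrow> P (sigma T t)"
    and right_dense: "\<And>t. \<lbrakk>t \<in> T; c \<le> t; sigma T t = t; P t\<rbrakk> \<Longrightarrow>
      \<exists>d>0. \<forall>s\<in>T. t < s \<and> s < t + d \<longrightarrow> P s"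
    and left_dense: "\<And>t. \<lbrakk>t \<in> T; c < t; \<And>s. \<lbrakk>s \<in> T; c \<le> s; s < t\<rbrakk> \<Longrightarrow> P s;
       \<And>d. 0 < d \<Longrightarrow> \<exists>s\<in>T. c \<le> s \<and> t - d < s \<and> s < t\<rbrakk> \<Longrightarrow> P t"
  shows "P t"
proof (rule ccontr)
  assume "\<not> P t"
  define F where "F = {s \<in> T. c \<le> s \<and> \<not> P s}"
  define m where "m = Inf F"
  have F: "F \<noteq> {}" "bdd_below F" using \<open>\<not> P t\<close> assms(1,2) by (auto simp: F_def intro!: bdd_belowI[of _ c])
  have "m \<in> closure F" unfolding m_def using F by (rule closure_contains_Inf)
  also have "closure F \<subseteq> closure T" by (rule closure_mono) (auto simp: F_def)
  finally have mT: "m \<in> T" using closed_T by simp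
  have cm: "c \<le> m" unfolding m_def using F by (intro cInf_greatest) (auto simp: F_def)
  have m_lower: "m \<le> s" if "s \<in> F" for s unfolding m_def using F that by (intro cInf_lower)
  have before: "P s" if "s \<in> T" "c \<le> s" "s < m" for s
    using m_lower[of s] that by (auto simp: F_def)
  have approx: "\<exists>s\<in>F. s < m + d" if "0 < d" for d
    using F that unfolding m_def by (metis add.commute cInf_lessD less_add_same_cancel2)
  show False
  proof (cases "P m")
    case True
    then have above: "m < s" if "s \<in> F" for s
      using m_lower[OF that] that by (auto simp: F_def less_le)
    show False
    proof (cases "sigma T m = m")
      case True
      from right_dense[OF mT cm True \<open>P m\<close>] obtain d
        where d: "0 < d" "\<forall>s\<in>T. m < s \<and> s < m + d \<longrightarrow> P s" by auto
      with approx[OF d(1)] above show False by (auto simp: F_def)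
    next
      case False
      with sigma_ge[OF mT] have sc: "m < sigma T m" by simp
      from approx[of "sigma T m - m"] sc obtain s where s: "s \<in> F" "s < sigma T m" by auto
      with sigma_le[OF mT, of s] above[OF s(1)] show False by (auto simp: F_def)
    qed
  next
    case False
    then have "c < m" using base cm by (auto simp: less_le)
    show False
    proof (cases "\<forall>d>0. \<exists>s\<in>T. c \<le> s \<and> m - d < s \<and> s < m")
      case True
      then show False using left_dense[OF mT \<open>c < m\<close>] before False by blast
    next
      case gap: False
      then obtain d where d: "0 < d" "\<And>s. \<lbrakk>s \<in> T; c \<le> s; s < m\<rbrakk> \<Longrightarrow> s \<le> m - d" by force
      define r where "r = Sup (T \<inter> {c..m - d})"
      have ne: "T \<inter> {c..m - d} \<noteq> {}" using cT \<open>c < m\<close> d(2)[of c] by auto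
      then have "r \<in> T \<inter> {c..m - d}" unfolding r_def
        using closed_T by (intro closed_contains_Sup) auto
      then have r: "r \<in> T" "c \<le> r" "r \<le> m - d" by auto
      have ub: "s \<le> r" if "s \<in> T" "c \<le> s" "s < m" for s unfolding r_def
        by (rule cSup_upper) (use d(2)[OF that] that in auto)
      have "sigma T r \<le> m" using sigma_le[OF r(1) mT] r d by auto
      moreover have "\<not> sigma T r < m"
      proof
        assume *: "sigma T r < m"
        have "c \<le> sigma T r" using r sigma_ge[OF r(1)] by simp
        then have "sigma T r = r" using ub[OF sigma_in[OF r(1)]] * sigma_ge[OF r(1)] by simp
        then obtain s where "s \<in> T" "r < s" "s < r + d" using right_dense_ex[OF r(1)] d by blast
        with ub[of s] r show False by auto
      qed
      ultimately have sr: "sigma T r = m" by simp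
      moreover have "r < sigma T r" "P r" using sr r d before by auto
      ultimately have "P m" using scattered[of r] r by auto
      with False show False by simp
    qed
  qed
qed

section \<open>Restriction to a half-line and the rules of delta differentiation\<close>

lemma restrict: "unbounded_time_scale (T \<inter> {c..})"
proof
  show "closed (T \<inter> {c..})" using closed_T by auto
  fix t assume "t \<in> T \<inter> {c..}"
  then show "\<exists>s\<in>T \<inter> {c..}. t < s" using unbounded_T[of t] by force
qed

lemma sigma_restrict: "c \<le> t \<Longrightarrow> sigma (T \<inter> {c..}) t = sigma T t"
proof -
  assume "c \<le> t"
  then have "{s \<in> T \<inter> {c..}. t < s} = {s \<in> T. t < s}" by auto
  moreover have "(\<exists>s\<in>T \<inter> {c..}. t < s) \<longleftrightarrow> (\<exists>s\<in>T. t < s)" using \<open>c \<le> t\<close> by force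
  ultimately show ?thesis by (simp add: sigma_def)
qed

lemma mu_restrict: "c \<le> t \<Longrightarrow> mu (T \<inter> {c..}) t = mu T t"
  by (simp add: mu_def sigma_restrict)

text \<open>The definition admits s = t for every tolerance, so the error at t is below every
  positive number.\<close>

lemma has_delta_derivative_jump:
  assumes "t \<in> T" "has_delta_derivative T f D t"
  shows "f (sigma T t) = f t + mu T t *\<^sub>R D"
proof -
  have "norm (f (sigma T t) - f t - (sigma T t - t) *\<^sub>R D) \<le> e * \<bar>sigma T t - t\<bar>" if "0 < e" for e
    using assms that unfolding has_delta_derivative_def by force
  then have "norm (f (sigma T t) - f t - (sigma T t - t) *\<^sub>R D) \<le> 0 + e" if "0 < e" for e
    using that by (cases "\<bar>sigma T t - t\<bar> = 0")
      (force, metis add_0 divide_pos_pos nonzero_eq_divide_eq zero_less_abs_iff abs_zero)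
  then have "norm (f (sigma T t) - f t - (sigma T t - t) *\<^sub>R D) \<le> 0" by (rule field_le_epsilon)
  then show ?thesis by (simp add: mu_def algebra_simps)
qed

lemma has_delta_derivative_dense_iff:
  assumes "t \<in> T" "sigma T t = t"
  shows "has_delta_derivative T f D t \<longleftrightarrow> (f has_vector_derivative D) (at t within T)"
proof -
  have "norm (f t - f s - (t - s) *\<^sub>R D) = norm (f s - f t - (s - t) *\<^sub>R D)" for s
    by (subst norm_minus_cancel[symmetric]) (simp add: algebra_simps)
  then show ?thesis
    unfolding has_delta_derivative_def has_vector_derivative_def has_derivative_within_alt
    by (simp add: assms bounded_linear_scaleR_left abs_minus_commute)
qed

text \<open>Near t the distance from s to \<open>sigma T t\<close> stays between m/2 and 2m, where m
  is the graininess, so the defining estimate bounds its left-hand side by an arbitrarily small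
  constant: it is plain continuity.\<close>

lemma has_delta_derivative_scattered_iff:
  assumes t: "t \<in> T" "t < sigma T t"
  shows "has_delta_derivative T f D t \<longleftrightarrow>
    f (sigma T t) = f t + mu T t *\<^sub>R D \<and> continuous (at t within T) f"
proof (cases "f (sigma T t) = f t + mu T t *\<^sub>R D")
  case False
  then show ?thesis using has_delta_derivative_jump[OF t(1)] by blast
next
  case True
  define m where "m = mu T t"
  \<comment> \<open>Once the jump condition is inserted, the error in the definition at s is g t - g
    s.\<close>
  define g where "g s = f s - s *\<^sub>R D" for s
  have m: "0 < m" "sigma T t = t + m" using t by (auto simp: m_def mu_def)
  have J: "f (sigma T t) = f t + m *\<^sub>R D" using True by (simp add: m_def)
  have "f (sigma T t) - f s - (sigma T t - s) *\<^sub>R D = g t - g s" for s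
    unfolding J unfolding m(2) g_def by (simp add: algebra_simps)
  then have eq: "norm (f (sigma T t) - f s - (sigma T t - s) *\<^sub>R D) = norm (g s - g t)" for s
    by (simp add: norm_minus_commute)
  have "continuous (at t within T) f \<longleftrightarrow> continuous (at t within T) g"
  proof
    assume "continuous (at t within T) g"
    then have "continuous (at t within T) (\<lambda>s. g s + s *\<^sub>R D)" by (intro continuous_intros)
    then show "continuous (at t within T) f" by (simp add: g_def)
  qed (unfold g_def, intro continuous_intros)
  also have "\<dots> \<longleftrightarrow> has_delta_derivative T f D t"
    unfolding has_delta_derivative_def eq continuous_within_eps_delta dist_norm real_norm_def
  proof (intro iffI allI impI)
    fix e :: real
    assume "\<forall>e>0. \<exists>d>0. \<forall>s\<in>T. \<bar>s - t\<bar> < d \<longrightarrow> norm (g s - g t) < e" and e: "0 < e"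
    then obtain d where d: "0 < d" "\<forall>s\<in>T. \<bar>s - t\<bar> < d \<longrightarrow> norm (g s - g t) < e * (m / 2)"
      using m(1) by (metis half_gt_zero mult_pos_pos)
    have "norm (g s - g t) \<le> e * \<bar>sigma T t - s\<bar>" if s: "s \<in> T" "\<bar>s - t\<bar> < min d (m / 2)" for s
    proof -
      have "m / 2 \<le> \<bar>sigma T t - s\<bar>" using s m by linarith
      then have "e * (m / 2) \<le> e * \<bar>sigma T t - s\<bar>" using e by (intro mult_left_mono) auto
      moreover have "norm (g s - g t) < e * (m / 2)" using d(2) s by simp
      ultimately show ?thesis by linarith
    qed
    then show "\<exists>d>0. \<forall>s\<in>T. \<bar>s - t\<bar> < d \<longrightarrow> norm (g s - g t) \<le> e * \<bar>sigma T t - s\<bar>"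
      using d(1) m(1) by (intro exI[of _ "min d (m / 2)"]) auto
  next
    fix e :: real
    assume "\<forall>e>0. \<exists>d>0. \<forall>s\<in>T. \<bar>s - t\<bar> < d \<longrightarrow> norm (g s - g t) \<le> e * \<bar>sigma T t - s\<bar>"
      and e: "0 < e"
    moreover have "0 < e / (3 * m)" using e m by simp
    ultimately obtain d where d: "0 < d"
      "\<forall>s\<in>T. \<bar>s - t\<bar> < d \<longrightarrow> norm (g s - g t) \<le> e / (3 * m) * \<bar>sigma T t - s\<bar>" by blast
    have "norm (g s - g t) < e" if s: "s \<in> T" "\<bar>s - t\<bar> < min d m" for s
    proof -
      have "\<bar>sigma T t - s\<bar> \<le> 2 * m" using s m by linarith
      then have "e / (3 * m) * \<bar>sigma T t - s\<bar> \<le> e / (3 * m) * (2 * m)"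
        using e m by (intro mult_left_mono) auto
      also have "\<dots> < e" using e m by (simp add: field_simps)
      finally show ?thesis using d(2) s by fastforce
    qed
    then show "\<exists>d>0. \<forall>s\<in>T. \<bar>s - t\<bar> < d \<longrightarrow> norm (g s - g t) < e"
      using d(1) m(1) by (intro exI[of _ "min d m"]) auto
  qed
  finally show ?thesis using True by simp
qed

text \<open>A common form for scattered and dense points, so that the rules below reduce to those
  for continuity and ordinary derivatives.\<close>

lemma has_delta_derivative_iff:
  assumes "t \<in> T"
  shows "has_delta_derivative T f D t \<longleftrightarrow>
    f (sigma T t) = f t + mu T t *\<^sub>R D \<and> continuous (at t within T) f \<and>
    (sigma T t = t \<longrightarrow> (f has_vector_derivative D) (at t within T))"
  using has_delta_derivative_scattered_iff[OF assms] has_delta_derivative_dense_iff[OF assms]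
    sigma_ge[OF assms]
  by (cases "sigma T t = t") (auto simp: mu_def dest: has_vector_derivative_continuous)

lemma has_delta_derivative_continuous_on:
  assumes "\<And>t. t \<in> T \<Longrightarrow> has_delta_derivative T f (f' t) t"
  shows "continuous_on T f"
  using assms by (auto simp: continuous_on_eq_continuous_within has_delta_derivative_iff)

lemma has_delta_derivative_bounded_linear:
  assumes "t \<in> T" "bounded_linear g" "has_delta_derivative T f D t"
  shows "has_delta_derivative T (\<lambda>t. g (f t)) (g D) t"
proof -
  interpret g: bounded_linear g by fact
  have "continuous (at t within T) (\<lambda>t. g (f t))"
    if "continuous (at t within T) f" using that by (rule g.continuous)
  then show ?thesis using assms
    by (auto simp: has_delta_derivative_iff g.add g.scaleR intro!: g.has_vector_derivative)
qed

lemma has_delta_derivative_add: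
  assumes "t \<in> T" "has_delta_derivative T f D t" "has_delta_derivative T g E t"
  shows "has_delta_derivative T (\<lambda>t. f t + g t) (D + E) t"
  using assms by (auto simp: has_delta_derivative_iff algebra_simps
     intro!: continuous_intros has_vector_derivative_add)

lemma has_delta_derivative_scaleR:
  assumes "t \<in> T" "has_delta_derivative T f D t"
  shows "has_delta_derivative T (\<lambda>t. a *\<^sub>R f t) (a *\<^sub>R D) t"
  using assms(1) bounded_linear_scaleR_right assms(2) by (rule has_delta_derivative_bounded_linear)

lemma has_delta_derivative_diff:
  assumes "t \<in> T" "has_delta_derivative T f D t" "has_delta_derivative T g E t"
  shows "has_delta_derivative T (\<lambda>t. f t - g t) (D - E) t"
  using assms by (auto simp: has_delta_derivative_iff algebra_simps
     intro!: continuous_intros has_vector_derivative_diff)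

lemma has_delta_derivative_cong:
  assumes "t \<in> T" "\<And>s. s \<in> T \<Longrightarrow> f s = g s"
  shows "has_delta_derivative T f D t \<longleftrightarrow> has_delta_derivative T g D t"
  using assms sigma_in[OF assms(1)] unfolding has_delta_derivative_def by auto

lemma has_delta_derivative_restrict:
  assumes "has_delta_derivative T f D t" "c \<le> t"
  shows "has_delta_derivative (T \<inter> {c..}) f D t"
  using assms unfolding has_delta_derivative_def by (simp add: sigma_restrict) blast

text \<open>At the cut c the restricted derivative sees only points to the right. The last premise
  says that t is off the cut or that nothing was cut away.\<close>

lemma has_delta_derivative_unrestrict:
  assumes "has_delta_derivative (T \<inter> {c..}) f D t" "c \<le> t" "c < t \<or> T \<subseteq> {c..}"
  shows "has_delta_derivative T f D t"
proof (cases "T \<subseteq> {c..}")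
  case True
  then have "T \<inter> {c..} = T" by auto
  with assms show ?thesis by simp
next
  case False
  with assms have "c < t" by auto
  show ?thesis unfolding has_delta_derivative_def
  proof safe
    fix e :: real assume "0 < e"
    then obtain d where d: "0 < d" "\<And>s. \<lbrakk>s \<in> T; c \<le> s; \<bar>s - t\<bar> < d\<rbrakk> \<Longrightarrow>
      norm (f (sigma T t) - f s - (sigma T t - s) *\<^sub>R D) \<le> e * \<bar>sigma T t - s\<bar>"
      using assms unfolding has_delta_derivative_def by (auto simp: sigma_restrict)
    show "\<exists>\<delta>>0. \<forall>s\<in>T. \<bar>s - t\<bar> < \<delta> \<longrightarrow>
      norm (f (sigma T t) - f s - (sigma T t - s) *\<^sub>R D) \<le> e * \<bar>sigma T t - s\<bar>"
      by (rule exI[of _ "min d (t - c)"]) (use d \<open>c < t\<close> in auto)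
  qed
qed

text \<open>Mean value argument: for each slope e' > 0 the bound e' (t - c) on the increment
  propagates by induction along T, exactly at jumps, by the derivative at right-dense points and by
  continuity at left-dense ones.\<close>

lemma zero_delta_derivative_constant:
  assumes "\<And>t. t \<in> T \<Longrightarrow> has_delta_derivative T f 0 t" and "c \<in> T" "t \<in> T" "c \<le> t"
  shows "f t = f c"
proof -
  note D = assms(1)[unfolded has_delta_derivative_iff]
  have cont: "continuous_on T f" using assms(1) by (rule has_delta_derivative_continuous_on)
  have "norm (f t - f c) \<le> 0 + e" if "0 < e" for e
  proof -
    \<comment> \<open>The 1 keeps the denominator positive for t = c.\<close>
    define e' where "e' = e / (t - c + 1)"
    have e': "0 < e'" using that assms by (simp add: e'_def)
    have "norm (f t - f c) \<le> e' * (t - c)"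
      using assms(3,4,2)
    proof (induction rule: time_scale_induct)
      case base show ?case by simp
    next
      case (scattered t)
      then have "f (sigma T t) = f t" using assms(1)[of t] by (simp add: has_delta_derivative_iff)
      moreover have "e' * (t - c) \<le> e' * (sigma T t - c)" using scattered e' by simp
      ultimately show ?case using scattered by simp
    next
      case (right_dense t)
      then have "(f has_vector_derivative 0) (at t within T)"
        using assms(1)[of t] by (simp add: has_delta_derivative_iff)
      then obtain d where d: "0 < d" "\<And>s. \<lbrakk>s \<in> T; \<bar>s - t\<bar> < d\<rbrakk> \<Longrightarrow> norm (f s - f t) \<le> e' * \<bar>s - t\<bar>"
        using e' unfolding has_vector_derivative_def has_derivative_within_alt by (force simp: )
      show ?case
      proof (intro exI[of _ d] conjI d ballI impI)
        fix s assume s: "s \<in> T" "t < s \<and> s < t + d"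
        have "norm (f s - f c) \<le> norm (f s - f t) + norm (f t - f c)"
          by (metis diff_add_cancel add_diff_eq norm_triangle_ineq)
        also have "\<dots> \<le> e' * (s - t) + e' * (t - c)" using d(2)[OF s(1)] s right_dense by auto
        finally show "norm (f s - f c) \<le> e' * (s - c)" by (simp add: algebra_simps)
      qed
    next
      case (left_dense t)
      show ?case
      proof (rule ccontr)
        assume "\<not> ?case"
        then have pos: "0 < norm (f t - f c) - e' * (t - c)" by simp
        have "continuous (at t within T) f" using assms(1)[OF left_dense(1)] left_dense(1)
          by (simp add: has_delta_derivative_iff)
        then obtain d where d: "0 < d" "\<And>s. \<lbrakk>s \<in> T; \<bar>s - t\<bar> < d\<rbrakk> \<Longrightarrow> norm (f s - f t) < norm (f t - f c) - e' * (t - c)"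
          using pos unfolding continuous_within_eps_delta dist_norm real_norm_def by blast
        obtain s where s: "s \<in> T" "c \<le> s" "t - d < s" "s < t" using left_dense.hyps(3)[OF d(1)] by auto
        have "norm (f t - f c) \<le> norm (f s - f t) + norm (f s - f c)"
          by (metis diff_add_cancel add_diff_eq norm_triangle_ineq norm_minus_commute)
        also have "norm (f s - f c) \<le> e' * (s - c)" using left_dense.IH[OF s(1,2,4)] .
        also have "\<dots> \<le> e' * (t - c)" using s e' by simp
        finally show False using d(2)[OF s(1)] s by auto
      qed
    qed
    also have "\<dots> \<le> e" using that assms by (simp add: e'_def divide_simps)
    finally show ?thesis by simp
  qed
  then have "norm (f t - f c) \<le> 0" by (rule field_le_epsilon)
  then show ?thesis by simp
qed

end

section \<open>Regulated functions and the delta integral\<close>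

lemma regulated_approximation:
  fixes g :: "real \<Rightarrow> 'a::banach"
  assumes reg: "\<And>x. x \<in> {a..b} \<Longrightarrow> \<exists>d>0. \<exists>l l'.
      (\<forall>y\<in>{a..b}. x - d < y \<and> y < x \<longrightarrow> norm (g y - l) \<le> e) \<and>
      (\<forall>y\<in>{a..b}. x < y \<and> y < x + d \<longrightarrow> norm (g y - l') \<le> e)"
    and e: "0 < e"
  obtains h B where "h integrable_on {a..b}" "\<forall>x\<in>{a..b}. norm (g x - h x) \<le> e"
    "\<forall>x\<in>{a..b}. norm (g x) \<le> B"
proof -
  from reg have "\<exists>d l l'. 0 < d \<and>
      (\<forall>y\<in>{a..b}. x - d < y \<and> y < x \<longrightarrow> norm (g y - l) \<le> e) \<and>
      (\<forall>y\<in>{a..b}. x < y \<and> y < x + d \<longrightarrow> norm (g y - l') \<le> e)" if "x \<in> {a..b}" for x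
    using that by meson
  then obtain d l l' where dl: "\<And>x. x \<in> {a..b} \<Longrightarrow> 0 < d x"
      "\<And>x y. \<lbrakk>x \<in> {a..b}; y \<in> {a..b}; x - d x < y; y < x\<rbrakk> \<Longrightarrow> norm (g y - l x) \<le> e"
      "\<And>x y. \<lbrakk>x \<in> {a..b}; y \<in> {a..b}; x < y; y < x + d x\<rbrakk> \<Longrightarrow> norm (g y - l' x) \<le> e"
    by metis
  \<comment> \<open>On a division fine for this gauge, each piece stays in the neighbourhood of its
    tag, where g is within e of one constant left of the tag and of another right of it. A step
    function with these two values approximates g, and finitely many tags give the bound
    \<open>B\<close>.\<close>
  define d' where "d' x = (if x \<in> {a..b} then d x else 1)" for x
  have "gauge (\<lambda>x. ball x (d' x))" by (rule gauge_ball_dependent) (use dl in \<open>auto simp: d'_def\<close>)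
  then obtain p where p: "p tagged_division_of {a..b}" "(\<lambda>x. ball x (d' x)) fine p"
    by (rule fine_division_exists_real)
  have tag: "x \<in> {a..b}" "x \<in> k" "k \<subseteq> {a..b}" "k \<subseteq> {x - d x <..< x + d x}" "\<exists>u v. k = {u..v}"
    if "(x, k) \<in> p" for x k
  proof -
    show "x \<in> k" "k \<subseteq> {a..b}" using tagged_division_ofD(2,3)[OF p(1) that] by auto
    then show x: "x \<in> {a..b}" by auto
    show "\<exists>u v. k = {u..v}" using tagged_division_ofD(4)[OF p(1) that] by auto
    have "k \<subseteq> ball x (d' x)" using fineD[OF p(2) that] .
    then show "k \<subseteq> {x - d x <..< x + d x}" using x
      by (auto simp: d'_def ball_def dist_real_def subset_eq abs_if split: if_splits)
  qed
  define B where "B = Max (insert 0 ((\<lambda>(x, k). norm (l x) + norm (l' x) + norm (g x) + e) ` p))"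
  have fin: "finite p" using p(1) by (rule tagged_division_of_finite)
  have B: "norm (l x) + norm (l' x) + norm (g x) + e \<le> B" if "(x, k) \<in> p" for x k
    unfolding B_def using that fin by (intro Max_ge) auto
  have bound: "\<forall>y\<in>{a..b}. norm (g y) \<le> B"
  proof
    fix y assume y: "y \<in> {a..b}"
    then obtain x k where xk: "(x, k) \<in> p" "y \<in> k"
      using tagged_division_ofD(6)[OF p(1)] by blast
    note t = tag[OF xk(1)]
    consider "y < x" | "y = x" | "x < y" by linarith
    then show "norm (g y) \<le> B"
    proof cases
      case 1
      then have "norm (g y - l x) \<le> e" using dl(2)[OF t(1) y] t xk by auto
      then have "norm (g y) \<le> norm (l x) + e" using norm_triangle_sub[of "g y" "l x"] by linarith
      then show ?thesis using B[OF xk(1)] norm_ge_zero[of "l' x"] norm_ge_zero[of "g x"] by linarith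
    next
      case 2
      show ?thesis unfolding 2
        using B[OF xk(1)] norm_ge_zero[of "l' x"] norm_ge_zero[of "l x"] e by linarith
    next
      case 3
      then have "norm (g y - l' x) \<le> e" using dl(3)[OF t(1) y] t xk by auto
      then have "norm (g y) \<le> norm (l' x) + e" using norm_triangle_sub[of "g y" "l' x"] by linarith
      then show ?thesis using B[OF xk(1)] norm_ge_zero[of "l x"] norm_ge_zero[of "g x"] by linarith
    qed
  qed
  have piece: "\<exists>h. (\<forall>y\<in>k. norm (g y - h y) \<le> e) \<and> h integrable_on k" if k: "k \<in> snd ` p" for k
  proof -
    from k obtain x where xk: "(x, k) \<in> p" by auto
    note t = tag[OF xk]
    from t(5) obtain u v where k: "k = {u..v}" by auto
    define h where "h y = (if y < x then l x else if y = x then g x else l' x)" for y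
    have "h integrable_on {u..x}"
      by (rule integrable_spike_finite[of "{x}" _ _ "\<lambda>_. l x"]) (auto simp: h_def)
    moreover have "h integrable_on {x..v}"
      by (rule integrable_spike_finite[of "{x}" _ _ "\<lambda>_. l' x"]) (auto simp: h_def)
    ultimately have "h integrable_on k" unfolding k
      by (rule Henstock_Kurzweil_Integration.integrable_combine[rotated 2]) (use t k in auto)
    moreover have "norm (g y - h y) \<le> e" if y: "y \<in> k" for y
      using dl(2,3)[OF t(1), of y] subsetD[OF t(3) y] subsetD[OF t(4) y] e by (auto simp: h_def)
    ultimately show ?thesis by blast
  qed
  have "snd ` p division_of cbox a b"
    using division_of_tagged_division[OF p(1)] by simp
  then obtain h where "\<forall>x\<in>cbox a b. norm (g x - h x) \<le> e" "h integrable_on cbox a b"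
    by (rule approximable_on_division[of e "snd ` p" a b g, rotated]) (use piece e in auto)
  with bound show ?thesis by (intro that[of h B]) auto
qed

text \<open>Composing with \<open>last_point T\<close> extends a function on $T$ to the line, constantly over the gaps;
  the delta integral becomes an ordinary integral.\<close>

definition last_point :: "real set \<Rightarrow> real \<Rightarrow> real" where
  "last_point T s = Sup (T \<inter> {..s})"

text \<open>A least point c makes \<open>T \<inter> {..s}\<close> nonempty for every s \<ge> c, so
  that \<open>last_point T s\<close> is a point of T, and it serves as lower limit of
  integration.\<close>

locale rooted_time_scale = unbounded_time_scale +
  fixes c :: real
  assumes root_in: "c \<in> T" and root_le: "\<And>t. t \<in> T \<Longrightarrow> c \<le> t"
begin

lemma floor_in: assumes "c \<le> s" shows "last_point T s \<in> T \<inter> {..s}"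
  unfolding last_point_def using assms root_in closed_T
  by (intro closed_contains_Sup) auto

lemma floor_props:
  assumes "c \<le> s"
  shows "last_point T s \<in> T" "last_point T s \<le> s" "c \<le> last_point T s"
  using floor_in[OF assms] root_le by auto

lemma floor_ge: "\<lbrakk>t \<in> T; t \<le> s\<rbrakk> \<Longrightarrow> t \<le> last_point T s"
  unfolding last_point_def by (rule cSup_upper) auto

lemma floor_eq [simp]: "t \<in> T \<Longrightarrow> last_point T t = t"
  using floor_ge[of t t] floor_props[of t] root_le by (auto intro: antisym)

lemma floor_eqI: "\<lbrakk>r \<in> T; r \<le> s; \<And>t. \<lbrakk>t \<in> T; t \<le> s\<rbrakk> \<Longrightarrow> t \<le> r\<rbrakk> \<Longrightarrow> last_point T s = r"
  using floor_ge[of r s] floor_props[of s] root_le[of r] by (intro antisym) auto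

lemma sigma_scattered_floor:
  assumes "t \<in> T" "t \<le> y" "y < sigma T t" shows "last_point T y = t"
  using assms sigma_le[of t] by (intro floor_eqI) force+

text \<open>Off T and inside gaps \<open>last_point\<close> is locally constant. At a right-dense
  point rd-continuity gives continuity, at a left-dense one a left limit; these are the only
  one-sided limits that remain.\<close>

lemma rd_continuous_regulated:
  fixes f :: "real \<Rightarrow> 'a::real_normed_vector"
  assumes rd: "rd_continuous T f" and x: "c \<le> x" and e: "0 < e"
  shows "\<exists>d>0. \<exists>l l'.
      (\<forall>y\<in>{c..}. x - d < y \<and> y < x \<longrightarrow> norm (f (last_point T y) - l) \<le> e) \<and>
      (\<forall>y\<in>{c..}. x < y \<and> y < x + d \<longrightarrow> norm (f (last_point T y) - l') \<le> e)"
proof (cases "x \<in> T")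
  case False
  then obtain d where d: "0 < d" "ball x d \<subseteq> - T"
    using closed_T openE[of "- T" x] by auto
  have const: "last_point T y = last_point T x" if "c \<le> y" "x - d < y" "y < x + d" for y
  proof (rule floor_eqI)
    have gap: "t \<le> x - d" if "t \<in> T" "t < x + d" for t
      using d(2) that by (force simp: dist_real_def)
    show "last_point T x \<in> T" using floor_props x by auto
    then show "last_point T x \<le> y" using gap[of "last_point T x"] floor_props[OF x] that d by force
    fix t assume "t \<in> T" "t \<le> y"
    then show "t \<le> last_point T x" using gap[of t] that d by (intro floor_ge) auto
  qed
  show ?thesis
  proof (intro exI[of _ d] conjI exI[of _ "f (last_point T x)"] ballI impI d(1))
    fix y assume "y \<in> {c..}" "x - d < y \<and> y < x"
    then have "last_point T y = last_point T x" by (intro const) auto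
    then show "norm (f (last_point T y) - f (last_point T x)) \<le> e" using e by simp
  next
    fix y assume "y \<in> {c..}" "x < y \<and> y < x + d"
    then have "last_point T y = last_point T x" by (intro const) auto
    then show "norm (f (last_point T y) - f (last_point T x)) \<le> e" using e by simp
  qed
next
  case True
  have "\<exists>d>0. \<exists>l. \<forall>y\<in>{c..}. x < y \<and> y < x + d \<longrightarrow> norm (f (last_point T y) - l) \<le> e"
  proof (cases "sigma T x = x")
    case dense: True
    then have "continuous (at x within T) f" using rd True by (auto simp: rd_continuous_def)
    then obtain d where d: "0 < d" "\<And>s. \<lbrakk>s \<in> T; \<bar>s - x\<bar> < d\<rbrakk> \<Longrightarrow> norm (f s - f x) < e"
      using e unfolding continuous_within_eps_delta dist_norm real_norm_def by blast
    show ?thesis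
    proof (intro exI[of _ d] exI[of _ "f x"] conjI d ballI impI)
      fix y assume y: "y \<in> {c..}" "x < y \<and> y < x + d"
      then show "norm (f (last_point T y) - f x) \<le> e"
        using d(2)[of "last_point T y"] floor_props[of y] floor_ge[OF True, of y] by force
    qed
  next
    case False
    with sigma_ge[OF True] have "x < sigma T x" by simp
    moreover have "norm (f (last_point T y) - f x) \<le> e" if "x < y" "y < x + (sigma T x - x)" for y
      using sigma_scattered_floor[OF True, of y] that e by simp
    ultimately show ?thesis
      by (intro exI[of _ "sigma T x - x"] conjI exI[of _ "f x"]) auto
  qed
  moreover have "\<exists>d>0. \<exists>l. \<forall>y\<in>{c..}. x - d < y \<and> y < x \<longrightarrow> norm (f (last_point T y) - l) \<le> e"
  proof (cases "\<exists>d>0. \<forall>s\<in>T. \<not> (x - d < s \<and> s < x)")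
    case True
    then obtain d where d: "0 < d" "\<And>s. \<lbrakk>s \<in> T; s < x\<rbrakk> \<Longrightarrow> s \<le> x - d" by force
    show ?thesis
    proof (intro exI[of _ d] exI[of _ "f (last_point T (x - d))"] conjI d ballI impI)
      fix y assume y: "y \<in> {c..}" "x - d < y \<and> y < x"
      have "c \<le> x - d" using d(2)[OF root_in] y by auto
      have "last_point T y = last_point T (x - d)"
        using floor_props[OF \<open>c \<le> x - d\<close>] floor_ge[of _ "x - d"] d y by (intro floor_eqI) force+
      then show "norm (f (last_point T y) - f (last_point T (x - d))) \<le> e" using e by simp
    qed
  next
    case False
    then have dense: "\<exists>s\<in>T. x - d < s \<and> s < x" if "0 < d" for d using that by blast
    from dense[of 1] have ex: "\<exists>s\<in>T. s < x" by auto
    moreover have "rho T x = x"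
    proof -
      have "Sup {s \<in> T. s < x} \<le> x" using ex by (intro cSup_least) auto
      moreover have "\<not> Sup {s \<in> T. s < x} < x"
      proof
        assume "Sup {s \<in> T. s < x} < x"
        then obtain s where s: "s \<in> T" "Sup {s \<in> T. s < x} < s" "s < x"
          using dense[of "x - Sup {s \<in> T. s < x}"] by auto
        have "s \<le> Sup {s \<in> T. s < x}" by (rule cSup_upper) (use s in \<open>auto intro!: bdd_aboveI[of _ x]\<close>)
        with s show False by simp
      qed
      ultimately show ?thesis using ex by (simp add: rho_def)
    qed
    ultimately obtain l where "(f \<longlongrightarrow> l) (at x within T \<inter> {..<x})"
      using rd \<open>x \<in> T\<close> unfolding rd_continuous_def by blast
    then have "eventually (\<lambda>s. dist (f s) l < e) (at x within T \<inter> {..<x})"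
      using e by (rule tendstoD)
    then obtain d where d: "0 < d" "\<And>s. \<lbrakk>s \<in> T; s < x; \<bar>s - x\<bar> < d\<rbrakk> \<Longrightarrow> norm (f s - l) < e"
      unfolding eventually_at dist_norm by auto
    \<comment> \<open>For y in (x - d, x) the point \<open>last_point T y\<close> might lie before x
      - d. Beyond a point s0 of T in that interval it cannot fall below s0.\<close>
    obtain s0 where s0: "s0 \<in> T" "x - d < s0" "s0 < x" using dense[OF d(1)] by auto
    show ?thesis
    proof (intro exI[of _ "x - s0"] exI[of _ l] conjI ballI impI)
      show "0 < x - s0" using s0 by simp
      fix y assume y: "y \<in> {c..}" "x - (x - s0) < y \<and> y < x"
      then show "norm (f (last_point T y) - l) \<le> e"
        using d(2)[of "last_point T y"] floor_props[of y] floor_ge[OF s0(1), of y] s0 by force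
    qed
  qed
  ultimately obtain d d' l l' where dd: "0 < d" "0 < d'"
    and l: "\<forall>y\<in>{c..}. x - d < y \<and> y < x \<longrightarrow> norm (f (last_point T y) - l) \<le> e"
    and l': "\<forall>y\<in>{c..}. x < y \<and> y < x + d' \<longrightarrow> norm (f (last_point T y) - l') \<le> e"
    by blast
  have "\<exists>l l'.
      (\<forall>y\<in>{c..}. x - min d d' < y \<and> y < x \<longrightarrow> norm (f (last_point T y) - l) \<le> e) \<and>
      (\<forall>y\<in>{c..}. x < y \<and> y < x + min d d' \<longrightarrow> norm (f (last_point T y) - l') \<le> e)"
    by (rule exI[of _ l], rule exI[of _ l']) (use l l' in auto)
  then show ?thesis using dd by (intro exI[of _ "min d d'"]) auto
qed

lemma
  fixes f :: "real \<Rightarrow> 'a::banach"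
  assumes "rd_continuous T f"
  shows floor_integrable: "(\<lambda>y. f (last_point T y)) integrable_on {c..b}"
    and floor_bounded: "\<exists>B. \<forall>y\<in>{c..b}. norm (f (last_point T y)) \<le> B"
proof -
  have reg: "\<exists>d>0. \<exists>l l'.
      (\<forall>y\<in>{c..b}. x - d < y \<and> y < x \<longrightarrow> norm (f (last_point T y) - l) \<le> e) \<and>
      (\<forall>y\<in>{c..b}. x < y \<and> y < x + d \<longrightarrow> norm (f (last_point T y) - l') \<le> e)"
    if "0 < e" "x \<in> {c..b}" for x e
  proof -
    have "c \<le> x" using that by simp
    from rd_continuous_regulated[OF assms this that(1)] obtain d l l' where d: "0 < d"
      and l: "\<forall>y\<in>{c..}. x - d < y \<and> y < x \<longrightarrow> norm (f (last_point T y) - l) \<le> e"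
      and l': "\<forall>y\<in>{c..}. x < y \<and> y < x + d \<longrightarrow> norm (f (last_point T y) - l') \<le> e"
      by blast
    have "\<exists>l l'.
      (\<forall>y\<in>{c..b}. x - d < y \<and> y < x \<longrightarrow> norm (f (last_point T y) - l) \<le> e) \<and>
      (\<forall>y\<in>{c..b}. x < y \<and> y < x + d \<longrightarrow> norm (f (last_point T y) - l') \<le> e)"
      by (rule exI[of _ l], rule exI[of _ l']) (use l l' in auto)
    with d show ?thesis by auto
  qed
  have one: "0 < (1::real)" by simp
  obtain h B where "\<forall>y\<in>{c..b}. norm (f (last_point T y)) \<le> B"
    by (rule regulated_approximation[OF reg[OF one] one])
  then show "\<exists>B. \<forall>y\<in>{c..b}. norm (f (last_point T y)) \<le> B" ..
  have "(\<lambda>y. f (last_point T y)) integrable_on cbox c b"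
  proof (rule integrable_uniform_limit)
    fix e :: real assume e: "0 < e"
    obtain h B where "h integrable_on {c..b}" "\<forall>x\<in>{c..b}. norm (f (last_point T x) - h x) \<le> e"
      by (rule regulated_approximation[OF reg[OF e] e])
    then show "\<exists>g. (\<forall>x\<in>cbox c b. norm (f (last_point T x) - g x) \<le> e) \<and> g integrable_on cbox c b"
      by auto
  qed
  then show "(\<lambda>y. f (last_point T y)) integrable_on {c..b}" by simp
qed

lemma floor_integrable_on:
  fixes f :: "real \<Rightarrow> 'a::banach"
  assumes "rd_continuous T f" "c \<le> a"
  shows "(\<lambda>y. f (last_point T y)) integrable_on {a..b}"
  using floor_integrable[OF assms(1)] by (rule integrable_on_subinterval) (use assms in auto)

lemma floor_integral_diff:
  fixes f :: "real \<Rightarrow> 'a::banach"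
  assumes "rd_continuous T f" "c \<le> s" "s \<le> t"
  shows "integral {c..t} (\<lambda>y. f (last_point T y)) - integral {c..s} (\<lambda>y. f (last_point T y))
    = integral {s..t} (\<lambda>y. f (last_point T y))"
  using Henstock_Kurzweil_Integration.integral_combine[OF assms(2,3) floor_integrable[OF assms(1)]] by (simp add: algebra_simps)

text \<open>Both orders of s and t are covered because the delta derivative compares t with points
  on either side.\<close>

lemma floor_integral_bound:
  fixes f :: "real \<Rightarrow> 'a::banach"
  assumes rd: "rd_continuous T f" and ct: "s \<in> T" "t \<in> T"
    and b: "\<And>u. \<lbrakk>u \<in> T; min s t \<le> u; u \<le> max s t\<rbrakk> \<Longrightarrow> norm (f u - v) \<le> e"
  shows "norm (integral {c..t} (\<lambda>y. f (last_point T y)) - integral {c..s} (\<lambda>y. f (last_point T y)) - (t - s) *\<^sub>R v)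
    \<le> e * \<bar>t - s\<bar>"
proof -
  have *: "norm (integral {s..t} (\<lambda>y. f (last_point T y)) - (t - s) *\<^sub>R v) \<le> e * (t - s)"
    if st: "s \<le> t" "s \<in> T" "t \<in> T" and b: "\<And>u. \<lbrakk>u \<in> T; s \<le> u; u \<le> t\<rbrakk> \<Longrightarrow> norm (f u - v) \<le> e" for s t
  proof -
    have cs: "c \<le> s" using root_le st by auto
    have I: "((\<lambda>y. f (last_point T y) - v) has_integral
       (integral {s..t} (\<lambda>y. f (last_point T y)) - (t - s) *\<^sub>R v)) {s..t}"
      using has_integral_diff[OF integrable_integral[OF floor_integrable_on[OF rd cs, of t]]
          has_integral_const_real[of v s t]] st by simp
    have "norm (f (last_point T y) - v) \<le> e" if "y \<in> {s..t}" for y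
      using that cs floor_props[of y] floor_ge[OF st(2), of y] by (intro b) auto
    moreover have "0 \<le> e" using b[of s] st norm_ge_zero order_trans by blast
    ultimately show ?thesis using has_integral_bound_real[OF _ _ I, of e "{}"] st by simp
  qed
  show ?thesis
  proof (cases "s \<le> t")
    case True
    then show ?thesis using *[of s t] floor_integral_diff[OF rd _ True] root_le[OF ct(1)] b ct by auto
  next
    case False
    then have ts: "t \<le> s" by simp
    let ?I = "integral {t..s} (\<lambda>y. f (last_point T y))"
    have "norm (integral {c..t} (\<lambda>y. f (last_point T y)) - integral {c..s} (\<lambda>y. f (last_point T y)) - (t - s) *\<^sub>R v)
       = norm (?I - (s - t) *\<^sub>R v)"
      using floor_integral_diff[OF rd _ ts] root_le[OF ct(2)]
      by (subst norm_minus_cancel[symmetric]) (simp add: algebra_simps)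
    also have "\<dots> \<le> e * (s - t)" using *[of t s] b ct ts by auto
    finally show ?thesis using ts by simp
  qed
qed

lemma floor_integral_delta:
  fixes f :: "real \<Rightarrow> 'a::banach"
  assumes rd: "rd_continuous T f" and t: "t \<in> T"
  shows "has_delta_derivative T (\<lambda>t. integral {c..t} (\<lambda>y. f (last_point T y))) (f t) t"
    (is "has_delta_derivative T ?F _ _")
proof (cases "sigma T t = t")
  case True
  then have "continuous (at t within T) f" using rd t by (auto simp: rd_continuous_def)
  then have "\<exists>d>0. \<forall>s\<in>T. \<bar>s - t\<bar> < d \<longrightarrow> norm (f s - f t) < e" if "0 < e" for e
    using that unfolding continuous_within_eps_delta dist_norm real_norm_def by blast
  then have ball: "\<exists>d>0. \<forall>s\<in>T. \<bar>s - t\<bar> < d \<longrightarrow> norm (?F s - ?F t - (s - t) *\<^sub>R f t) \<le> e * \<bar>s - t\<bar>"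
    if "0 < e" for e
  proof -
    from \<open>\<And>e. 0 < e \<Longrightarrow> \<exists>d>0. \<forall>s\<in>T. \<bar>s - t\<bar> < d \<longrightarrow> norm (f s - f t) < e\<close>[OF that] obtain d
      where d: "0 < d" "\<And>s. \<lbrakk>s \<in> T; \<bar>s - t\<bar> < d\<rbrakk> \<Longrightarrow> norm (f s - f t) < e" by blast
    show ?thesis
    proof (intro exI[of _ d] conjI d ballI impI)
      fix s assume "s \<in> T" "\<bar>s - t\<bar> < d"
      then show "norm (?F s - ?F t - (s - t) *\<^sub>R f t) \<le> e * \<bar>s - t\<bar>"
        using t by (intro floor_integral_bound[OF rd] less_imp_le[OF d(2)]) auto
    qed
  qed
  show ?thesis unfolding has_delta_derivative_dense_iff[OF t True]
      has_vector_derivative_def has_derivative_within_alt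
    using ball by (simp add: bounded_linear_scaleR_left)
next
  case False
  with sigma_ge[OF t] have sc: "t < sigma T t" by simp
  have ct: "c \<le> t" using root_le t by auto
  \<comment> \<open>Over a gap the integrand is the constant f t except at the right end, a null
    set; the integral is therefore the jump that a delta derivative prescribes.\<close>
  have "integral {t..sigma T t} (\<lambda>y. f (last_point T y)) = integral {t..sigma T t} (\<lambda>y. f t)"
    by (rule integral_spike[of "{sigma T t}"])
      (use sigma_scattered_floor[OF t] in auto)
  then have "?F (sigma T t) = ?F t + mu T t *\<^sub>R f t"
    using floor_integral_diff[OF rd ct, of "sigma T t"] sc by (simp add: mu_def algebra_simps)
  moreover have "continuous_on {c..sigma T t} ?F"
    by (rule indefinite_integral_continuous_1[OF floor_integrable[OF rd]])
  then have "continuous (at t within T) ?F"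
  proof -
    have "continuous (at t within {c..sigma T t}) ?F"
      using \<open>continuous_on {c..sigma T t} ?F\<close> ct sc by (simp add: continuous_on_eq_continuous_within)
    then have "continuous (at t within T \<inter> {..<sigma T t}) ?F"
      by (rule continuous_within_subset) (use root_le in auto)
    moreover have "at t within T \<inter> {..<sigma T t} = at t within T"
      by (rule at_within_nhd[of _ "{..<sigma T t}"]) (use sc in auto)
    ultimately show ?thesis by simp
  qed
  ultimately show ?thesis using has_delta_derivative_scattered_iff[OF t sc] by blast
qed

lemma integral_of_delta_derivative:
  fixes f :: "real \<Rightarrow> 'a::banach"
  assumes rd: "rd_continuous T f" and F: "\<And>t. t \<in> T \<Longrightarrow> has_delta_derivative T F (f t) t"
    and t: "t \<in> T"
  shows "F t = F c + integral {c..t} (\<lambda>y. f (last_point T y))"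
proof -
  have "has_delta_derivative T (\<lambda>t. F t - integral {c..t} (\<lambda>y. f (last_point T y))) 0 t" if "t \<in> T" for t
    using has_delta_derivative_diff[OF that F[OF that] floor_integral_delta[OF rd that]] by simp
  from zero_delta_derivative_constant[OF this root_in t root_le[OF t]]
  show ?thesis by (simp add: algebra_simps)
qed

end

section \<open>Linear dynamic equations\<close>

text \<open>Intended for an rd-continuous coefficient applied to a continuous solution: the
  right-hand side of the equation is then rd-continuous and can be integrated.\<close>

lemma rd_continuous_bilinear:
  assumes "bounded_bilinear h" "rd_continuous T f" "continuous_on T x"
  shows "rd_continuous T (\<lambda>t. h (f t) (x t))"
  unfolding rd_continuous_def
proof (intro ballI conjI impI)
  interpret bounded_bilinear h by fact
  fix t assume t: "t \<in> T"
  have x: "(x \<longlongrightarrow> x t) (at t within T)" using assms(3) t by (simp add: continuous_on_def)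
  {
    assume "sigma T t = t"
    then have "(f \<longlongrightarrow> f t) (at t within T)"
      using assms(2) t by (auto simp: rd_continuous_def continuous_within)
    from tendsto[OF this x] show "continuous (at t within T) (\<lambda>t. h (f t) (x t))"
      by (simp add: continuous_within)
  }
  assume "(\<exists>s\<in>T. s < t) \<and> rho T t = t"
  then obtain l where "(f \<longlongrightarrow> l) (at t within T \<inter> {..<t})"
    using assms(2) t unfolding rd_continuous_def by blast
  moreover have "(x \<longlongrightarrow> x t) (at t within T \<inter> {..<t})" by (rule tendsto_within_subset[OF x]) auto
  ultimately show "\<exists>l. ((\<lambda>t. h (f t) (x t)) \<longlongrightarrow> l) (at t within T \<inter> {..<t})"
    using tendsto by blast
qed

lemma rd_continuous_linear:
  assumes "bounded_linear g" "rd_continuous T f"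
  shows "rd_continuous T (\<lambda>t. g (f t))"
  unfolding rd_continuous_def
proof (intro ballI conjI impI)
  interpret bounded_linear g by fact
  fix t assume t: "t \<in> T"
  {
    assume "sigma T t = t"
    then have "(f \<longlongrightarrow> f t) (at t within T)"
      using assms(2) t by (auto simp: rd_continuous_def continuous_within)
    from tendsto[OF this] show "continuous (at t within T) (\<lambda>t. g (f t))"
      by (simp add: continuous_within)
  }
  assume "(\<exists>s\<in>T. s < t) \<and> rho T t = t"
  then obtain l where "(f \<longlongrightarrow> l) (at t within T \<inter> {..<t})"
    using assms(2) t unfolding rd_continuous_def by blast
  then show "\<exists>l. ((\<lambda>t. g (f t)) \<longlongrightarrow> l) (at t within T \<inter> {..<t})"
    using tendsto by blast
qed

lemma continuous_imp_rd_continuous: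
  assumes "continuous_on T f" shows "rd_continuous T f"
  unfolding rd_continuous_def
proof (intro ballI conjI impI)
  fix t assume t: "t \<in> T"
  then show "continuous (at t within T) f" using assms by (simp add: continuous_on_eq_continuous_within)
  then have "(f \<longlongrightarrow> f t) (at t within T)" by (simp add: continuous_within)
  from tendsto_within_subset[OF this, of "T \<inter> {..<t}"]
  show "\<exists>l. (f \<longlongrightarrow> l) (at t within T \<inter> {..<t})" by auto
qed

context unbounded_time_scale begin

lemma rd_continuous_restrict:
  assumes "rd_continuous T f" shows "rd_continuous (T \<inter> {c..}) f"
  unfolding rd_continuous_def
proof (intro ballI conjI impI)
  fix t assume t: "t \<in> T \<inter> {c..}"
  {
    assume "sigma (T \<inter> {c..}) t = t"
    then have "continuous (at t within T) f"
      using assms t by (auto simp: rd_continuous_def sigma_restrict)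
    then show "continuous (at t within T \<inter> {c..}) f" by (rule continuous_within_subset) auto
  }
  assume *: "(\<exists>s\<in>T \<inter> {c..}. s < t) \<and> rho (T \<inter> {c..}) t = t"
  then have ex: "\<exists>s\<in>T \<inter> {c..}. s < t" and sup: "Sup {s \<in> T \<inter> {c..}. s < t} = t"
    unfolding rho_def by (blast, metis (mono_tags, lifting))
  have "Sup {s \<in> T \<inter> {c..}. s < t} \<le> Sup {s \<in> T. s < t}"
    using ex by (intro cSup_subset_mono) (auto intro!: bdd_aboveI[of _ t])
  moreover have "Sup {s \<in> T. s < t} \<le> t" using ex by (intro cSup_least) auto
  ultimately have "rho T t = t" using ex sup by (auto simp: rho_def)
  then obtain l where l: "(f \<longlongrightarrow> l) (at t within T \<inter> {..<t})"
    using assms t ex unfolding rd_continuous_def by blast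
  have "(f \<longlongrightarrow> l) (at t within T \<inter> {c..} \<inter> {..<t})" by (rule tendsto_within_subset[OF l]) auto
  then show "\<exists>l. (f \<longlongrightarrow> l) (at t within T \<inter> {c..} \<inter> {..<t})" ..
qed

lemma root: "c \<in> T \<Longrightarrow> rooted_time_scale (T \<inter> {c..}) c"
  using restrict by (auto simp: rooted_time_scale_def rooted_time_scale_axioms_def)

end

text \<open>Integrating the weight exp (2K(s - c)) against K gains a factor 1/2, and
  \<open>last_point\<close> never moves to the right, so the increasing weight dominates on gaps
  too. This factor 1/2 serves twice: in the growth bound and as contraction constant in the
  existence proof.\<close>

lemma (in rooted_time_scale) exp_weighted_bound:
  fixes f :: "real \<Rightarrow> 'a::banach"
  assumes rd: "rd_continuous T f" and K: "0 < K" and B: "0 \<le> B"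
    and f: "\<And>s. \<lbrakk>s \<in> T; s \<le> t\<rbrakk> \<Longrightarrow> norm (f s) \<le> K * B * exp (2 * K * (s - c))" and t: "c \<le> t"
  shows "norm (integral {c..t} (\<lambda>y. f (last_point T y))) \<le> B / 2 * exp (2 * K * (t - c))"
proof -
  have E: "((\<lambda>y. K * B * exp (2 * K * (y - c))) has_integral
      B / 2 * exp (2 * K * (t - c)) - B / 2 * exp (2 * K * (c - c))) {c..t}"
    by (rule fundamental_theorem_of_calculus[OF t])
      (auto simp: has_real_derivative_iff_has_vector_derivative[symmetric] intro!: derivative_eq_intros)
  have "norm (integral {c..t} (\<lambda>y. f (last_point T y))) \<le> integral {c..t} (\<lambda>y. K * B * exp (2 * K * (y - c)))"
  proof (rule Henstock_Kurzweil_Integration.integral_norm_bound_integral[OF floor_integrable[OF rd]])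
    show "(\<lambda>y. K * B * exp (2 * K * (y - c))) integrable_on {c..t}" using E by blast
    fix y assume y: "y \<in> {c..t}"
    then have p: "last_point T y \<in> T" "last_point T y \<le> y" using floor_props[of y] by auto
    then have "norm (f (last_point T y)) \<le> K * B * exp (2 * K * (last_point T y - c))" using f[of "last_point T y"] y by auto
    also have "\<dots> \<le> K * B * exp (2 * K * (y - c))" using p K B by (intro mult_left_mono) auto
    finally show "norm (f (last_point T y)) \<le> K * B * exp (2 * K * (y - c))" .
  qed
  also have "\<dots> = B / 2 * exp (2 * K * (t - c)) - B / 2" using integral_unique[OF E] by simp
  finally show ?thesis using B by simp
qed

text \<open>The state space is arbitrary so that vector solutions, the transition matrix and the
  scalar exponential share one theory. The bound K holds on all of T; for the matrix system it will
  come from periodicity.\<close>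

locale linear_dynamic = unbounded_time_scale +
  fixes L :: "real \<Rightarrow> 'a::euclidean_space \<Rightarrow>\<^sub>L 'a" and K :: real
  assumes rd: "rd_continuous T L" and bound: "\<And>t. t \<in> T \<Longrightarrow> norm (L t) \<le> K" and K_pos: "0 < K"
begin

definition flow :: "(real \<Rightarrow> 'a) \<Rightarrow> bool" where
  "flow x \<longleftrightarrow> (\<forall>t\<in>T. has_delta_derivative T x (blinfun_apply (L t) (x t)) t)"

lemma flow_continuous_on: "flow x \<Longrightarrow> continuous_on T x"
  unfolding flow_def by (rule has_delta_derivative_continuous_on) auto

lemma rd_flow: "continuous_on T x \<Longrightarrow> rd_continuous T (\<lambda>t. blinfun_apply (L t) (x t))"
  using bounded_bilinear_blinfun_apply rd by (rule rd_continuous_bilinear)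

lemma norm_L: "t \<in> T \<Longrightarrow> norm (blinfun_apply (L t) v) \<le> K * norm v"
  using norm_blinfun[of "L t" v] bound[of t] by (meson mult_right_mono norm_ge_zero order_trans)

lemma flow_add: "flow x \<Longrightarrow> flow y \<Longrightarrow> flow (\<lambda>t. x t + y t)"
  unfolding flow_def by (auto simp: blinfun.add_right intro: has_delta_derivative_add)

lemma flow_diff: "flow x \<Longrightarrow> flow y \<Longrightarrow> flow (\<lambda>t. x t - y t)"
  unfolding flow_def by (auto simp: blinfun.diff_right intro: has_delta_derivative_diff)

lemma flow_scaleR: "flow x \<Longrightarrow> flow (\<lambda>t. a *\<^sub>R x t)"
  unfolding flow_def by (auto simp: blinfun.scaleR_right intro: has_delta_derivative_scaleR)

lemma flow_cong: "(\<And>t. t \<in> T \<Longrightarrow> x t = y t) \<Longrightarrow> flow x \<longleftrightarrow> flow y"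
  unfolding flow_def using has_delta_derivative_cong[of _ x y] by auto

end

locale rooted_linear_dynamic = rooted_time_scale + linear_dynamic
begin

lemma flow_integral:
  assumes "flow x" "t \<in> T"
  shows "x t = x c + integral {c..t} (\<lambda>y. L (last_point T y) (x (last_point T y)))"
  by (rule integral_of_delta_derivative[of "\<lambda>t. L t (x t)", OF rd_flow])
    (use assms flow_continuous_on in \<open>auto simp: flow_def\<close>)

text \<open>At a maximum m of the weighted norm w on the compact set
  \<open>T \<inter> {c..b}\<close>, the integral equation and the factor 1/2 give w m \<le> norm (x
  c) + w m / 2, up to the weight. This is where the constants 2 and 2K come from.\<close>

lemma gronwall:
  assumes "flow x" "b \<in> T"
  shows "norm (x b) \<le> 2 * norm (x c) * exp (2 * K * (b - c))"
proof -
  define w where "w t = norm (x t) * exp (- (2 * K * (t - c)))" for t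
  have "compact (T \<inter> {c..b})" using closed_T by (intro closed_Int_compact) auto
  moreover have "T \<inter> {c..b} \<noteq> {}" using assms(2) root_le by auto
  moreover have "continuous_on (T \<inter> {c..b}) w" unfolding w_def
    by (intro continuous_intros continuous_on_subset[OF flow_continuous_on[OF assms(1)]]) auto
  ultimately obtain m where "m \<in> T \<inter> {c..b}" "\<And>t. t \<in> T \<inter> {c..b} \<Longrightarrow> w t \<le> w m"
    using continuous_attains_sup[of "T \<inter> {c..b}" w] by blast
  then have m: "m \<in> T" "m \<le> b" "\<And>t. \<lbrakk>t \<in> T; t \<le> b\<rbrakk> \<Longrightarrow> w t \<le> w m"
    using root_le by auto
  have w0: "0 \<le> w m" by (simp add: w_def)
  have x: "norm (x t) = w t * exp (2 * K * (t - c))" for t by (simp add: w_def exp_minus)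
  have "norm (integral {c..m} (\<lambda>y. L (last_point T y) (x (last_point T y)))) \<le> w m / 2 * exp (2 * K * (m - c))"
  proof (rule exp_weighted_bound[of "\<lambda>t. L t (x t)", OF rd_flow[OF flow_continuous_on[OF assms(1)]] K_pos w0])
    fix s assume s: "s \<in> T" "s \<le> m"
    have "norm (L s (x s)) \<le> K * norm (x s)" by (rule norm_L[OF s(1)])
    also have "\<dots> \<le> K * (w m * exp (2 * K * (s - c)))" unfolding x
      using m(3)[of s] s m K_pos by (intro mult_left_mono mult_right_mono) auto
    finally show "norm (L s (x s)) \<le> K * w m * exp (2 * K * (s - c))" by simp
  qed (use root_le m in auto)
  then have "norm (x m) \<le> norm (x c) + w m / 2 * exp (2 * K * (m - c))"
    unfolding flow_integral[OF assms(1) m(1)] by (meson add_left_mono norm_triangle_le)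
  then have "w m * exp (2 * K * (m - c)) / 2 \<le> norm (x c)" unfolding x[of m] by (simp add: algebra_simps)
  moreover have "w m * 1 \<le> w m * exp (2 * K * (m - c))"
    using w0 K_pos root_le[OF m(1)] by (intro mult_left_mono) auto
  ultimately have "w m \<le> 2 * norm (x c)" by simp
  then have "w b \<le> 2 * norm (x c)" using m(3)[of b] assms by simp
  then show ?thesis unfolding x[of b] by (intro mult_right_mono) auto
qed

lemma flow_increment:
  assumes "flow x" "b \<in> T"
  shows "norm (x b - x c) \<le> 2 * K * (b - c) * norm (x c) * exp (2 * K * (b - c))"
proof -
  let ?B = "2 * K * norm (x c) * exp (2 * K * (b - c))"
  have "norm (integral {c..b} (\<lambda>y. L (last_point T y) (x (last_point T y)))
      - integral {c..c} (\<lambda>y. L (last_point T y) (x (last_point T y))) - (b - c) *\<^sub>R 0) \<le> ?B * \<bar>b - c\<bar>"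
  proof (rule floor_integral_bound[of "\<lambda>t. L t (x t)", OF rd_flow[OF flow_continuous_on[OF assms(1)]] root_in assms(2)])
    fix u assume u: "u \<in> T" "min c b \<le> u" "u \<le> max c b"
    have ub: "u \<le> b" using u root_le[OF assms(2)] by auto
    have "norm (L u (x u)) \<le> K * norm (x u)" by (rule norm_L[OF u(1)])
    also have "\<dots> \<le> K * (2 * norm (x c) * exp (2 * K * (u - c)))"
      using gronwall[OF assms(1) u(1)] K_pos by simp
    also have "\<dots> \<le> K * (2 * norm (x c) * exp (2 * K * (b - c)))"
      using K_pos ub by (intro mult_left_mono) auto
    finally show "norm (L u (x u) - 0) \<le> ?B" by (simp add: algebra_simps)
  qed
  then show ?thesis using flow_integral[OF assms] root_le[OF assms(2)] by (simp add: algebra_simps)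
qed

lemma flow_unique:
  assumes "flow x" "flow y" "x c = y c" "t \<in> T" shows "x t = y t"
  using gronwall[OF flow_diff[OF assms(1,2)] assms(4)] assms(3) by simp

text \<open>Picard iteration in a weighted (Bielecki) norm, which contracts on the whole half-line
  at once instead of on short intervals.\<close>

lemma flow_exists: "\<exists>x. flow x \<and> x c = y0"
proof -
  define G where "G u s = L s (exp (2 * K * (s - c)) *\<^sub>R apply_bcontfun u s)" for u s
  define J where "J u t = integral {c..t} (\<lambda>y. G u (last_point T y))" for u t
  \<comment> \<open>The unknown u is the solution multiplied by exp (- 2K(t - c)), so that it is
    bounded; \<open>W\<close> is the Picard map in this variable.\<close>
  define W where "W u t = exp (- (2 * K * (t - c))) *\<^sub>R (y0 + J u t)" for u t
  have rdG: "rd_continuous T (G u)" for u unfolding G_def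
    by (intro rd_flow continuous_intros continuous_on_apply_bcontfun)
  have Jdiff: "norm (J u t - J v t) \<le> dist u v / 2 * exp (2 * K * (t - c))" if "c \<le> t" for u v t
  proof -
    have "J u t - J v t = integral {c..t} (\<lambda>y. G u (last_point T y) - G v (last_point T y))"
      unfolding J_def
      by (rule Henstock_Kurzweil_Integration.integral_diff[symmetric]) (intro floor_integrable rdG)+
    also have "\<dots> = integral {c..t} (\<lambda>y. G (u - v) (last_point T y))"
      by (simp add: G_def blinfun.diff_right[symmetric] scaleR_diff_right[symmetric] minus_bcontfun.rep_eq)
    also have "norm \<dots> \<le> dist u v / 2 * exp (2 * K * (t - c))"
    proof (rule exp_weighted_bound[OF rdG K_pos _ _ that])
      fix s assume "s \<in> T"
      then have "norm (G (u - v) s) \<le> K * (exp (2 * K * (s - c)) * norm (apply_bcontfun (u - v) s))"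
        unfolding G_def using norm_L[of s "exp (2 * K * (s - c)) *\<^sub>R apply_bcontfun (u - v) s"] by simp
      also have "\<dots> \<le> K * (exp (2 * K * (s - c)) * dist u v)"
        using K_pos norm_bounded[of "u - v" s] by (intro mult_left_mono) (auto simp: dist_norm)
      finally show "norm (G (u - v) s) \<le> K * dist u v * exp (2 * K * (s - c))" by (simp add: algebra_simps)
    qed simp
    finally show ?thesis .
  qed
  have WJ: "norm (W u t - W v t) \<le> dist u v / 2" if "c \<le> t" for u v t
  proof -
    have "W u t - W v t = exp (- (2 * K * (t - c))) *\<^sub>R (J u t - J v t)"
      by (simp add: W_def algebra_simps)
    then have "norm (W u t - W v t) \<le> exp (- (2 * K * (t - c))) * (dist u v / 2 * exp (2 * K * (t - c)))"
      using Jdiff[OF that, of u v] by simp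
    also have "\<dots> = dist u v / 2"
      unfolding exp_minus using exp_not_eq_zero[of "2 * K * (t - c)"] by (metis (no_types, lifting)
        mult.commute mult.left_commute mult.right_neutral right_inverse)
    finally show ?thesis .
  qed
  have W0: "norm (W 0 t) \<le> norm y0" if "c \<le> t" for t
  proof -
    have "J 0 t = 0" by (simp add: J_def G_def)
    then show ?thesis using K_pos that by (simp add: W_def mult_left_le_one_le)
  qed
  \<comment> \<open>Freezing the argument at c on the left yields a bounded continuous function on
    the whole line, hence an element of a complete space. Values of u off T do not enter
    \<open>G\<close>, which is evaluated at \<open>last_point\<close> only.\<close>
  have "continuous_on UNIV (\<lambda>t. W u (max c t))" for u
  proof -
    have Jc: "continuous_on {c..} (J u)"
    proof (clarsimp simp: continuous_on_eq_continuous_within)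
      fix t assume "c \<le> t"
      have "continuous_on {c..t + 1} (J u)" unfolding J_def
        by (rule indefinite_integral_continuous_1[OF floor_integrable[OF rdG]])
      then have "continuous (at t within {c..t+1}) (J u)" using \<open>c \<le> t\<close>
        by (simp add: continuous_on_eq_continuous_within)
      moreover have "at t within {c..t+1} = at t within {c..}"
        by (rule at_within_nhd[of _ "{..<t+1}"]) auto
      ultimately show "continuous (at t within {c..}) (J u)" by simp
    qed
    have "continuous_on {c..} (W u)" unfolding W_def by (intro continuous_intros Jc)
    then show ?thesis by (rule continuous_on_compose2) (auto intro!: continuous_intros)
  qed
  then have bc: "(\<lambda>t. W u (max c t)) \<in> bcontfun" for u
  proof (rule bcontfun_normI)
    fix t show "norm (W u (max c t)) \<le> norm y0 + dist u 0 / 2"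
      using WJ[of "max c t" u 0] W0[of "max c t"] norm_triangle_sub[of "W u (max c t)" "W 0 (max c t)"] by simp
  qed
  have "\<exists>!u. Bcontfun (\<lambda>t. W u (max c t)) = u"
  proof (rule banach_fix_type[of "1/2"], simp, simp, intro allI dist_bound)
    fix u v t
    show "dist (Bcontfun (\<lambda>t. W u (max c t)) t) (Bcontfun (\<lambda>t. W v (max c t)) t) \<le> 1 / 2 * dist u v"
      using WJ[of "max c t" u v] by (simp add: Bcontfun_inverse[OF bc] dist_norm)
  qed
  then obtain u where "Bcontfun (\<lambda>t. W u (max c t)) = u" by auto
  then have u: "apply_bcontfun u t = W u (max c t)" for t
    using Bcontfun_inverse[OF bc[of u]] by metis
  define x where "x t = y0 + J u t" for t
  have ux: "exp (2 * K * (t - c)) *\<^sub>R apply_bcontfun u t = x t" if "c \<le> t" for t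
    using that by (simp add: u W_def x_def max_def exp_minus)
  have "flow x" unfolding flow_def
  proof
    fix t assume t: "t \<in> T"
    have "has_delta_derivative T (\<lambda>t. J u t + y0) (G u t) t"
      unfolding J_def using has_delta_derivative_add[OF t floor_integral_delta[OF rdG t], of "\<lambda>_. y0" 0 u] t
      by (simp add: has_delta_derivative_iff)
    moreover have "G u t = L t (x t)" unfolding G_def using ux[of t] root_le[OF t] by simp
    ultimately show "has_delta_derivative T x (L t (x t)) t" by (simp add: x_def[abs_def] add.commute)
  qed
  moreover have "x c = y0" by (simp add: x_def J_def)
  ultimately show ?thesis by blast
qed

end

section \<open>Propagation of solutions from an arbitrary starting point\<close>

context linear_dynamic begin

lemma restrict_dynamic: "linear_dynamic (T \<inter> {c..}) L K"
  using restrict rd_continuous_restrict[OF rd] bound K_pos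
  by (auto simp: linear_dynamic_def linear_dynamic_axioms_def)

lemma root_dynamic: "c \<in> T \<Longrightarrow> rooted_linear_dynamic (T \<inter> {c..}) c L K"
  using root restrict_dynamic by (auto simp: rooted_linear_dynamic_def)

lemma flow_restrict: "flow x \<Longrightarrow> linear_dynamic.flow (T \<inter> {c..}) L x"
  unfolding flow_def linear_dynamic.flow_def[OF restrict_dynamic]
  by (auto intro: has_delta_derivative_restrict)

lemma flow_growth:
  assumes "flow x" "s \<in> T" "t \<in> T" "s \<le> t"
  shows "norm (x t) \<le> 2 * norm (x s) * exp (2 * K * (t - s))"
  using rooted_linear_dynamic.gronwall[OF root_dynamic[OF assms(2)] flow_restrict[OF assms(1)]] assms
  by auto

lemma flow_step:
  assumes "flow x" "s \<in> T" "t \<in> T" "s \<le> t"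
  shows "norm (x t - x s) \<le> 2 * K * (t - s) * norm (x s) * exp (2 * K * (t - s))"
  using rooted_linear_dynamic.flow_increment[OF root_dynamic[OF assms(2)] flow_restrict[OF assms(1)]] assms
  by auto

text \<open>The length d is uniform in the solution and in the place, since the increment bound
  depends only on K and the step length.\<close>

lemma flow_step_small: "\<exists>d>0. \<forall>x s t. flow x \<and> s \<in> T \<and> t \<in> T \<and> s \<le> t \<and> t < s + d \<longrightarrow>
    norm (x t - x s) \<le> norm (x s) / 2"
proof -
  have "((\<lambda>h. 2 * K * h * exp (2 * K * h)) \<longlongrightarrow> 2 * K * 0 * exp (2 * K * 0)) (at_right 0)"
    by (intro tendsto_intros)
  then have "eventually (\<lambda>h. 2 * K * h * exp (2 * K * h) < 1/2) (at_right 0)"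
    by (rule order_tendstoD) simp
  then obtain d where d: "0 < d" "\<And>h. \<lbrakk>0 < h; h < d\<rbrakk> \<Longrightarrow> 2 * K * h * exp (2 * K * h) < 1/2"
    unfolding eventually_at_right_field by auto
  show ?thesis
  proof (intro exI[of _ d] conjI d(1) allI impI, elim conjE)
    fix x s t assume *: "flow x" "s \<in> T" "t \<in> T" "s \<le> t" "t < s + d"
    have "2 * K * (t - s) * exp (2 * K * (t - s)) \<le> 1/2"
      using d(2)[of "t - s"] * by (cases "t = s") auto
    then have "2 * K * (t - s) * exp (2 * K * (t - s)) * norm (x s) \<le> 1/2 * norm (x s)"
      by (rule mult_right_mono) simp
    then show "norm (x t - x s) \<le> norm (x s) / 2"
      using flow_step[OF *(1-4)] by (simp add: algebra_simps)
  qed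
qed

text \<open>Both kinds of dense points are covered by the same fact: short steps of the flow change the state
  by at most half of its norm.\<close>

lemma flow_induct:
  assumes x: "flow x" and st: "s \<in> T" "t \<in> T" "s \<le> t" and Q: "Q (x s)"
    and small: "\<And>y z. \<lbrakk>Q y; norm (z - y) \<le> norm y / 2\<rbrakk> \<Longrightarrow> Q z"
    and jump: "\<And>t. \<lbrakk>t \<in> T; Q (x t)\<rbrakk> \<Longrightarrow> Q (x t + mu T t *\<^sub>R blinfun_apply (L t) (x t))"
  shows "Q (x t)"
proof -
  from flow_step_small obtain d where d: "0 < d"
    and step: "\<forall>x s t. flow x \<and> s \<in> T \<and> t \<in> T \<and> s \<le> t \<and> t < s + d \<longrightarrow>
      norm (x t - x s) \<le> norm (x s) / 2" by (elim exE conjE)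
  show ?thesis using st(2,3,1)
  proof (induction rule: time_scale_induct)
    case base show ?case by (rule Q)
  next
    case (scattered t)
    then have "x (sigma T t) = x t + mu T t *\<^sub>R blinfun_apply (L t) (x t)"
      using x has_delta_derivative_jump[of t x] by (auto simp: flow_def)
    then show ?case using jump[OF scattered(1,4)] by simp
  next
    case (right_dense t)
    then show ?case using step x d by (intro exI[of _ d] conjI ballI impI small[OF right_dense(4)]) auto
  next
    case (left_dense t)
    obtain r where r: "r \<in> T" "s \<le> r" "t - d < r" "r < t" using left_dense.hyps(3)[OF d] by auto
    show ?case by (rule small[OF left_dense.IH[OF r(1,2,4)]]) (use step x r left_dense(1) in simp)
  qed
qed

end

section \<open>Backward uniqueness and existence under regressivity\<close>

locale regressive_dynamic = linear_dynamic +
  assumes reg: "\<And>t v. \<lbrakk>t \<in> T; v + mu T t *\<^sub>R blinfun_apply (L t) v = 0\<rbrakk> \<Longrightarrow> v = 0"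
begin

lemma restrict_regressive: "regressive_dynamic (T \<inter> {c..}) L K"
proof -
  interpret R: linear_dynamic "T \<inter> {c..}" L K by (rule restrict_dynamic)
  show ?thesis
  proof
    fix t v assume "t \<in> T \<inter> {c..}" "v + mu (T \<inter> {c..}) t *\<^sub>R blinfun_apply (L t) v = 0"
    then show "v = 0" using reg[of t v] by (simp add: mu_restrict)
  qed
qed

text \<open>A step changing the state by at most half its norm cannot reach 0, and a jump cannot
  because I + \<mu> L has trivial kernel. Applied to differences this is uniqueness backward in
  time.\<close>

lemma flow_nonzero:
  assumes "flow x" "s \<in> T" "t \<in> T" "s \<le> t" "x s \<noteq> 0"
  shows "x t \<noteq> 0"
proof (rule flow_induct[OF assms(1-4), where Q = "\<lambda>y. y \<noteq> 0"])
  show "x t + mu T t *\<^sub>R blinfun_apply (L t) (x t) \<noteq> 0" if "t \<in> T" "x t \<noteq> 0" for t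
    using reg[of t "x t"] that by blast
qed (use assms(5) in auto)

lemma flow_unique:
  assumes "flow x" "flow y" "x s = y s" "s \<in> T" "t \<in> T" shows "x t = y t"
proof (cases "s \<le> t")
  case True
  then show ?thesis using flow_growth[OF flow_diff[OF assms(1,2)] assms(4,5)] assms(3) by simp
next
  case False
  then show ?thesis using flow_nonzero[OF flow_diff[OF assms(1,2)] assms(5,4)] assms(3) by force
qed

text \<open>The map from the value at c to the value at \<tau> is linear and, by backward
  uniqueness, injective. In finite dimension it is onto, so some initial value at c reaches
  y0.\<close>

lemma flow_exists_rooted:
  assumes "c \<in> T" "\<tau> \<in> T" "c \<le> \<tau>"
  shows "\<exists>x. linear_dynamic.flow (T \<inter> {c..}) L x \<and> x \<tau> = y0"
proof -
  interpret R: rooted_linear_dynamic "T \<inter> {c..}" c L K by (rule root_dynamic[OF assms(1)])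
  interpret R': regressive_dynamic "T \<inter> {c..}" L K by (rule restrict_regressive)
  define S where "S v = (SOME x. R.flow x \<and> x c = v)" for v
  have S: "R.flow (S v)" "S v c = v" for v
    using someI_ex[OF R.flow_exists[of v]] by (auto simp: S_def)
  have tau: "\<tau> \<in> T \<inter> {c..}" using assms by simp
  have "linear (\<lambda>v. S v \<tau>)"
  proof (rule linearI)
    show "S (u + v) \<tau> = S u \<tau> + S v \<tau>" for u v
      by (rule R.flow_unique[OF S(1) R.flow_add[OF S(1) S(1)] _ tau]) (simp add: S)
    show "S (a *\<^sub>R v) \<tau> = a *\<^sub>R S v \<tau>" for a v
      by (rule R.flow_unique[OF S(1) R.flow_scaleR[OF S(1)] _ tau]) (simp add: S)
  qed
  moreover have "inj (\<lambda>v. S v \<tau>)"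
  proof (rule injI)
    fix u v assume "S u \<tau> = S v \<tau>"
    from R'.flow_unique[OF S(1) S(1) this tau R.root_in] show "u = v" by (simp add: S)
  qed
  ultimately have "surj (\<lambda>v. S v \<tau>)" by (rule linear_inj_imp_surj)
  then obtain v where "y0 = S v \<tau>" by (rule surjE)
  with S(1) show ?thesis by auto
qed

text \<open>T may lack a least point, so there is no single c to start from. The solutions on the
  half-lines agree on overlaps because they share the value at \<tau>, and can be glued.\<close>

lemma flow_exists:
  assumes "\<tau> \<in> T"
  shows "\<exists>x. flow x \<and> x \<tau> = y0"
proof -
  define X where "X c = (SOME x. linear_dynamic.flow (T \<inter> {c..}) L x \<and> x \<tau> = y0)" for c
  have X: "linear_dynamic.flow (T \<inter> {c..}) L (X c)" "X c \<tau> = y0" if "c \<in> T" "c \<le> \<tau>" for c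
    using someI_ex[OF flow_exists_rooted[OF that(1) assms that(2)]] by (auto simp: X_def)
  \<comment> \<open>The half-line is cut at t itself when t < \<tau>; for the derivative at t a cut
    strictly to the left of t is then used, unless t is the least point of T.\<close>
  define x where "x t = X (min t \<tau>) t" for t
  have minT: "min t \<tau> \<in> T" if "t \<in> T" for t using that assms by (simp add: min_def)
  have eq: "X c t = x t" if c: "c \<in> T" "c \<le> \<tau>" "c \<le> t" "t \<in> T" for c t
  proof -
    let ?T = "T \<inter> {min t \<tau>..}"
    interpret R': regressive_dynamic ?T L K by (rule restrict_regressive)
    interpret C: linear_dynamic "T \<inter> {c..}" L K by (rule restrict_dynamic)
    have "(T \<inter> {c..}) \<inter> {min t \<tau>..} = ?T" using c by auto
    then have "R'.flow (X c)" using C.flow_restrict[OF X(1)[OF c(1,2)], of "min t \<tau>"] by simp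
    moreover have "R'.flow (X (min t \<tau>))" by (rule X) (use minT that in auto)
    moreover have "X c \<tau> = X (min t \<tau>) \<tau>" using X(2) c minT by simp
    ultimately show ?thesis unfolding x_def
      by (rule R'.flow_unique[of _ _ \<tau>]) (use assms c in auto)
  qed
  have deriv: "has_delta_derivative (T \<inter> {c..}) x (L t (x t)) t"
    if c: "c \<in> T" "c \<le> \<tau>" "c \<le> t" "t \<in> T" for c t
  proof -
    interpret C: linear_dynamic "T \<inter> {c..}" L K by (rule restrict_dynamic)
    have "C.flow x" using X(1)[OF c(1,2)] C.flow_cong[of "X c" x] eq c(1,2) by auto
    then show ?thesis using c unfolding C.flow_def by auto
  qed
  have "flow x" unfolding flow_def
  proof
    fix t assume t: "t \<in> T"
    show "has_delta_derivative T x (L t (x t)) t"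
    proof (cases "\<exists>s\<in>T. s < t")
      case True
      then obtain s where s: "s \<in> T" "s < t" by auto
      have "min s \<tau> \<le> \<tau>" "min s \<tau> < t" using s by auto
      with deriv[OF minT[OF s(1)] _ _ t] show ?thesis
        by (intro has_delta_derivative_unrestrict[where c = "min s \<tau>"]) simp_all
    next
      case False
      then have *: "T \<subseteq> {t..}" by force
      with assms have "t \<le> \<tau>" by auto
      with * deriv[OF t _ _ t] show ?thesis
        by (intro has_delta_derivative_unrestrict[where c = t]) simp_all
    qed
  qed
  moreover have "x \<tau> = y0" using X(2)[OF assms] by (simp add: x_def)
  ultimately show ?thesis by blast
qed

text \<open>Justifies the definite description: requiring the value \<open>undefined\<close> off T
  turns uniqueness on T into uniqueness of the function.\<close>

lemma ivp_solution:
  assumes "\<tau> \<in> T"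
  shows "flow (ivp_solution T (\<lambda>t y. blinfun_apply (L t) y) \<tau> y0)"
    and "ivp_solution T (\<lambda>t y. blinfun_apply (L t) y) \<tau> y0 \<tau> = y0"
proof -
  let ?P = "\<lambda>y. y \<in> extensional T \<and>
    (\<forall>t\<in>T. has_delta_derivative T y (blinfun_apply (L t) (y t)) t) \<and> y \<tau> = y0"
  obtain x where x: "flow x" "x \<tau> = y0" using flow_exists[OF assms] by blast
  have P: "?P y \<longleftrightarrow> y \<in> extensional T \<and> flow y \<and> y \<tau> = y0" for y by (simp add: flow_def)
  have "?P (restrict x T)" unfolding P using x assms flow_cong[of "restrict x T" x] by auto
  moreover have "y = restrict x T" if "?P y" for y
    using that flow_unique[of y x \<tau>] x assms unfolding P by (intro extensionalityI[of _ T]) auto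
  ultimately have "?P (THE y. ?P y)" by (rule theI)
  then show "flow (ivp_solution T (\<lambda>t y. blinfun_apply (L t) y) \<tau> y0)"
    and "ivp_solution T (\<lambda>t y. blinfun_apply (L t) y) \<tau> y0 \<tau> = y0"
    unfolding ivp_solution_def flow_def by auto
qed

end

section \<open>Antiderivatives and generalized polynomials\<close>

context unbounded_time_scale begin

lemma delta_increment_ge:
  fixes F :: "real \<Rightarrow> real"
  assumes rd: "rd_continuous T f" and F: "\<And>t. t \<in> T \<Longrightarrow> has_delta_derivative T F (f t) t"
    and st: "s \<in> T" "t \<in> T" "s \<le> t" and v: "\<And>u. \<lbrakk>u \<in> T; s \<le> u; u \<le> t\<rbrakk> \<Longrightarrow> v \<le> f u"
  shows "(t - s) * v \<le> F t - F s"
proof -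
  interpret R: rooted_time_scale "T \<inter> {s..}" s by (rule root[OF st(1)])
  have rd': "rd_continuous (T \<inter> {s..}) f" by (rule rd_continuous_restrict[OF rd])
  have I: "F t = F s + integral {s..t} (\<lambda>y. f (last_point (T \<inter> {s..}) y))"
    by (rule R.integral_of_delta_derivative[OF rd'])
      (use F st in \<open>auto intro: has_delta_derivative_restrict\<close>)
  have "(t - s) * v = integral {s..t} (\<lambda>y. v)" using st by simp
  also have "\<dots> \<le> integral {s..t} (\<lambda>y. f (last_point (T \<inter> {s..}) y))"
    by (intro integral_le R.floor_integrable[OF rd'] v integrable_const_ivl)
      (use R.floor_props in \<open>auto intro: order_trans\<close>)
  finally show ?thesis using I by simp
qed

lemma delta_antiderivative_exists:
  fixes f :: "real \<Rightarrow> 'a::banach"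
  assumes rd: "rd_continuous T f" and s: "s \<in> T"
  obtains F where "\<And>t. t \<in> T \<Longrightarrow> has_delta_derivative T F (f t) t" "F s = 0"
proof -
  define g where "g y = f (last_point T y)" for y
  \<comment> \<open>Oriented integral from s, so that no lower end of T is needed; on each half-line
    it differs by a constant from the integral starting at c.\<close>
  define F where "F t = (if s \<le> t then integral {s..t} g else - integral {t..s} g)" for t
  have deriv: "has_delta_derivative (T \<inter> {c..}) F (f t) t" if c: "c \<in> T" "c \<le> s" "t \<in> T" "c \<le> t" for c t
  proof -
    let ?T = "T \<inter> {c..}"
    interpret R: rooted_time_scale ?T c by (rule root[OF c(1)])
    have rd': "rd_continuous ?T f" by (rule rd_continuous_restrict[OF rd])
    have fl: "last_point ?T y = last_point T y" if "c \<le> y" for y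
    proof -
      have "last_point ?T y \<in> T" "last_point ?T y \<le> y" using R.floor_props[OF that] by auto
      moreover have "u \<le> last_point ?T y" if "u \<in> T" "u \<le> y" for u
        using R.floor_ge[of u y] R.floor_props[OF \<open>c \<le> y\<close>] that by (cases "c \<le> u") auto
      ultimately show ?thesis unfolding last_point_def by (intro cSup_eq_maximum[symmetric]) auto
    qed
    define I where "I t = integral {c..t} (\<lambda>y. f (last_point ?T y))" for t
    have diff: "I b - I a = integral {a..b} g" if "c \<le> a" "a \<le> b" for a b
    proof -
      have "I b - I a = integral {a..b} (\<lambda>y. f (last_point ?T y))"
        unfolding I_def by (rule R.floor_integral_diff[OF rd' that])
      also have "\<dots> = integral {a..b} g" unfolding g_def
        by (rule Henstock_Kurzweil_Integration.integral_cong) (use fl that in auto)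
      finally show ?thesis .
    qed
    have "F u = I u - I s" if "u \<in> ?T" for u
      using diff[of s u] diff[of u s] that c by (auto simp: F_def minus_equation_iff)
    moreover have "has_delta_derivative ?T (\<lambda>u. I u - I s) (f t - 0) t"
    proof (rule R.has_delta_derivative_diff)
      show "has_delta_derivative ?T I (f t) t" unfolding I_def
        by (rule R.floor_integral_delta[OF rd']) (use c in auto)
      show "has_delta_derivative ?T (\<lambda>_. I s) 0 t"
        by (subst R.has_delta_derivative_iff) (use c in auto)
    qed (use c in auto)
    ultimately show ?thesis using R.has_delta_derivative_cong[of t F "\<lambda>u. I u - I s"] c by simp
  qed
  have "has_delta_derivative T F (f t) t" if t: "t \<in> T" for t
  proof (cases "\<exists>r\<in>T. r < t")
    case True
    then obtain r where r: "r \<in> T" "r < t" by auto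
    then have m: "min r s \<in> T" "min r s \<le> s" "min r s < t" using s by (auto simp: min_def)
    with deriv[OF m(1,2) t] show ?thesis
      by (intro has_delta_derivative_unrestrict[where c = "min r s"]) simp_all
  next
    case False
    then have *: "T \<subseteq> {t..}" by force
    with s have "t \<le> s" by auto
    with * deriv[OF t _ t] show ?thesis
      by (intro has_delta_derivative_unrestrict[where c = t]) simp_all
  qed
  moreover have "F s = 0" by (simp add: F_def)
  ultimately show ?thesis by (rule that)
qed

lemma delta_integral_eq:
  fixes f :: "real \<Rightarrow> 'a::banach"
  assumes F: "\<And>t. t \<in> T \<Longrightarrow> has_delta_derivative T F (f t) t" and s: "s \<in> T" "t \<in> T"
  shows "delta_integral T f s t = F t - F s"
  unfolding delta_integral_def
proof (rule the_equality)
  show "\<exists>F'. (\<forall>t\<in>T. has_delta_derivative T F' (f t) t) \<and> F t - F s = F' t - F' s"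
    using F by blast
  fix I assume "\<exists>F'. (\<forall>t\<in>T. has_delta_derivative T F' (f t) t) \<and> I = F' t - F' s"
  then obtain F' where F': "\<And>t. t \<in> T \<Longrightarrow> has_delta_derivative T F' (f t) t" and I: "I = F' t - F' s" by blast
  have D: "has_delta_derivative T (\<lambda>t. F' t - F t) 0 u" if "u \<in> T" for u
    using has_delta_derivative_diff[OF that F'[OF that] F[OF that]] by simp
  have "F' t - F t = F' s - F s"
    using zero_delta_derivative_constant[OF D, of s t] zero_delta_derivative_constant[OF D, of t s] s
    by (cases "s \<le> t") auto
  then have "F' t = F' s - F s + F t" by (metis diff_add_cancel)
  then show "I = F t - F s" using I by simp
qed

text \<open>The recursion is only meaningful if each h_k has an antiderivative. The induction
  carries continuity along: h_(k+1), being an antiderivative, is continuous and hence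
  rd-continuous.\<close>

lemma gen_poly_Suc_derivative:
  assumes s: "s \<in> T"
  shows "(\<forall>t\<in>T. has_delta_derivative T (\<lambda>t. gen_poly T (Suc k) t s) (gen_poly T k t s) t)
    \<and> gen_poly T (Suc k) s s = 0"
proof (induction k)
  have step: "(\<forall>t\<in>T. has_delta_derivative T (\<lambda>t. gen_poly T (Suc k) t s) (gen_poly T k t s) t)
    \<and> gen_poly T (Suc k) s s = 0" if c: "continuous_on T (\<lambda>t. gen_poly T k t s)" for k
  proof -
    obtain F where F: "\<And>t. t \<in> T \<Longrightarrow> has_delta_derivative T F (gen_poly T k t s) t" "F s = 0"
      by (rule delta_antiderivative_exists[OF continuous_imp_rd_continuous[OF c] s]; rule that; assumption)
    have eq: "gen_poly T (Suc k) t s = F t" if "t \<in> T" for t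
      using delta_integral_eq[of F "\<lambda>t. gen_poly T k t s", OF F(1) s that] F(2) by simp
    show ?thesis using F(1) has_delta_derivative_cong[of _ "\<lambda>t. gen_poly T (Suc k) t s" F] eq F(2) s
      by (metis (no_types, lifting))
  qed
  {
    case 0 show ?case by (rule step) simp
  next
    case (Suc k)
    then have "continuous_on T (\<lambda>t. gen_poly T (Suc k) t s)"
      by (intro has_delta_derivative_continuous_on[of _ "\<lambda>t. gen_poly T k t s"]) blast
    then show ?case by (rule step)
  }
qed

lemma gen_poly_rd_continuous: "s \<in> T \<Longrightarrow> rd_continuous T (\<lambda>t. gen_poly T k t s)"
proof (cases k)
  case (Suc j)
  assume "s \<in> T"
  then have "continuous_on T (\<lambda>t. gen_poly T (Suc j) t s)"
    using gen_poly_Suc_derivative[of s j]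
    by (intro has_delta_derivative_continuous_on[of _ "\<lambda>t. gen_poly T j t s"]) blast
  then show ?thesis unfolding Suc by (rule continuous_imp_rd_continuous)
qed (auto intro: continuous_imp_rd_continuous)

lemma gen_poly_increment:
  assumes "r \<in> T" "s \<in> T" "t \<in> T" "s \<le> t"
    and "\<And>u. \<lbrakk>u \<in> T; s \<le> u; u \<le> t\<rbrakk> \<Longrightarrow> v \<le> gen_poly T k u r"
  shows "gen_poly T (Suc k) s r + (t - s) * v \<le> gen_poly T (Suc k) t r"
  using delta_increment_ge[of "\<lambda>t. gen_poly T k t r" "\<lambda>t. gen_poly T (Suc k) t r",
      OF gen_poly_rd_continuous[OF assms(1)] _ assms(2-4) assms(5)]
    gen_poly_Suc_derivative[OF assms(1), of k] by force

lemma gen_poly_mono: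
  assumes "r \<in> T"
  shows "\<lbrakk>s \<in> T; t \<in> T; r \<le> s; s \<le> t\<rbrakk> \<Longrightarrow> 0 \<le> gen_poly T k s r \<and> gen_poly T k s r \<le> gen_poly T k t r"
proof (induction k arbitrary: s t)
  case (Suc k)
  have inc: "gen_poly T (Suc k) a r \<le> gen_poly T (Suc k) b r" if ab: "a \<in> T" "b \<in> T" "r \<le> a" "a \<le> b" for a b
  proof -
    have "gen_poly T (Suc k) a r + (b - a) * 0 \<le> gen_poly T (Suc k) b r"
    proof (rule gen_poly_increment[OF assms ab(1,2,4)])
      fix u assume "u \<in> T" "a \<le> u" "u \<le> b"
      then show "0 \<le> gen_poly T k u r" using Suc.IH[of u u] ab by auto
    qed
    then show ?thesis by simp
  qed
  have "gen_poly T (Suc k) r r = 0" using gen_poly_Suc_derivative[OF assms] by blast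
  then show ?case using inc[OF assms, of s] inc[of s t] Suc.prems by auto
qed auto

text \<open>Over one period h_(k+1) grows by at least p times the value of h_k at its beginning,
  because h_k is nondecreasing; the resulting recursion in m is Pascal's rule.\<close>

lemma gen_poly_ge_binomial:
  assumes r: "r \<in> T" and p: "0 \<le> p" "\<And>m. r + real m * p \<in> T"
  shows "p ^ k * real (m choose k) \<le> gen_poly T k (r + real m * p) r"
proof (induction k arbitrary: m)
  case (Suc k)
  show ?case
  proof (induction m)
    case 0
    then show ?case using gen_poly_Suc_derivative[OF r, of k] by simp
  next
    case (Suc m)
    let ?s = "r + real m * p" and ?t = "r + real (Suc m) * p"
    have "gen_poly T (Suc k) ?s r + (?t - ?s) * gen_poly T k ?s r \<le> gen_poly T (Suc k) ?t r"
    proof (rule gen_poly_increment[OF r p(2) p(2)])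
      show "?s \<le> ?t" using p by (simp add: algebra_simps)
      fix u assume "u \<in> T" "?s \<le> u" "u \<le> ?t"
      then show "gen_poly T k ?s r \<le> gen_poly T k u r" using gen_poly_mono[OF r p(2)[of m], of u k] p by auto
    qed
    moreover have "?t - ?s = p" by (simp add: algebra_simps)
    moreover have "p * (p ^ k * real (m choose k)) \<le> p * gen_poly T k ?s r"
      using Suc.IH \<open>\<And>m. p ^ k * real (m choose k) \<le> gen_poly T k (r + real m * p) r\<close> p(1)
      by (intro mult_left_mono) auto
    ultimately show ?case using Suc.IH by (simp add: algebra_simps)
  qed
qed simp

end

lemma Blinfun_linear:
  fixes b :: "'a::euclidean_space \<Rightarrow> 'b::euclidean_space \<Rightarrow> 'c::real_normed_vector"
  assumes "bilinear b"
  shows "bounded_linear (\<lambda>A. Blinfun (b A))" "blinfun_apply (Blinfun (b A)) = b A"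
proof -
  have bl: "bounded_linear (b A)" for A
    using assms by (simp add: bilinear_def linear_conv_bounded_linear)
  then show app: "blinfun_apply (Blinfun (b A)) = b A" for A by (rule bounded_linear_Blinfun_apply)
  have "linear (\<lambda>A. Blinfun (b A))"
    by (rule linearI; rule blinfun_eqI)
      (simp_all add: app blinfun.add_left blinfun.scaleR_left bilinear_ladd[OF assms] bilinear_lmul[OF assms])
  then show "bounded_linear (\<lambda>A. Blinfun (b A))" by (simp add: linear_conv_bounded_linear)
qed

section \<open>Periodic systems and the monodromy matrix\<close>

locale periodic_unbounded_time_scale =
  fixes p :: real and T :: "real set"
  assumes p_pos: "0 < p" and periodic: "periodic_time_scale p T"

sublocale periodic_unbounded_time_scale \<subseteq> unbounded_time_scale T
proof
  show "closed T" using periodic by (simp add: periodic_time_scale_def time_scale_def)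
  fix t assume "t \<in> T"
  then have "t + p \<in> T" using periodic by (simp add: periodic_time_scale_def)
  then show "\<exists>s\<in>T. t < s" using p_pos by force
qed

context periodic_unbounded_time_scale begin

lemma shift_in: "t \<in> T \<Longrightarrow> t + p \<in> T" and mu_shift: "t \<in> T \<Longrightarrow> mu T (t + p) = mu T t"
  and mu_nonneg: "t \<in> T \<Longrightarrow> 0 \<le> mu T t" and mu_le: "t \<in> T \<Longrightarrow> mu T t \<le> p"
proof -
  assume "t \<in> T"
  with periodic have "t + p \<in> T \<and> mu T t = mu T (t + p) \<and> 0 \<le> mu T t \<and> mu T t \<le> p"
    unfolding periodic_time_scale_def by blast
  then show "t + p \<in> T" "mu T (t + p) = mu T t" "0 \<le> mu T t" "mu T t \<le> p" by simp_all
qed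

lemma shift_nat_in: "t \<in> T \<Longrightarrow> t + real k * p \<in> T"
proof (induction k)
  case (Suc k)
  then show ?case using shift_in[of "t + real k * p"] by (simp add: algebra_simps)
qed simp

text \<open>Only forward shifts are given by definition. If s - p were missing, it would lie in a
  gap after some q, so that \<mu>(q) > s - p - q; but s itself ends the gap after q + p, so \<mu>(q
  + p) \<le> s - p - q, against periodicity of \<mu>. The point r ensures that q exists.\<close>

lemma shift_back_in:
  assumes s: "s \<in> T" and r: "r \<in> T" "r \<le> s - p" shows "s - p \<in> T"
proof (rule ccontr)
  assume nin: "s - p \<notin> T"
  interpret R: rooted_time_scale "T \<inter> {r..}" r by (rule root[OF r(1)])
  define q where "q = last_point (T \<inter> {r..}) (s - p)"
  have q: "q \<in> T" "q \<le> s - p" "r \<le> q" using R.floor_props[OF r(2)] by (auto simp: q_def)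
  then have ql: "q < s - p" using nin by (auto simp: less_le)
  have ub: "u \<le> q" if "u \<in> T" "u \<le> s - p" for u
  proof (cases "r \<le> u")
    case True
    then show ?thesis unfolding q_def using R.floor_ge[of u "s - p"] that by simp
  qed (use q in simp)
  have "s - p < sigma T q"
  proof (rule ccontr)
    assume "\<not> ?thesis"
    then have "sigma T q = q" using ub[OF sigma_in[OF q(1)]] sigma_ge[OF q(1)] by simp
    then obtain u where "u \<in> T" "q < u" "u < q + (s - p - q)"
      using ql by (elim right_dense_ex[OF q(1), where d = "s - p - q"]) auto
    then show False using ub[of u] by simp
  qed
  moreover have "sigma T (q + p) \<le> s" by (rule sigma_le[OF shift_in[OF q(1)] s]) (use ql in simp)
  ultimately show False using mu_shift[OF q(1)] by (simp add: mu_def)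
qed

lemma shift_back_nat_in:
  "\<lbrakk>s \<in> T; r \<in> T; r \<le> s - real k * p\<rbrakk> \<Longrightarrow> s - real k * p \<in> T"
proof (induction k)
  case (Suc k)
  then have "s - real k * p \<in> T" using p_pos by (simp add: algebra_simps)
  from shift_back_in[OF this Suc.prems(2)] Suc.prems(3) show ?case by (simp add: algebra_simps)
qed simp

lemma sigma_shift: "t \<in> T \<Longrightarrow> sigma T (t + p) = sigma T t + p"
  using mu_shift[of t] by (simp add: mu_def)

lemma has_delta_derivative_shift:
  assumes "t \<in> T" "has_delta_derivative T x D (t + p)"
  shows "has_delta_derivative T (\<lambda>s. x (s + p)) D t"
  unfolding has_delta_derivative_def
proof (intro allI impI)
  fix e :: real assume "0 < e"
  then obtain d where d: "0 < d" "\<forall>s\<in>T. \<bar>s - (t + p)\<bar> < d \<longrightarrow>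
      norm (x (sigma T (t + p)) - x s - (sigma T (t + p) - s) *\<^sub>R D) \<le> e * \<bar>sigma T (t + p) - s\<bar>"
    using assms(2) unfolding has_delta_derivative_def by blast
  show "\<exists>\<delta>>0. \<forall>s\<in>T. \<bar>s - t\<bar> < \<delta> \<longrightarrow>
     norm (x (sigma T t + p) - x (s + p) - (sigma T t - s) *\<^sub>R D) \<le> e * \<bar>sigma T t - s\<bar>"
  proof (intro exI[of _ d] conjI d(1) ballI impI)
    fix s assume s: "s \<in> T" "\<bar>s - t\<bar> < d"
    have "\<bar>(s + p) - (t + p)\<bar> < d" using s by simp
    with d(2) shift_in[OF s(1)]
    show "norm (x (sigma T t + p) - x (s + p) - (sigma T t - s) *\<^sub>R D) \<le> e * \<bar>sigma T t - s\<bar>"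
      by (force simp: sigma_shift[OF assms(1)])
  qed
qed

text \<open>Since a \<mu> \<le> a p < 1, the exponential stays positive and therefore decreases.
  Over one period its derivative is thus at least -a times its initial value, which costs at most a
  factor 1 - a p.\<close>

lemma ts_exp_lower_bound:
  assumes a: "0 < a" "a * p < 1" and \<tau>: "\<tau> \<in> T" and t: "t \<in> T" "\<tau> \<le> t" "t \<le> \<tau> + real k * p"
  shows "(1 - a * p) ^ k \<le> ts_exp T (- a) t \<tau>"
proof -
  define L :: "real \<Rightarrow> real \<Rightarrow>\<^sub>L real" where "L = (\<lambda>_. (- a) *\<^sub>R id_blinfun)"
  have Lapp: "blinfun_apply (L t) = (*) (- a)" for t
    by (rule ext) (simp add: L_def blinfun.scaleR_left blinfun.minus_left)
  have amu: "0 < 1 - a * mu T t" if "t \<in> T" for t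
  proof -
    have "a * mu T t \<le> a * p" using mu_le[OF that] a by (intro mult_left_mono) auto
    with a show ?thesis by linarith
  qed
  interpret E: regressive_dynamic T L a
  proof
    show "rd_continuous T L" unfolding L_def by (rule continuous_imp_rd_continuous) simp
    show "norm (L t) \<le> a" for t unfolding L_def using norm_blinfun_id_le[where 'a=real] a
      by simp
    fix t v assume "t \<in> T" "v + mu T t *\<^sub>R blinfun_apply (L t) v = 0"
    then have "(1 - a * mu T t) * v = 0" "1 - a * mu T t \<noteq> 0"
      using amu[of t] by (auto simp: Lapp algebra_simps)
    then show "v = 0" by simp
  qed (rule a)
  define e where "e = ivp_solution T (\<lambda>s y. - a * y) \<tau> 1"
  have e: "E.flow e" "e \<tau> = 1" using E.ivp_solution[OF \<tau>, of 1] by (simp_all add: Lapp e_def)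
  have De: "has_delta_derivative T e (- a * e t) t" if "t \<in> T" for t
    using e(1) that by (auto simp: E.flow_def Lapp)
  have ce: "continuous_on T e" by (rule E.flow_continuous_on[OF e(1)])
  have pos: "0 < e s" if "s \<in> T" "\<tau> \<le> s" for s
  proof (rule E.flow_induct[OF e(1) \<tau> that])
    show "0 < e \<tau>" by (simp add: e)
    show "0 < z" if "0 < y" "norm (z - y) \<le> norm y / 2" for y z :: real
      using that by (simp add: abs_if split: if_splits)
    show "0 < e t + mu T t *\<^sub>R blinfun_apply (L t) (e t)" if "t \<in> T" "0 < e t" for t
    proof -
      have "0 < (1 - a * mu T t) * e t" using that amu by simp
      then show ?thesis by (simp add: Lapp algebra_simps)
    qed
  qed
  have rde: "rd_continuous T (\<lambda>t. - a * e t)"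
    by (intro continuous_imp_rd_continuous continuous_intros ce)
  have rde': "rd_continuous T (\<lambda>t. - (- a * e t))"
    by (intro continuous_imp_rd_continuous continuous_intros ce)
  have decr: "e t \<le> e s" if "s \<in> T" "t \<in> T" "\<tau> \<le> s" "s \<le> t" for s t
  proof -
    have "has_delta_derivative T (\<lambda>t. - e t) (- (- a * e t)) t" if "t \<in> T" for t
      using has_delta_derivative_scaleR[OF that De[OF that], of "-1"] by simp
    then have "(t - s) * 0 \<le> - e t - - e s"
      by (rule delta_increment_ge[OF rde']) (use that pos a in \<open>auto intro!: mult_nonneg_nonneg less_imp_le\<close>)
    then show ?thesis by simp
  qed
  have step: "(1 - a * p) * e s \<le> e (s + p)" if s: "s \<in> T" "\<tau> \<le> s" for s
  proof -
    have "(s + p - s) * (- a * e s) \<le> e (s + p) - e s"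
      by (rule delta_increment_ge[OF rde De]) (use s p_pos a shift_in decr in \<open>auto\<close>)
    then show ?thesis by (simp add: algebra_simps)
  qed
  have "(1 - a * p) ^ k \<le> e (\<tau> + real k * p)" for k
  proof (induction k)
    case (Suc k)
    have "(1 - a * p) ^ Suc k \<le> (1 - a * p) * e (\<tau> + real k * p)"
      using Suc a by (simp add: mult_left_mono)
    also have "\<dots> \<le> e (\<tau> + real k * p + p)"
      by (rule step) (use shift_nat_in[OF \<tau>] p_pos in auto)
    finally show ?case by (simp add: algebra_simps)
  qed (use e in simp)
  also have "e (\<tau> + real k * p) \<le> e t"
    by (rule decr) (use t shift_nat_in[OF \<tau>] in auto)
  finally show ?thesis by (simp add: ts_exp_def e_def)
qed

end

section \<open>Periodic linear systems: interpretation of the abstract theory and the monodromy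
  relation\<close>

locale periodic_system = periodic_unbounded_time_scale +
  fixes t0 :: real and A :: "real \<Rightarrow> real^'n^'n"
  assumes t0_in: "t0 \<in> T" and regressive: "regressive T A" and A_periodic: "periodic_on p T A"
begin

lemma A_shift_nat: "t \<in> T \<Longrightarrow> A (t + real k * p) = A t"
proof (induction k)
  case (Suc k)
  have "A (t + real k * p + p) = A (t + real k * p)"
    using A_periodic shift_nat_in[OF Suc.prems, of k] unfolding periodic_on_def by blast
  with Suc show ?case by (simp add: algebra_simps)
qed simp

text \<open>An rd-continuous function is bounded on the compact period from t0 on. Points further
  right are shifted back into it, which is possible because t0 lies to their left; points left of t0
  are shifted forward.\<close>

lemma A_bounded: "\<exists>B. \<forall>t\<in>T. norm (A t) \<le> B"
proof -
  have rdA: "rd_continuous T A" using regressive by (simp add: regressive_def)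
  interpret R: rooted_time_scale "T \<inter> {t0..}" t0 by (rule root[OF t0_in])
  from R.floor_bounded[OF rd_continuous_restrict[OF rdA], of "t0 + p"] obtain B
    where B: "\<forall>y\<in>{t0..t0 + p}. norm (A (last_point (T \<inter> {t0..}) y)) \<le> B" ..
  have near: "norm (A t) \<le> B" if "t \<in> T" "t0 \<le> t" "t \<le> t0 + p" for t
    using bspec[OF B, of t] R.floor_eq[of t] that by simp
  have right: "norm (A t) \<le> B" if t: "t \<in> T" "t0 \<le> t" for t
  proof -
    define k where "k = nat \<lfloor>(t - t0) / p\<rfloor>"
    have "real k \<le> (t - t0) / p" "(t - t0) / p < real k + 1"
      using t p_pos by (simp_all add: k_def of_nat_nat)
    then have k: "t0 \<le> t - real k * p" "t - real k * p \<le> t0 + p"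
      using p_pos by (simp_all add: field_simps)
    have "t - real k * p \<in> T" by (rule shift_back_nat_in[OF t(1) t0_in k(1)])
    from near[OF this k] A_shift_nat[OF this, of k] show ?thesis by simp
  qed
  have "norm (A t) \<le> B" if t: "t \<in> T" for t
  proof -
    obtain k where "(t0 - t) / p \<le> real k" using real_arch_simple by blast
    then have "t0 \<le> t + real k * p" using p_pos by (simp add: field_simps)
    from right[OF shift_nat_in[OF t] this] show ?thesis using A_shift_nat[OF t] by simp
  qed
  then show ?thesis by blast
qed

definition vector_field :: "real \<Rightarrow> (real^'n) \<Rightarrow>\<^sub>L (real^'n)" where "vector_field t = Blinfun ((*v) (A t))"
definition matrix_field :: "real \<Rightarrow> (real^'n^'n) \<Rightarrow>\<^sub>L (real^'n^'n)" where "matrix_field t = Blinfun ((**) (A t))"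

lemma bilinear_matvec: "bilinear ((*v) :: real^'n^'n \<Rightarrow> _)"
  unfolding bilinear_def
  by (intro conjI allI linearI; simp only: Finite_Cartesian_Product.vec_eq_iff;
      simp add: matrix_vector_mult_def sum.distrib sum_distrib_left algebra_simps)

lemma bilinear_matmul: "bilinear ((**) :: real^'n^'n \<Rightarrow> real^'n^'n \<Rightarrow> _)"
  unfolding bilinear_def
  by (intro conjI allI linearI; simp only: Finite_Cartesian_Product.vec_eq_iff;
      simp add: matrix_matrix_mult_def sum.distrib sum_distrib_left algebra_simps)

lemma vector_field_apply [simp]: "blinfun_apply (vector_field t) = (*v) (A t)"
  unfolding vector_field_def by (rule Blinfun_linear[OF bilinear_matvec])

lemma matrix_field_apply [simp]: "blinfun_apply (matrix_field t) = (**) (A t)"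
  unfolding matrix_field_def by (rule Blinfun_linear[OF bilinear_matmul])

lemma kernel_trivial: "\<lbrakk>t \<in> T; v + mu T t *\<^sub>R (A t *v v) = 0\<rbrakk> \<Longrightarrow> v = 0"
proof -
  assume t: "t \<in> T" and v: "v + mu T t *\<^sub>R (A t *v v) = 0"
  have "invertible (mat 1 + mu T t *\<^sub>R A t)" using regressive t by (simp add: regressive_def)
  then obtain B where "B ** (mat 1 + mu T t *\<^sub>R A t) = mat 1" by (auto simp: invertible_def)
  moreover have "(mat 1 + mu T t *\<^sub>R A t) *v v = 0"
    using v by (simp add: matrix_vector_mult_add_rdistrib scaleR_matrix_vector_assoc[symmetric])
  ultimately show "v = 0" by (metis matrix_vector_mul_assoc matrix_vector_mul_lid matrix_vector_mult_0_right)
qed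

lemma dynamics: "\<exists>K. regressive_dynamic T vector_field K \<and> regressive_dynamic T matrix_field K"
proof -
  have rdA: "rd_continuous T A" using regressive by (simp add: regressive_def)
  obtain B where B: "\<forall>t\<in>T. norm (A t) \<le> B" using A_bounded by blast
  have bl: "bounded_linear (\<lambda>A::real^'n^'n. Blinfun ((*v) A))" "bounded_linear (\<lambda>A::real^'n^'n. Blinfun ((**) A :: real^'n^'n \<Rightarrow> _))"
    by (rule Blinfun_linear[OF bilinear_matvec], rule Blinfun_linear[OF bilinear_matmul])
  obtain K1 where K1: "0 < K1" "\<And>A::real^'n^'n. norm (Blinfun ((*v) A)) \<le> norm A * K1"
    using bounded_linear.pos_bounded[OF bl(1)] by blast
  obtain K2 where K2: "0 < K2" "\<And>A::real^'n^'n. norm (Blinfun ((**) A :: real^'n^'n \<Rightarrow> _)) \<le> norm A * K2"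
    using bounded_linear.pos_bounded[OF bl(2)] by blast
  define K where "K = (\<bar>B\<bar> + 1) * (K1 + K2)"
  have K0: "0 < K" using K1 K2 by (simp add: K_def add_nonneg_pos)
  have KB: "norm (A t) * K1 \<le> K" "norm (A t) * K2 \<le> K" if "t \<in> T" for t
    unfolding K_def using B that K1(1) K2(1) by (auto intro!: mult_mono simp: add_nonneg_nonneg)
  have "regressive_dynamic T vector_field K"
  proof
    show "rd_continuous T vector_field" unfolding vector_field_def[abs_def] by (rule rd_continuous_linear[OF bl(1) rdA])
    show "norm (vector_field t) \<le> K" if "t \<in> T" for t unfolding vector_field_def using K1(2)[of "A t"] KB[OF that] by simp
    show "v = 0" if "t \<in> T" "v + mu T t *\<^sub>R blinfun_apply (vector_field t) v = 0" for t v
      using kernel_trivial[of t v] that by simp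
  qed (rule K0)
  moreover have "regressive_dynamic T matrix_field K"
  proof
    show "rd_continuous T matrix_field" unfolding matrix_field_def[abs_def] by (rule rd_continuous_linear[OF bl(2) rdA])
    show "norm (matrix_field t) \<le> K" if "t \<in> T" for t unfolding matrix_field_def using K2(2)[of "A t"] KB[OF that] by simp
    show "X = 0" if t: "t \<in> T" "X + mu T t *\<^sub>R blinfun_apply (matrix_field t) X = 0" for t X
    proof -
      have "X *v v = 0" for v
      proof (rule kernel_trivial[OF t(1)])
        have "(X + mu T t *\<^sub>R (A t ** X)) *v v = 0" using t(2) by simp
        then show "X *v v + mu T t *\<^sub>R (A t *v (X *v v)) = 0"
          by (simp add: matrix_vector_mult_add_rdistrib scaleR_matrix_vector_assoc[symmetric] matrix_vector_mul_assoc)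
      qed
      then show "X = 0" by (simp add: matrix_eq)
    qed
  qed (rule K0)
  ultimately show ?thesis by blast
qed

text \<open>A fixed name shared by the vector and the matrix equation, as the two interpretations
  below require.\<close>

definition K where "K = (SOME K. regressive_dynamic T vector_field K \<and> regressive_dynamic T matrix_field K)"

lemma K: "regressive_dynamic T vector_field K" "regressive_dynamic T matrix_field K"
proof -
  have *: "regressive_dynamic T vector_field K \<and> regressive_dynamic T matrix_field K"
    unfolding K_def by (rule someI_ex[OF dynamics])
  show "regressive_dynamic T vector_field K" using * by (rule conjunct1)
  show "regressive_dynamic T matrix_field K" using * by (rule conjunct2)
qed

end

sublocale periodic_system \<subseteq> V: regressive_dynamic T vector_field K by (rule K)
sublocale periodic_system \<subseteq> M: regressive_dynamic T matrix_field K by (rule K)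

context periodic_system begin

lemma is_solution_iff: "is_solution T A x \<longleftrightarrow> V.flow x"
  by (simp add: is_solution_def V.flow_def)

definition Phi :: "real^'n^'n" where "Phi = transition_matrix T A (t0 + p) t0"

lemma flow_shift: "V.flow x \<Longrightarrow> V.flow (\<lambda>t. x (t + p))"
proof -
  assume x: "V.flow x"
  show "V.flow (\<lambda>t. x (t + p))" unfolding V.flow_def
  proof
    fix t assume t: "t \<in> T"
    have "has_delta_derivative T x (blinfun_apply (vector_field (t + p)) (x (t + p))) (t + p)"
      using x shift_in[OF t] unfolding V.flow_def by blast
    moreover have "A (t + p) = A t" using A_periodic t unfolding periodic_on_def by blast
    ultimately show "has_delta_derivative T (\<lambda>t. x (t + p)) (blinfun_apply (vector_field t) (x (t + p))) t"
      using has_delta_derivative_shift[OF t] by simp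
  qed
qed

lemma flow_shift_nat: "V.flow x \<Longrightarrow> V.flow (\<lambda>t. x (t + real k * p))"
proof (induction k)
  case (Suc k)
  from flow_shift[OF Suc.IH[OF Suc.prems]] show ?case by (simp add: algebra_simps)
qed simp

text \<open>The transition matrix applied to x t0 is again a solution, with the same value at
  t0.\<close>

lemma monodromy: assumes x: "V.flow x" shows "x (t0 + p) = Phi *v x t0"
proof -
  define X where "X t = transition_matrix T A t t0" for t
  have X: "M.flow X" "X t0 = mat 1"
    using M.ivp_solution[OF t0_in, of "mat 1"] by (simp_all add: X_def[abs_def] transition_matrix_def)
  have "bounded_linear (\<lambda>X::real^'n^'n. X *v x t0)"
    using bilinear_matvec by (auto simp: bilinear_def linear_conv_bounded_linear)
  then have "V.flow (\<lambda>t. X t *v x t0)"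
    unfolding V.flow_def using X(1) unfolding M.flow_def
    by (auto simp: matrix_vector_mul_assoc intro: has_delta_derivative_bounded_linear)
  from V.flow_unique[OF x this _ t0_in shift_in[OF t0_in]] X(2) show ?thesis
    by (simp add: Phi_def X_def)
qed

lemma Phi_injective: "Phi *v v = 0 \<Longrightarrow> v = 0"
proof -
  assume *: "Phi *v v = 0"
  obtain x where x: "V.flow x" "x t0 = v" using V.flow_exists[OF t0_in] by blast
  then have "x (t0 + p) = 0" using monodromy[OF x(1)] * by simp
  with V.flow_nonzero[OF x(1) t0_in shift_in[OF t0_in]] p_pos x(2) show "v = 0" by force
qed

text \<open>The same matrix advances solutions by a period at every point congruent to t0, also left
  of t0; this makes the stability bounds uniform in the starting point.\<close>

lemma monodromy_grid:
  assumes g: "g \<in> T" "g = t0 + real k * p \<or> g + real k * p = t0" and x: "V.flow x"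
  shows "x (g + real j * p) = ((*v) Phi ^^ j) (x g)"
proof -
  have 1: "x (g + p) = Phi *v x g" if "g \<in> T" "g = t0 + real k * p \<or> g + real k * p = t0" "V.flow x" for g k x
    using that(2)
  proof
    assume "g = t0 + real k * p"
    with monodromy[OF flow_shift_nat[OF that(3), of k]] show ?thesis by (simp add: algebra_simps)
  next
    assume g: "g + real k * p = t0"
    \<comment> \<open>Shifting x itself to start at t0 would need backward shifts of T. Instead a
      solution z starting at t0 is shifted forward and compared with x by uniqueness.\<close>
    obtain z where z: "V.flow z" "z t0 = x g" using V.flow_exists[OF t0_in] by blast
    have "x (g + p) = z (g + p + real k * p)"
      by (rule V.flow_unique[OF that(3) flow_shift_nat[OF z(1)] _ that(1) shift_in[OF that(1)]])
        (use z g in simp)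
    also have "g + p + real k * p = t0 + p" using g by simp
    also have "z (t0 + p) = Phi *v x g" using monodromy[OF z(1)] z(2) by simp
    finally show ?thesis .
  qed
  show ?thesis using x
  proof (induction j arbitrary: x)
    case (Suc j)
    have "x (g + real (Suc j) * p) = (\<lambda>t. x (t + p)) (g + real j * p)" by (simp add: algebra_simps)
    also have "\<dots> = ((*v) Phi ^^ j) (x (g + p))"
      by (rule Suc.IH[OF flow_shift[OF Suc.prems]])
    also have "x (g + p) = Phi *v x g" by (rule 1[OF g Suc.prems])
    finally show ?case by (simp add: funpow_swap1)
  qed simp
qed

lemma monodromy_power: "V.flow x \<Longrightarrow> x (t0 + real j * p) = ((*v) Phi ^^ j) (x t0)"
  using monodromy_grid[OF t0_in, of 0] by simp

lemma grid_point:
  assumes \<tau>: "\<tau> \<in> T"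
  obtains g k where "g \<in> T" "\<tau> \<le> g" "g < \<tau> + p" "g = t0 + real k * p \<or> g + real k * p = t0"
proof -
  \<comment> \<open>The first grid point at or after \<tau>. For negative m it belongs to T because
    \<tau> lies to its left.\<close>
  define m where "m = \<lceil>(\<tau> - t0) / p\<rceil>"
  define g where "g = t0 + of_int m * p"
  have "(\<tau> - t0) / p \<le> of_int m" "of_int m < (\<tau> - t0) / p + 1" unfolding m_def by linarith+
  then have g: "\<tau> \<le> g" "g < \<tau> + p" unfolding g_def using p_pos by (simp_all add: field_simps)
  show ?thesis
  proof (cases "0 \<le> m")
    case True
    then have "g = t0 + real (nat m) * p" by (simp add: g_def of_nat_nat)
    with shift_nat_in[OF t0_in] g show ?thesis by (intro that[of g "nat m"]) auto
  next
    case False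
    then have eq: "g = t0 - real (nat (- m)) * p" by (simp add: g_def of_nat_nat)
    then have "g \<in> T" using shift_back_nat_in[OF t0_in \<tau>, of "nat (- m)"] g by simp
    with eq g show ?thesis by (intro that[of g "nat (- m)"]) auto
  qed
qed

lemma period_index:
  assumes "g \<le> t" obtains j where "g + real j * p \<le> t" "t < g + (real j + 1) * p"
proof
  define j where "j = nat \<lfloor>(t - g) / p\<rfloor>"
  have "real j \<le> (t - g) / p" "(t - g) / p < real j + 1"
    using assms p_pos by (simp_all add: j_def of_nat_nat)
  then show "g + real j * p \<le> t" "t < g + (real j + 1) * p"
    using p_pos by (simp_all add: field_simps)
qed

lemma flow_period_growth:
  assumes "V.flow x" "s \<in> T" "t \<in> T" "s \<le> t" "t \<le> s + p"
  shows "norm (x t) \<le> 2 * exp (2 * K * p) * norm (x s)"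
proof -
  have "norm (x t) \<le> 2 * norm (x s) * exp (2 * K * (t - s))"
    by (rule V.flow_growth[OF assms(1-4)])
  also have "\<dots> \<le> 2 * norm (x s) * exp (2 * K * p)"
    using assms V.K_pos by (intro mult_left_mono) auto
  finally show ?thesis by (simp add: algebra_simps)
qed

text \<open>The first estimate counts periods from t0, with j bounded above by t, for comparison
  with generalized polynomials. The second starts anywhere: one period may pass before the grid is
  reached and one after the last full period, whence j + 2.\<close>

lemma growth_bound:
  obtains C where "1 \<le> C"
    "\<And>x t. \<lbrakk>V.flow x; t \<in> T; t0 \<le> t\<rbrakk> \<Longrightarrow> \<exists>j. t0 + real j * p \<le> t \<and> norm (x t) \<le> C * norm (((*v) Phi ^^ j) (x t0))"
    "\<And>x \<tau> t. \<lbrakk>V.flow x; \<tau> \<in> T; t \<in> T; \<tau> \<le> t\<rbrakk> \<Longrightarrow>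
      \<exists>j u. norm (x t) \<le> C * norm (((*v) Phi ^^ j) u) \<and> norm u \<le> C * norm (x \<tau>) \<and> t \<le> \<tau> + real (j + 2) * p"
proof
  define C where "C = 2 * exp (2 * K * p)"
  have "1 \<le> exp (2 * K * p)" using V.K_pos p_pos by simp
  then show C1: "1 \<le> C" unfolding C_def by linarith
  have main: "\<exists>j. g + real j * p \<le> t \<and> t < g + (real j + 1) * p \<and> norm (x t) \<le> C * norm (((*v) Phi ^^ j) (x g))"
    if x: "V.flow x" and t: "t \<in> T" "g \<le> t" and g: "g \<in> T" "g = t0 + real k * p \<or> g + real k * p = t0" for x t g k
  proof -
    obtain j where j: "g + real j * p \<le> t" "t < g + (real j + 1) * p" by (rule period_index[OF t(2)])
    have "norm (x t) \<le> C * norm (x (g + real j * p))" unfolding C_def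
      by (rule flow_period_growth[OF x shift_nat_in[OF g(1)] t(1) j(1)]) (use j in \<open>simp add: algebra_simps\<close>)
    then show ?thesis using monodromy_grid[OF g x] j by auto
  qed
  show "\<exists>j. t0 + real j * p \<le> t \<and> norm (x t) \<le> C * norm (((*v) Phi ^^ j) (x t0))"
    if "V.flow x" "t \<in> T" "t0 \<le> t" for x t
    using main[OF that t0_in, of 0] by auto
  show "\<exists>j u. norm (x t) \<le> C * norm (((*v) Phi ^^ j) u) \<and> norm u \<le> C * norm (x \<tau>) \<and> t \<le> \<tau> + real (j + 2) * p"
    if x: "V.flow x" and \<tau>: "\<tau> \<in> T" and t: "t \<in> T" "\<tau> \<le> t" for x \<tau> t
  proof -
    obtain g k where g: "g \<in> T" "\<tau> \<le> g" "g < \<tau> + p" "g = t0 + real k * p \<or> g + real k * p = t0"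
      by (rule grid_point[OF \<tau>])
    show ?thesis
    proof (cases "g \<le> t")
      case True
      from main[OF x t(1) True g(1,4)] obtain j where j: "t < g + (real j + 1) * p"
        "norm (x t) \<le> C * norm (((*v) Phi ^^ j) (x g))" by auto
      moreover have "norm (x g) \<le> C * norm (x \<tau>)" unfolding C_def
        by (rule flow_period_growth[OF x \<tau> g(1,2)]) (use g in simp)
      moreover have "t \<le> \<tau> + real (j + 2) * p" using j(1) g(3) by (simp add: algebra_simps)
      ultimately show ?thesis by blast
    next
      case False
      have "norm (x t) \<le> C * norm (((*v) Phi ^^ 0) (x \<tau>))" unfolding C_def
        using flow_period_growth[OF x \<tau> t] False g by simp
      moreover have "norm (x \<tau>) \<le> C * norm (x \<tau>)" using C1 by (simp add: mult_le_cancel_right1)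
      moreover have "t \<le> \<tau> + real (0 + 2) * p" using False g p_pos by simp
      ultimately show ?thesis by blast
    qed
  qed
qed

end

section \<open>Polynomials in a complex matrix\<close>

lemma mat_mult_component: "(mat c ** X) $ i $ j = c * (X :: complex^'n^'n) $ i $ j"
  by (simp add: matrix_matrix_mult_def mat_def if_distrib[where f = "\<lambda>x. x * _"] cong: if_cong)

lemma mult_mat_component: "((X :: complex^'n^'n) ** mat c) $ i $ j = c * X $ i $ j"
  by (simp add: matrix_matrix_mult_def mat_def if_distrib[where f = "\<lambda>x. _ * x"] mult.commute cong: if_cong)

lemma mat_commute: "mat c ** X = (X :: complex^'n^'n) ** mat c"
  by (simp add: vec_eq_iff mat_mult_component mult_mat_component)

lemma mat_add: "mat (a + b) = (mat a + mat b :: complex^'n^'n)"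
  by (simp add: vec_eq_iff mat_def)

lemma mat_mult: "mat (a * b) = (mat a ** mat b :: complex^'n^'n)"
  unfolding vec_eq_iff mat_mult_component by (simp add: mat_def)

lemma mat_vector: "mat c *v v = c *s (v :: complex^'n)"
  by (simp add: vec_eq_iff matrix_vector_mult_def mat_def if_distrib[where f = "\<lambda>x. x * _"] cong: if_cong)

lemma matrix_add_mult: "((A + B) ** C :: complex^'n^'n) = A ** C + B ** C"
  by (simp add: vec_eq_iff matrix_matrix_mult_def sum.distrib algebra_simps)

lemma matrix_diff_mult: "((A - B) ** C :: complex^'n^'n) = A ** C - B ** C"
  by (simp add: vec_eq_iff matrix_matrix_mult_def sum_subtractf algebra_simps)

lemma matrix_mult_diff: "(C ** (A - B) :: complex^'n^'n) = C ** A - C ** B"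
  by (simp add: vec_eq_iff matrix_matrix_mult_def sum_subtractf algebra_simps)

lemma matrix_mult_0 [simp]: "0 ** X = 0" "X ** 0 = (0 :: complex^'n^'n)"
  by (simp_all add: vec_eq_iff matrix_matrix_mult_def)

lemma matrix_sum_mult: "sum (f :: _ \<Rightarrow> complex^'n^'n) S ** (X :: complex^'n^'n) = (\<Sum>k\<in>S. f k ** X)"
  by (induction S rule: infinite_finite_induct) (auto simp: matrix_add_mult)

lemma matrix_mult_sum: "(X :: complex^'n^'n) ** sum (f :: _ \<Rightarrow> complex^'n^'n) S = (\<Sum>k\<in>S. X ** f k)"
  by (induction S rule: infinite_finite_induct) (auto simp: matrix_add_ldistrib)

lemma matrix_sum_vector: "sum f S *v (v :: complex^'n) = (\<Sum>k\<in>S. (f k :: complex^'n^'n) *v v)"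
  by (induction S rule: infinite_finite_induct) (auto simp: matrix_vector_mult_add_rdistrib)

lemma matpow_0 [simp]: "matpow M 0 = mat 1" and matpow_Suc [simp]: "matpow M (Suc k) = M ** matpow M k"
  by (simp_all add: matpow_def)

lemma matpow_vector: "matpow M k *v v = (((*v) M) ^^ k) v"
  by (induction k) (simp_all add: matrix_vector_mul_assoc[symmetric])

lemma poly_mat_altdef:
  assumes "degree q \<le> n" shows "poly_mat q M = (\<Sum>k\<le>n. mat (coeff q k) ** matpow M k)"
proof -
  have "(\<Sum>k\<le>n. mat (coeff q k) ** matpow M k) = (\<Sum>k\<le>degree q. mat (coeff q k) ** matpow M k)"
    by (rule sum.mono_neutral_right)
      (use assms in \<open>auto simp: coeff_eq_0 vec_eq_iff mat_mult_component\<close>)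
  then show ?thesis by (simp add: poly_mat_def)
qed

lemma poly_mat_0 [simp]: "poly_mat 0 M = 0"
  by (simp add: poly_mat_def vec_eq_iff mat_mult_component)

lemma poly_mat_pCons: "poly_mat (pCons a q) M = mat a + M ** poly_mat q M"
proof -
  have "poly_mat (pCons a q) M = (\<Sum>k\<le>Suc (degree q). mat (coeff (pCons a q) k) ** matpow M k)"
    by (rule poly_mat_altdef) (rule degree_pCons_le)
  also have "\<dots> = mat a + (\<Sum>k\<le>degree q. mat (coeff q k) ** (M ** matpow M k))"
    by (subst sum.atMost_Suc_shift) simp
  also have "(\<Sum>k\<le>degree q. mat (coeff q k) ** (M ** matpow M k)) = M ** poly_mat q M"
    unfolding poly_mat_def matrix_mult_sum
    by (intro sum.cong refl) (metis mat_commute matrix_mul_assoc)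
  finally show ?thesis .
qed

lemma poly_mat_const [simp]: "poly_mat [:c:] M = mat c"
  by (simp add: poly_mat_pCons vec_eq_iff matrix_matrix_mult_def)

lemma poly_mat_1 [simp]: "poly_mat 1 M = mat 1"
  by (simp add: one_pCons)

lemma poly_mat_linear: "poly_mat [:- a, 1:] M = M - mat a"
  by (simp add: poly_mat_pCons) (simp add: vec_eq_iff mat_def)

lemma poly_mat_add: "poly_mat (q + r) M = poly_mat q M + poly_mat r M"
  by (induction q r rule: poly_induct2) (simp_all add: poly_mat_pCons mat_add matrix_add_ldistrib)

lemma poly_mat_smult: "poly_mat (Polynomial.smult a q) M = mat a ** poly_mat q M"
proof (induction q)
  case (pCons b q)
  then show ?case
    by (simp add: poly_mat_pCons mat_mult matrix_add_ldistrib) (metis mat_commute matrix_mul_assoc)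
qed (simp add: vec_eq_iff mat_mult_component)

lemma poly_mat_mult: "poly_mat (q * r) M = poly_mat q M ** poly_mat r M"
proof (induction q)
  case (pCons b q)
  have "poly_mat (pCons b q * r) M = mat b ** poly_mat r M + M ** poly_mat (q * r) M"
    by (simp add: poly_mat_add poly_mat_smult poly_mat_pCons)
  then show ?case using pCons by (simp add: poly_mat_pCons matrix_add_mult matrix_mul_assoc)
qed (simp add: vec_eq_iff matrix_matrix_mult_def)

lemma poly_mat_sum: "poly_mat (sum f S) M = (\<Sum>x\<in>S. poly_mat (f x) M)"
  by (induction S rule: infinite_finite_induct) (simp_all add: poly_mat_add)

lemma poly_mat_power: "poly_mat (q ^ k) M = matpow (poly_mat q M) k"
  by (induction k) (simp_all add: poly_mat_mult)

lemma poly_mat_commute_poly: "poly_mat q M ** poly_mat r M = poly_mat r M ** poly_mat q M"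
  by (metis poly_mat_mult mult.commute)

lemma matpow_commute: "B ** M = M ** B \<Longrightarrow> B ** matpow M k = matpow M k ** B"
  by (induction k) (simp, metis matpow_Suc matrix_mul_assoc)

lemma poly_mat_commute:
  assumes "B ** M = M ** B" shows "B ** poly_mat q M = poly_mat q M ** B"
proof (induction q)
  case (pCons a q)
  then show ?case using assms
    by (simp add: poly_mat_pCons matrix_add_ldistrib matrix_add_mult mat_commute) (metis matrix_mul_assoc)
qed (simp add: vec_eq_iff matrix_matrix_mult_def)

lemma poly_mat_eigenvector: "M *v w = l *s w \<Longrightarrow> poly_mat q M *v w = poly q l *s w"
proof (induction q)
  case (pCons a q)
  have "poly_mat (pCons a q) M *v w = a *s w + M *v (poly_mat q M *v w)"
    by (simp add: poly_mat_pCons matrix_vector_mult_add_rdistrib mat_vector matrix_vector_mul_assoc)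
  also have "\<dots> = a *s w + poly q l *s (l *s w)"
    using pCons by (simp add: vector_scalar_commute)
  finally show ?case by (simp add: vector_sadd_rdistrib mult.commute)
qed simp

text \<open>On the span of v and w the matrix acts as a 2 x 2 Jordan block, where the off-diagonal
  entry of a polynomial is its derivative.\<close>

lemma poly_mat_chain:
  assumes "M *v w = l *s w" "M *v v = l *s v + w"
  shows "poly_mat q M *v v = poly q l *s v + poly (pderiv q) l *s w"
proof (induction q)
  case (pCons a q)
  have "poly_mat (pCons a q) M *v v = a *s v + M *v (poly_mat q M *v v)"
    by (simp add: poly_mat_pCons matrix_vector_mult_add_rdistrib mat_vector matrix_vector_mul_assoc)
  also have "M *v (poly_mat q M *v v) = poly q l *s (l *s v + w) + poly (pderiv q) l *s (l *s w)"
    using pCons assms by (simp add: matrix_vector_right_distrib vector_scalar_commute)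
  finally show ?case
    by (simp add: vec_eq_iff pderiv_pCons algebra_simps)
qed simp

section \<open>Passage to matrices indexed by natural numbers, and the Cayley-Hamilton
  theorem\<close>

definition vec_enum :: "nat \<Rightarrow> 'n::finite" where
  "vec_enum = (SOME e. bij_betw e {..<CARD('n)} UNIV)"

lemma bij_vec_enum: "bij_betw (vec_enum :: nat \<Rightarrow> 'n::finite) {..<CARD('n)} UNIV"
proof -
  have "\<exists>e :: nat \<Rightarrow> 'n. bij_betw e {..<CARD('n)} UNIV"
    using ex_bij_betw_nat_finite[OF finite[of "UNIV :: 'n set"]] by (simp add: lessThan_atLeast0)
  then show ?thesis unfolding vec_enum_def by (rule someI_ex)
qed

lemma jnf_of_eq: "jnf_of (M :: 'a^'n^'n) = Matrix.mat CARD('n) CARD('n) (\<lambda>(i, j). M $ vec_enum i $ vec_enum j)"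
  by (simp add: jnf_of_def vec_enum_def Let_def)

lemma jnf_of_carrier: "jnf_of (M :: 'a^'n^'n) \<in> carrier_mat CARD('n) CARD('n)"
  by (simp add: jnf_of_eq)

lemma sum_vec_enum: "(\<Sum>x\<in>UNIV. f x) = (\<Sum>i<CARD('n). f (vec_enum i :: 'n::finite))"
  by (rule sum.reindex_bij_betw[OF bij_vec_enum, symmetric])

lemma vec_enum_eq_iff: "\<lbrakk>i < CARD('n); j < CARD('n)\<rbrakk> \<Longrightarrow> (vec_enum i :: 'n::finite) = vec_enum j \<longleftrightarrow> i = j"
  using bij_vec_enum by (auto simp: bij_betw_def inj_on_def)

lemma vec_enum_ex: "\<exists>i<CARD('n). (x :: 'n::finite) = vec_enum i"
  using bij_vec_enum[where 'n='n] by (auto simp: bij_betw_def image_iff)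

lemma matrix_vector_axis: "(M :: complex^'n^'m) *v axis k 1 = column k M"
  by (simp add: vec_eq_iff matrix_vector_mult_def axis_def column_def if_distrib cong: if_cong)

text \<open>Let C = xI - M over polynomials and B its adjugate, so C B = c I. Reading the entries of
  C as polynomials in M, each column combination of basis vectors vanishes; multiplying by the
  entries of B and summing gives c(M) e_k = 0.\<close>

theorem cayley_hamilton: "poly_mat (charpoly M) M = 0" for M :: "complex^'n^'n"
proof -
  let ?n = "CARD('n)" and ?A = "jnf_of M"
  define C where "C = char_poly_matrix ?A"
  define B where "B = adj_mat C"
  have Cc: "C \<in> carrier_mat ?n ?n" unfolding C_def using jnf_of_carrier[of M] by simp
  have Bc: "B \<in> carrier_mat ?n ?n" unfolding B_def using adj_mat(1)[OF Cc] .
  have CB: "(\<Sum>j<?n. C $$ (i, j) * B $$ (j, k)) = (if i = k then charpoly M else 0)" if "i < ?n" "k < ?n" for i k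
  proof -
    have "(C * B) $$ (i, k) = (charpoly M \<cdot>\<^sub>m 1\<^sub>m ?n) $$ (i, k)"
      unfolding B_def adj_mat(2)[OF Cc] by (simp add: charpoly_def char_poly_def C_def)
    then show ?thesis using that Cc Bc
      by (simp add: scalar_prod_def lessThan_atLeast0 if_distrib cong: if_cong)
  qed
  have Cij: "C $$ (i, j) = (if i = j then [:0, 1:] else 0) + [:- (M $ vec_enum i $ vec_enum j):]"
    if "i < ?n" "j < ?n" for i j
    using that unfolding C_def char_poly_matrix_def by (simp add: jnf_of_eq)
  define e where "e i = axis (vec_enum i :: 'n) (1::complex)" for i
  have Mx: "poly_mat [:0, 1:] M = M" using poly_mat_linear[of 0 M] by (simp add: vec_eq_iff mat_def)
  \<comment> \<open>This is the identity M e_j = sum over i of M_ij e_i, the expansion of the j-th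
    column.\<close>
  have col: "(\<Sum>i<?n. poly_mat (C $$ (i, j)) M *v e i) = 0" if j: "j < ?n" for j
  proof -
    have "(\<Sum>i<?n. poly_mat (C $$ (i, j)) M *v e i) =
       (\<Sum>i<?n. (if i = j then M *v e j else 0) - M $ vec_enum i $ vec_enum j *s e i)"
    proof (intro sum.cong refl)
      fix i assume "i \<in> {..<?n}"
      moreover have "(- c) *s u = - (c *s u)" for c :: complex and u :: "complex^'n" by (simp add: vec_eq_iff)
      ultimately show "poly_mat (C $$ (i, j)) M *v e i = (if i = j then M *v e j else 0) - M $ vec_enum i $ vec_enum j *s e i"
        using j by (simp add: Cij poly_mat_add Mx matrix_vector_mult_add_rdistrib mat_vector)
    qed
    also have "\<dots> = M *v e j - (\<Sum>i<?n. M $ vec_enum i $ vec_enum j *s e i)"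
      using j by (simp add: sum_subtractf)
    also have "(\<Sum>i<?n. M $ vec_enum i $ vec_enum j *s e i) = (\<Sum>x\<in>UNIV. M $ x $ vec_enum j *s axis x 1)"
      by (simp add: sum_vec_enum e_def)
    also have "\<dots> = M *v e j"
      unfolding e_def matrix_vector_axis
      by (simp add: vec_eq_iff column_def axis_def if_distrib cong: if_cong)
    finally show ?thesis by simp
  qed
  have "poly_mat (charpoly M) M *v e k = 0" if k: "k < ?n" for k
  proof -
    have "poly_mat (charpoly M) M *v e k = (\<Sum>i<?n. poly_mat (if i = k then charpoly M else 0) M *v e i)"
      using k by (simp add: if_distrib[where f = "\<lambda>q. poly_mat q M *v _"] cong: if_cong)
    also have "\<dots> = (\<Sum>i<?n. poly_mat (\<Sum>j<?n. C $$ (i, j) * B $$ (j, k)) M *v e i)"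
      using k by (intro sum.cong refl) (simp only: CB lessThan_iff)
    also have "\<dots> = (\<Sum>i<?n. \<Sum>j<?n. poly_mat (B $$ (j, k)) M *v (poly_mat (C $$ (i, j)) M *v e i))"
      by (simp add: poly_mat_sum matrix_sum_vector poly_mat_mult matrix_vector_mul_assoc
          poly_mat_commute_poly[of "C $$ _"])
    also have "\<dots> = (\<Sum>j<?n. poly_mat (B $$ (j, k)) M *v (\<Sum>i<?n. poly_mat (C $$ (i, j)) M *v e i))"
      by (subst sum.swap) (simp add: matrix_vector_right_distrib vec.linear_sum linear_sum[OF matrix_vector_mul_linear])
    also have "\<dots> = 0" by (simp add: col)
    finally show ?thesis .
  qed
  then have "poly_mat (charpoly M) M *v axis x 1 = 0" for x
    using vec_enum_ex[of x] by (auto simp: e_def)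
  then show ?thesis
    by (metis (no_types, lifting) vec_eq_iff matrix_vector_axis column_def vec_lambda_beta zero_index)
qed

section \<open>Jordan blocks and chains\<close>

definition jnf_vec :: "'a^'n \<Rightarrow> 'a Matrix.vec" where
  "jnf_vec w = Matrix.vec CARD('n) (\<lambda>i. w $ vec_enum i)"

lemma jnf_vec_carrier: "jnf_vec (w :: 'a^'n) \<in> carrier_vec CARD('n)"
  by (simp add: jnf_vec_def)

lemma jnf_vec_inject: "jnf_vec (w :: 'a^'n) = jnf_vec w' \<longleftrightarrow> w = w'"
proof
  assume *: "jnf_vec w = jnf_vec w'"
  have "w $ vec_enum i = w' $ vec_enum i" if "i < CARD('n)" for i
    using arg_cong[OF *, of "\<lambda>v. vec_index v i"] that by (simp add: jnf_vec_def)
  then show "w = w'" unfolding vec_eq_iff using vec_enum_ex by metis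
qed simp

lemma jnf_vec_surj: assumes "v \<in> carrier_vec CARD('n)" obtains w :: "'a^'n" where "jnf_vec w = v"
proof
  show "jnf_vec (\<chi> x. vec_index v (inv_into {..<CARD('n)} vec_enum x) :: 'a^'n) = v"
    using assms bij_vec_enum[where 'n='n]
    by (intro eq_vecI) (auto simp: jnf_vec_def bij_betw_def)
qed

lemma jnf_vec_0: "jnf_vec (0 :: 'a::zero^'n) = 0\<^sub>v CARD('n)"
  by (intro eq_vecI) (auto simp: jnf_vec_def)

lemma jnf_vec_scale: "jnf_vec (c *s w :: 'a::times^'n) = c \<cdot>\<^sub>v jnf_vec w"
  by (intro eq_vecI) (auto simp: jnf_vec_def)

lemma jnf_vec_mult: "jnf_of M *\<^sub>v jnf_vec w = jnf_vec (M *v (w :: complex^'n))"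
proof (rule eq_vecI)
  fix i assume "i < dim_vec (jnf_vec (M *v w))"
  then have i: "i < CARD('n)" by (simp add: jnf_vec_def)
  have "vec_index (jnf_of M *\<^sub>v jnf_vec w) i = (\<Sum>j<CARD('n). M $ vec_enum i $ vec_enum j * w $ vec_enum j)"
    using i by (simp add: jnf_of_eq jnf_vec_def scalar_prod_def lessThan_atLeast0)
  then show "vec_index (jnf_of M *\<^sub>v jnf_vec w) i = vec_index (jnf_vec (M *v w)) i"
    using i by (simp add: jnf_vec_def matrix_vector_mult_def sum_vec_enum)
qed (simp add: jnf_of_eq jnf_vec_def)

lemma charpoly_root_eigenvector:
  fixes M :: "complex^'n^'n"
  assumes "poly (charpoly M) l = 0"
  obtains w where "w \<noteq> 0" "M *v w = l *s w"
proof -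
  have "eigenvalue (jnf_of M) l"
    using assms eigenvalue_root_char_poly[OF jnf_of_carrier[of M], of l] by (simp add: charpoly_def)
  then obtain v where "eigenvector (jnf_of M) v l" by (auto simp: eigenvalue_def)
  then have v: "v \<in> carrier_vec CARD('n)" "v \<noteq> 0\<^sub>v CARD('n)" "jnf_of M *\<^sub>v v = l \<cdot>\<^sub>v v"
    using jnf_of_carrier[of M] by (auto simp: eigenvector_def)
  from v(1) obtain w :: "complex^'n" where w: "jnf_vec w = v" by (rule jnf_vec_surj)
  have "M *v w = l *s w" using v(3) by (simp add: w[symmetric] jnf_vec_mult jnf_vec_scale[symmetric] jnf_vec_inject)
  moreover have "w \<noteq> 0" using v(2) by (auto simp: w[symmetric] jnf_vec_0)
  ultimately show ?thesis by (rule that[rotated])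
qed

lemma charpoly_monic: "lead_coeff (charpoly M) = 1" "degree (charpoly (M :: complex^'n^'n)) = CARD('n)"
  using degree_monic_char_poly[OF jnf_of_carrier[of M]] by (simp_all add: charpoly_def)

lemma charpoly_nonzero: "charpoly M \<noteq> 0"
  using charpoly_monic(1)[of M] by auto

lemma eigenvector_charpoly_root:
  assumes "M *v w = l *s w" "w \<noteq> 0" shows "poly (charpoly M) l = 0"
proof -
  have "poly (charpoly M) l *s w = 0"
    using poly_mat_eigenvector[OF assms(1), of "charpoly M"] by (simp add: cayley_hamilton)
  with assms(2) show ?thesis by (auto simp: vec_eq_iff)
qed

text \<open>Evaluating c(M) = 0 on the eigenvector gives c(l) = 0, and then on the chain c'(l) w =
  0; so l is a double root.\<close>

lemma chain_charpoly_order: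
  assumes "M *v w = l *s w" "w \<noteq> 0" "M *v v = l *s v + w"
  shows "2 \<le> order l (charpoly M)"
proof -
  let ?c = "charpoly M"
  have c: "poly ?c l = 0" by (rule eigenvector_charpoly_root[OF assms(1,2)])
  have "poly (pderiv ?c) l *s w = 0"
    using poly_mat_chain[OF assms(1,3), of ?c] c by (simp add: cayley_hamilton)
  with assms(2) have c': "poly (pderiv ?c) l = 0" by (auto simp: vec_eq_iff)
  from c obtain d where d: "?c = [:- l, 1:] * d" by (auto simp: poly_eq_0_iff_dvd)
  have "poly d l = 0" using c' unfolding d pderiv_mult by (simp add: pderiv_pCons)
  then obtain e where "d = [:- l, 1:] * e" by (auto simp: poly_eq_0_iff_dvd)
  with d have "?c = [:- l, 1:] ^ 2 * e" by (simp only: power2_eq_square mult.assoc)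
  then have "[:- l, 1:] ^ 2 dvd ?c" by (rule dvdI)
  then show ?thesis using charpoly_nonzero order_divides by blast
qed

lemma jnf_of_shift: "char_matrix (jnf_of (M :: complex^'n^'n)) a = jnf_of (M - mat a)"
  by (rule eq_matI) (auto simp: char_matrix_def jnf_of_eq mat_def vec_enum_eq_iff)

lemma multiple_jordan_block_imp_chain:
  fixes R :: "complex^'n^'n"
  assumes "has_jordan_block R a k" "1 < k"
  obtains v w where "w \<noteq> 0" "R *v w = a *s w" "R *v v = a *s v + w"
proof -
  let ?A = "jnf_of R" and ?C = "jnf_of (R - mat a)"
  from assms(1) obtain bs where bs: "jordan_nf ?A bs" "(k, a) \<in> set bs" by (auto simp: has_jordan_block_def)
  have C: "?C \<in> carrier_mat CARD('n) CARD('n)" by (rule jnf_of_carrier)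
  define ns where "ns = map fst [(n, e)\<leftarrow>bs . e = a]"
  have kns: "k \<in> set ns" using bs(2) by (force simp: ns_def)
  have le: "(\<Sum>n\<leftarrow>ns. min 1 n) \<le> (\<Sum>n\<leftarrow>ns. min 2 n)" for ns :: "nat list"
    by (rule sum_list_mono) simp
  \<comment> \<open>With block sizes n, the kernel of the j-th power of R - a has dimension the sum
    of min j n. The block of size k > 1 makes the second kernel strictly larger than the first; a
    vector in the difference starts the chain.\<close>
  have "(\<Sum>n\<leftarrow>ns. min 1 n) < (\<Sum>n\<leftarrow>ns. min 2 n)" using kns
  proof (induction ns)
    case (Cons n ns)
    show ?case
    proof (cases "n = k")
      case True
      then show ?thesis using le[of ns] assms(2) by simp
    next
      case False
      then have "(\<Sum>n\<leftarrow>ns. min 1 n) < (\<Sum>n\<leftarrow>ns. min 2 n)" using Cons by simp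
      moreover have "min 1 n \<le> min 2 n" by simp
      ultimately show ?thesis by simp
    qed
  qed simp
  then have "dim_gen_eigenspace ?A a 1 \<noteq> dim_gen_eigenspace ?A a 2"
    unfolding dim_gen_eigenspace[OF bs(1)] ns_def[symmetric] by simp
  then have "kernel_dim (?C ^\<^sub>m 1) \<noteq> kernel_dim (?C ^\<^sub>m 2)"
    by (simp add: dim_gen_eigenspace_def jnf_of_shift)
  then have "mat_kernel (?C ^\<^sub>m 1) \<noteq> mat_kernel (?C ^\<^sub>m 2)"
    using C unfolding kernel_dim_def by auto
  moreover have C2: "?C ^\<^sub>m 2 = ?C * ?C" using C by (simp add: numeral_2_eq_2)
  have C1: "?C ^\<^sub>m 1 = ?C" using C by simp
  have mk: "x \<in> mat_kernel ?C \<longleftrightarrow> x \<in> carrier_vec CARD('n) \<and> ?C *\<^sub>v x = 0\<^sub>v CARD('n)"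
    "x \<in> mat_kernel (?C * ?C) \<longleftrightarrow> x \<in> carrier_vec CARD('n) \<and> ?C *\<^sub>v (?C *\<^sub>v x) = 0\<^sub>v CARD('n)" for x
    using C by (auto simp: mat_kernel_def)
  have "?C *\<^sub>v 0\<^sub>v CARD('n) = 0\<^sub>v CARD('n)" using C by auto
  then have "mat_kernel ?C \<subseteq> mat_kernel (?C * ?C)" using mk by auto
  ultimately obtain x where x: "x \<in> carrier_vec CARD('n)" "?C *\<^sub>v (?C *\<^sub>v x) = 0\<^sub>v CARD('n)" "?C *\<^sub>v x \<noteq> 0\<^sub>v CARD('n)"
    unfolding C1 C2 using mk by blast
  from x(1) obtain v :: "complex^'n" where v: "jnf_vec v = x" by (rule jnf_vec_surj)
  define w where "w = (R - mat a) *v v"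
  have "w \<noteq> 0" using x(3) by (simp add: v[symmetric] jnf_vec_mult jnf_vec_0[symmetric] jnf_vec_inject w_def)
  moreover have "(R - mat a) *v w = 0"
    using x(2) by (simp add: v[symmetric] jnf_vec_mult jnf_vec_0[symmetric] jnf_vec_inject w_def)
  then have "R *v w = a *s w" by (simp add: matrix_vector_mult_diff_rdistrib mat_vector)
  moreover have "R *v v = a *s v + w" by (simp add: w_def matrix_vector_mult_diff_rdistrib mat_vector)
  ultimately show ?thesis by (rule that)
qed

lemma jordan_matrix_simple_blocks:
  assumes "\<forall>(k, a)\<in>set bs. k = 1"
  shows "jordan_matrix bs \<in> carrier_mat (length bs) (length bs) \<and>
    (\<forall>i<length bs. \<forall>j<length bs. jordan_matrix bs $$ (i, j) = (if i = j then snd (bs ! i) else 0))"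
  using assms
proof (induction bs)
  case (Cons b bs)
  obtain a where b: "b = (1, a)" using Cons.prems by (cases b) auto
  have IH: "jordan_matrix bs \<in> carrier_mat (length bs) (length bs)"
    "\<And>i j. \<lbrakk>i < length bs; j < length bs\<rbrakk> \<Longrightarrow> jordan_matrix bs $$ (i, j) = (if i = j then snd (bs ! i) else 0)"
    using Cons by auto
  have eq: "jordan_matrix (b # bs) = four_block_mat (jordan_block 1 a) (0\<^sub>m 1 (length bs)) (0\<^sub>m (length bs) 1) (jordan_matrix bs)"
    using IH(1) by (simp add: b jordan_matrix_def Let_def)
  have dims: "dim_row (jordan_matrix bs) = length bs" "dim_col (jordan_matrix bs) = length bs" using IH(1) by auto
  have "four_block_mat (jordan_block 1 a) (0\<^sub>m 1 (length bs)) (0\<^sub>m (length bs) 1) (jordan_matrix bs) $$ (i, j) =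
      (if i = j then snd ((b # bs) ! i) else 0)" if "i < Suc (length bs)" "j < Suc (length bs)" for i j
    using that IH(2)[of "i - 1" "j - 1"]
    by (cases i; cases j) (simp_all add: dims jordan_block_def b del: jordan_matrix_dim)
  then show ?case unfolding eq by (auto simp: dims simp del: jordan_matrix_dim intro!: carrier_matI)
qed (auto simp: jordan_matrix_def)

text \<open>If all blocks of some Jordan form have size 1, the matrix is diagonal in suitable
  coordinates, and a chain can be excluded coordinate by coordinate.\<close>

lemma simple_jordan_blocks_imp_no_chain:
  fixes R :: "complex^'n^'n"
  assumes simple: "\<And>a k. \<lbrakk>poly (charpoly R) a = 0; has_jordan_block R a k\<rbrakk> \<Longrightarrow> k = 1"
    and chain: "R *v w = a *s w" "R *v v = a *s v + w"
  shows "w = 0"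
proof -
  let ?A = "jnf_of R" and ?n = "CARD('n)"
  have A: "?A \<in> carrier_mat ?n ?n" by (rule jnf_of_carrier)
  obtain bs where bs: "jordan_nf ?A bs"
    using char_poly_factorized[OF A] jordan_nf_exists[OF A] by blast
  have "k = 1" if "(k, e) \<in> set bs" for k e
  proof (rule simple)
    show "has_jordan_block R e k" using bs that by (auto simp: has_jordan_block_def)
    \<comment> \<open>The hypothesis speaks of blocks at roots of the characteristic polynomial; a
      nonempty block does belong to a root.\<close>
    have "k \<noteq> 0" using bs that by (force simp: jordan_nf_def)
    then have "poly ([:- e, 1:] ^ k) e = 0" by simp
    moreover have "[:- e, 1:] ^ k dvd char_poly ?A" unfolding jordan_nf_char_poly[OF bs]
      by (rule prod_list_dvd) (use that in force)
    ultimately show "poly (charpoly R) e = 0" unfolding charpoly_def by (metis dvd_def mult_zero_left poly_mult)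
  qed
  then have one: "\<forall>(k, e)\<in>set bs. k = 1" by auto
  define J where "J = jordan_matrix bs"
  from bs obtain P Q where wit: "similar_mat_wit ?A J P Q" unfolding jordan_nf_def similar_mat_def J_def by blast
  from similar_mat_witD2[OF A wit] have PQ: "P * Q = 1\<^sub>m ?n" "Q * P = 1\<^sub>m ?n" "?A = P * J * Q"
    and car: "J \<in> carrier_mat ?n ?n" "P \<in> carrier_mat ?n ?n" "Q \<in> carrier_mat ?n ?n" by auto
  have len: "length bs = ?n"
    using conjunct1[OF jordan_matrix_simple_blocks[OF one]] car(1) unfolding J_def by (metis carrier_matD(1))
  define d where "d i = snd (bs ! i)" for i
  have Jx: "vec_index (J *\<^sub>v x) i = d i * vec_index x i" if "i < ?n" "x \<in> carrier_vec ?n" for i x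
  proof -
    have "vec_index (J *\<^sub>v x) i = (\<Sum>j = 0..<?n. J $$ (i, j) * vec_index x j)"
      using that car(1) by (simp add: scalar_prod_def)
    also have "\<dots> = (\<Sum>j = 0..<?n. if i = j then d i * vec_index x j else 0)"
      by (intro sum.cong refl) (use jordan_matrix_simple_blocks[OF one] that len in \<open>auto simp: J_def d_def\<close>)
    finally show ?thesis using that by simp
  qed
  let ?v = "jnf_vec v" and ?w = "jnf_vec w"
  have vc: "?v \<in> carrier_vec ?n" "?w \<in> carrier_vec ?n" by (rule jnf_vec_carrier)+
  have QA: "Q *\<^sub>v (?A *\<^sub>v x) = J *\<^sub>v (Q *\<^sub>v x)" if "x \<in> carrier_vec ?n" for x
  proof -
    have "Q *\<^sub>v (?A *\<^sub>v x) = (Q * (P * J * Q)) *\<^sub>v x" unfolding PQ(3)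
      by (rule assoc_mult_mat_vec[symmetric, OF car(3) _ that]) (use car in auto)
    also have "Q * (P * J * Q) = (Q * P) * (J * Q)" using car by (simp add: assoc_mult_mat[of _ ?n ?n _ ?n _ ?n])
    also have "\<dots> *\<^sub>v x = J *\<^sub>v (Q *\<^sub>v x)" using that car by (simp add: PQ(2) assoc_mult_mat_vec)
    finally show ?thesis .
  qed
  have Aw: "?A *\<^sub>v ?w = a \<cdot>\<^sub>v ?w" by (simp add: jnf_vec_mult chain jnf_vec_scale)
  have Av: "?A *\<^sub>v ?v = a \<cdot>\<^sub>v ?v + ?w"
    unfolding jnf_vec_mult chain by (intro eq_vecI) (auto simp: jnf_vec_def)
  have "vec_index (Q *\<^sub>v ?w) i = 0" if i: "i < ?n" for i
  proof -
    have "Q *\<^sub>v (a \<cdot>\<^sub>v ?w) = a \<cdot>\<^sub>v (Q *\<^sub>v ?w)" "Q *\<^sub>v (a \<cdot>\<^sub>v ?v + ?w) = a \<cdot>\<^sub>v (Q *\<^sub>v ?v) + Q *\<^sub>v ?w"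
      using car(3) vc by (auto simp: mult_add_distrib_mat_vec[of Q ?n ?n])
    then have 1: "J *\<^sub>v (Q *\<^sub>v ?w) = a \<cdot>\<^sub>v (Q *\<^sub>v ?w)"
      and 2: "J *\<^sub>v (Q *\<^sub>v ?v) = a \<cdot>\<^sub>v (Q *\<^sub>v ?v) + Q *\<^sub>v ?w"
      using QA[OF vc(2)] QA[OF vc(1)] by (simp_all add: Aw Av)
    have Qc: "Q *\<^sub>v ?w \<in> carrier_vec ?n" "Q *\<^sub>v ?v \<in> carrier_vec ?n" using car(3) vc by auto
    have "d i * vec_index (Q *\<^sub>v ?w) i = a * vec_index (Q *\<^sub>v ?w) i"
      using arg_cong[OF 1, of "\<lambda>x. vec_index x i"] i car Jx[OF i Qc(1)] by simp
    moreover have "d i * vec_index (Q *\<^sub>v ?v) i = a * vec_index (Q *\<^sub>v ?v) i + vec_index (Q *\<^sub>v ?w) i"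
      using arg_cong[OF 2, of "\<lambda>x. vec_index x i"] i car Jx[OF i Qc(2)] by simp
    \<comment> \<open>If d i = a, the equation for v leaves w_i = 0; otherwise the one for w
      does.\<close>
    ultimately show ?thesis by (cases "d i = a") auto
  qed
  then have "Q *\<^sub>v ?w = 0\<^sub>v ?n" using car(3) by (intro eq_vecI) auto
  then have "P *\<^sub>v (Q *\<^sub>v ?w) = 0\<^sub>v ?n" using car(2) by auto
  moreover have "P *\<^sub>v (Q *\<^sub>v ?w) = ?w" using car vc PQ(1) by (metis assoc_mult_mat_vec one_mult_mat_vec)
  ultimately show ?thesis by (simp add: jnf_vec_0[symmetric] jnf_vec_inject)
qed

section \<open>Partial fractions and spectral projections\<close>

text \<open>Lifting from x^m to x^(m+1), with x = X - l: modulo x both v and b are constants, so v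
  is a multiple k b there, and the part k x^m b of v x^m can be moved into the coefficient of
  b.\<close>

lemma bezout_linear_power:
  fixes b :: "'a::field poly"
  assumes "poly b l \<noteq> 0"
  shows "\<exists>u v. u * b + v * [:- l, 1:] ^ m = 1"
proof (induction m)
  case 0
  show ?case by (intro exI[of _ 0] exI[of _ 1]) simp
next
  case (Suc m)
  define x where "x = [:- l, 1:]"
  from Suc obtain u v where uv: "u * b + v * x ^ m = 1" by (auto simp: x_def)
  have "x dvd b - [:poly b l:]" "x dvd v - [:poly v l:]"
    by (simp_all add: x_def poly_eq_0_iff_dvd[symmetric])
  then obtain b' v' where b': "b = [:poly b l:] + x * b'" and v': "v = [:poly v l:] + x * v'"
    unfolding dvd_def by (metis diff_add_cancel add.commute)
  define k where "k = [:poly v l / poly b l:]"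
  have "[:poly v l:] = k * [:poly b l:]" using assms by (simp add: k_def)
  also have "[:poly b l:] = b - x * b'" using b' by (metis add_diff_cancel_right')
  finally have v: "v = k * (b - x * b') + x * v'" using v' by simp
  have "(u + k * x ^ m) * b + (v' - k * b') * x ^ Suc m = u * b + (k * (b - x * b') + x * v') * x ^ m"
    by (simp add: algebra_simps)
  also have "\<dots> = 1" using uv unfolding v .
  finally show ?case unfolding x_def by blast
qed

locale monic_complex_poly =
  fixes c :: "complex poly"
  assumes monic: "lead_coeff c = 1" and nonconstant: "0 < degree c"
begin

text \<open>With $c$ the characteristic polynomial of $M$, \<open>b l\<close> is the paper's $b_i$, and below \<open>P l\<close> is $P_i(M)$
  and \<open>X l r\<close> is the factor of $P_i(M)$ in the definition of $M^r$ (for $\lambda_i = l$).\<close>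

definition S where "S = {r. poly c r = 0}"
definition q where "q r = [:- r, 1:] ^ order r c"
definition b where "b l = (\<Prod>r\<in>S - {l}. q r)"

lemma c_nonzero: "c \<noteq> 0" using monic by auto

lemma finite_S: "finite S" unfolding S_def using c_nonzero by (rule poly_roots_finite)

lemma decompose: "c = (\<Prod>r\<in>S. q r)"
  using complex_poly_decompose[of c] monic by (simp add: S_def q_def)

lemma decompose_at: "l \<in> S \<Longrightarrow> c = q l * b l"
  unfolding b_def by (subst decompose) (rule prod.remove[OF finite_S])

lemma order_pos: "l \<in> S \<Longrightarrow> 0 < order l c"
  using c_nonzero order_root[of c l] by (simp add: S_def)

lemma degree_q: "degree (q l) = order l c" by (simp add: q_def degree_linear_power)

lemma q_nonzero: "q l \<noteq> 0" by (simp add: q_def)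

lemma b_nonzero: "b l \<noteq> 0" unfolding b_def using finite_S q_nonzero by simp

lemma degree_decompose: "degree c = (\<Sum>r\<in>S. order r c)"
  unfolding arg_cong[OF decompose, of degree]
  by (subst degree_prod_sum_eq) (simp_all add: q_nonzero degree_q)

lemma degree_b: "l \<in> S \<Longrightarrow> order l c + degree (b l) = degree c"
  using decompose_at[of l] degree_mult_eq[OF q_nonzero b_nonzero, of l l] by (simp add: degree_q)

lemma q_dvd_b: "\<lbrakk>r \<in> S; r \<noteq> l\<rbrakk> \<Longrightarrow> q r dvd b l"
  unfolding b_def using finite_S by (intro dvd_prodI) auto

lemma poly_b_nonzero: "poly (b l) l \<noteq> 0"
  unfolding b_def poly_prod using finite_S by (auto simp: q_def)

text \<open>Multiplying by c clears denominators off the roots. The further factor c in the proof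
  makes the polynomial identity hold at the roots as well, after which c is cancelled.\<close>

lemma linear_combination_iff:
  "(\<forall>z. poly c z \<noteq> 0 \<longrightarrow> 1 / poly c z = (\<Sum>r | poly c r = 0. poly (a r) z / (z - r) ^ order r c))
    \<longleftrightarrow> (\<Sum>r\<in>S. a r * b r) = 1" (is "?L \<longleftrightarrow> ?R")
proof -
  have *: "1 / poly c z = (\<Sum>r | poly c r = 0. poly (a r) z / (z - r) ^ order r c)
      \<longleftrightarrow> poly (\<Sum>r\<in>S. a r * b r) z = 1" if z: "poly c z \<noteq> 0" for z
  proof -
    have "poly c z * (poly (a r) z / (z - r) ^ order r c) = poly (a r * b r) z" if r: "r \<in> S" for r
    proof -
      have "z - r \<noteq> 0" using z r by (auto simp: S_def)
      moreover have "poly c z = (z - r) ^ order r c * poly (b r) z"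
        using arg_cong[OF decompose_at[OF r], of "\<lambda>p. poly p z"] by (simp add: q_def)
      ultimately show ?thesis by simp
    qed
    then have "poly c z * (\<Sum>r\<in>S. poly (a r) z / (z - r) ^ order r c) = poly (\<Sum>r\<in>S. a r * b r) z"
      by (simp add: sum_distrib_left poly_sum)
    then show ?thesis using z by (auto simp: S_def field_simps)
  qed
  show ?thesis
  proof
    assume ?R then show ?L using * by simp
  next
    assume ?L
    then have "poly c z * (poly (\<Sum>r\<in>S. a r * b r) z - 1) = 0" for z using * by auto
    then have "c * ((\<Sum>r\<in>S. a r * b r) - 1) = 0"
      by (intro poly_all_0_iff_0[THEN iffD1] allI) simp
    then show ?R using c_nonzero by simp
  qed
qed

text \<open>Chinese remaindering: $a_l$ is the inverse of $b_l$ modulo $q_l$.\<close>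

lemma numerators_exist:
  "\<exists>a. (\<forall>r. if poly c r = 0 then degree (a r) < order r c else a r = 0) \<and> (\<Sum>r\<in>S. a r * b r) = 1"
proof -
  have "\<exists>u. q l dvd u * b l - 1 \<and> (u = 0 \<or> degree u < order l c)" if l: "l \<in> S" for l
  proof -
    obtain u v where uv: "u * b l + v * q l = 1"
      using bezout_linear_power[OF poly_b_nonzero, of l "order l c"] by (auto simp: q_def)
    let ?u = "u mod q l"
    have "?u * b l - 1 = q l * (- v - (u div q l) * b l)"
    proof -
      define m d where "m = u mod q l" and "d = u div q l"
      have u: "u = d * q l + m" by (simp only: m_def d_def div_mult_mod_eq)
      have "m * b l - 1 = m * b l - (u * b l + v * q l)" using uv by simp
      also have "\<dots> = q l * (- v - d * b l)" unfolding u by (simp add: algebra_simps)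
      finally show ?thesis by (simp add: m_def d_def)
    qed
    moreover have "?u = 0 \<or> degree ?u < degree (q l)" by (rule degree_mod_less[OF q_nonzero])
    ultimately show ?thesis unfolding degree_q by (metis dvd_triv_left)
  qed
  then obtain u where u: "\<And>l. l \<in> S \<Longrightarrow> q l dvd u l * b l - 1" "\<And>l. l \<in> S \<Longrightarrow> u l = 0 \<or> degree (u l) < order l c"
    by metis
  define a where "a r = (if r \<in> S then u r else 0)" for r
  \<comment> \<open>Every q l divides \<open>D\<close>, so \<open>D\<close> would have at least
    degree c roots counted with multiplicity; its degree is smaller, hence it is 0.\<close>
  define D where "D = (\<Sum>r\<in>S. a r * b r) - 1"
  have dvd: "q l dvd D" if l: "l \<in> S" for l
  proof -
    have "D = (u l * b l - 1) + (\<Sum>r\<in>S - {l}. a r * b r)"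
      unfolding D_def using l by (simp add: sum.remove[OF finite_S] a_def)
    moreover have "q l dvd (\<Sum>r\<in>S - {l}. a r * b r)"
      by (intro dvd_sum dvd_mult q_dvd_b) (use l in auto)
    ultimately show ?thesis using u(1)[OF l] by simp
  qed
  have "degree (a r * b r) \<le> degree c - 1" if r: "r \<in> S" for r
  proof (cases "u r = 0")
    case False
    have "degree (a r * b r) \<le> degree (u r) + degree (b r)" using r by (simp add: a_def degree_mult_le)
    then show ?thesis using u(2)[OF r] degree_b[OF r] False by linarith
  qed (simp add: a_def)
  then have "degree D \<le> degree c - 1" unfolding D_def
    by (intro degree_diff_le degree_sum_le finite_S) auto
  then have degD: "degree D < degree c" using nonconstant by simp
  have "D = 0"
  proof (rule ccontr)
    assume D: "D \<noteq> 0"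
    have ord: "order l c \<le> order l D" if "l \<in> S" for l
      using dvd[OF that] D order_divides[of l "order l c" D] by (simp add: q_def)
    have "S \<subseteq> {x. poly D x = 0}" using ord order_pos D order_root[of D] by fastforce
    then have "(\<Sum>l\<in>S. order l D) \<le> (\<Sum>l | poly D l = 0. order l D)"
      using D by (intro sum_mono2 poly_roots_finite) auto
    also have "\<dots> \<le> degree D" by (rule sum_order_le_degree[OF D])
    also have "\<dots> < (\<Sum>l\<in>S. order l c)" using degD degree_decompose by simp
    also have "\<dots> \<le> (\<Sum>l\<in>S. order l D)" by (rule sum_mono) (rule ord)
    finally show False by simp
  qed
  moreover have "if poly c r = 0 then degree (a r) < order r c else a r = 0" for r
    using u(2)[of r] order_pos[of r] by (auto simp: a_def S_def)
  ultimately show ?thesis unfolding D_def by (intro exI[of _ a]) auto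
qed

text \<open>All summands except the l-th are divisible by q l, and b l is invertible modulo q l; so
  q l divides a l - a' l, whose degree is too small.\<close>

lemma numerators_unique:
  assumes "\<And>r. if poly c r = 0 then degree (a r) < order r c else a r = 0" "(\<Sum>r\<in>S. a r * b r) = 1"
    "\<And>r. if poly c r = 0 then degree (a' r) < order r c else a' r = 0" "(\<Sum>r\<in>S. a' r * b r) = 1"
  shows "a = a'"
proof
  fix l
  show "a l = a' l"
  proof (cases "l \<in> S")
    case False
    then show ?thesis using assms(1,3)[of l] by (simp add: S_def)
  next
    case l: True
    have "(\<Sum>r\<in>S. (a r - a' r) * b r) = 0" using assms(2,4) by (simp add: left_diff_distrib sum_subtractf)
    then have "(a l - a' l) * b l = - (\<Sum>r\<in>S - {l}. (a r - a' r) * b r)"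
      using l by (simp add: sum.remove[OF finite_S] eq_neg_iff_add_eq_0)
    moreover have "q l dvd (\<Sum>r\<in>S - {l}. (a r - a' r) * b r)"
      by (intro dvd_sum dvd_mult q_dvd_b) (use l in auto)
    ultimately have d: "q l dvd (a l - a' l) * b l" by simp
    obtain u v where uv: "u * b l + v * q l = 1"
      using bezout_linear_power[OF poly_b_nonzero, of l "order l c"] by (auto simp: q_def)
    have "a l - a' l = (a l - a' l) * (u * b l + v * q l)" using uv by simp
    also have "\<dots> = u * ((a l - a' l) * b l) + q l * ((a l - a' l) * v)" by (simp add: algebra_simps)
    finally have "q l dvd a l - a' l" using d by (metis dvd_add dvd_mult dvd_triv_left)
    moreover have "degree (a l - a' l) < degree (q l)"
      using degree_diff_less[of "a l" "order l c" "a' l"] assms(1,3)[of l] l by (simp add: S_def degree_q)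
    ultimately show ?thesis using dvd_imp_degree_le[of "q l" "a l - a' l"] by fastforce
  qed
qed

lemma pfd_numerators: "(\<Sum>r\<in>S. pfd_numerators c r * b r) = 1"
proof -
  let ?P = "\<lambda>a. (\<forall>r. if poly c r = 0 then degree (a r) < order r c else a r = 0) \<and> (\<Sum>r\<in>S. a r * b r) = 1"
  have "\<exists>!a. ?P a" using numerators_exist numerators_unique by (blast intro: ex_ex1I)
  then have "?P (THE a. ?P a)" by (rule theI')
  then show ?thesis unfolding pfd_numerators_def linear_combination_iff by blast
qed

end

locale spectral =
  fixes M :: "complex^'n^'n"

sublocale spectral \<subseteq> monic_complex_poly "charpoly M"
  by unfold_locales (rule charpoly_monic, simp add: charpoly_monic)

context spectral begin

definition f where "f l = pfd_numerators (charpoly M) l * b l"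

abbreviation P where "P l \<equiv> poly_mat (f l) M"

lemma spectral_proj: "spectral_proj M l = P l"
  by (simp add: spectral_proj_def Let_def f_def b_def q_def S_def poly_mat_mult)

lemma sum_P: "(\<Sum>l\<in>S. P l) = mat 1"
  using pfd_numerators by (simp add: poly_mat_sum[symmetric] f_def)

lemma sum_P_vector: "(\<Sum>l\<in>S. P l *v v) = v"
  by (simp add: matrix_sum_vector[symmetric] sum_P)

text \<open>The product of q l and f l is a multiple of the characteristic polynomial.\<close>

lemma P_nilpotent:
  assumes "l \<in> S" shows "poly_mat ([:- l, 1:] ^ order l (charpoly M)) M *v (P l *v v) = 0"
proof -
  have "[:- l, 1:] ^ order l (charpoly M) * f l = pfd_numerators (charpoly M) l * charpoly M"
    using decompose_at[OF assms] by (simp add: f_def q_def ac_simps)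
  then show ?thesis
    by (simp add: matrix_vector_mul_assoc poly_mat_mult[symmetric]) (simp add: poly_mat_mult cayley_hamilton)
qed

lemma P_commute: "B ** M = M ** B \<Longrightarrow> B *v (P l *v v) = P l *v (B *v v)"
  using poly_mat_commute[of B M "f l"] by (simp add: matrix_vector_mul_assoc)

text \<open>For r \<noteq> l the polynomial f r contains the factor q l and vanishes at l. That P l
  fixes w then follows from the projections summing to the identity.\<close>

lemma P_eigenvector:
  assumes "M *v w = l *s w" "l \<in> S" "r \<in> S" shows "P r *v w = (if r = l then w else 0)"
proof -
  have 0: "P r *v w = 0" if "r \<in> S" "r \<noteq> l" for r
  proof -
    have "q l dvd f r" unfolding f_def using q_dvd_b[OF assms(2)] that by auto
    then have "poly (f r) l = 0" using order_pos[OF assms(2)] by (auto simp: dvd_def q_def)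
    then show ?thesis using poly_mat_eigenvector[OF assms(1), of "f r"] by simp
  qed
  have "w = P l *v w + (\<Sum>r\<in>S - {l}. P r *v w)"
    using sum_P_vector[of w] assms(2) by (simp add: sum.remove[OF finite_S])
  also have "(\<Sum>r\<in>S - {l}. P r *v w) = 0" by (rule sum.neutral) (use 0 in auto)
  finally show ?thesis using 0 assms(3) by auto
qed

text \<open>A chain forces l to be at least a double root, so both f r and its derivative vanish at
  l for r \<noteq> l.\<close>

lemma P_chain:
  assumes "M *v w = l *s w" "w \<noteq> 0" "M *v v = l *s v + w" "r \<in> S"
  shows "P r *v v = (if r = l then v else 0)"
proof -
  have l: "l \<in> S" using eigenvector_charpoly_root[OF assms(1,2)] by (simp add: S_def)
  have 0: "P r *v v = 0" if "r \<in> S" "r \<noteq> l" for r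
  proof -
    have "[:- l, 1:] ^ 2 dvd q l" unfolding q_def by (rule le_imp_power_dvd[OF chain_charpoly_order[OF assms(1-3)]])
    also have "q l dvd f r" unfolding f_def using q_dvd_b[OF l] that by auto
    finally obtain g where g: "f r = [:- l, 1:] ^ 2 * g" by (auto simp: dvd_def)
    have "poly (f r) l = 0" "poly (pderiv (f r)) l = 0"
      unfolding g pderiv_mult pderiv_power by (simp_all add: power2_eq_square)
    then show ?thesis using poly_mat_chain[OF assms(1,3), of "f r"] by simp
  qed
  have "v = P l *v v + (\<Sum>r\<in>S - {l}. P r *v v)"
    using sum_P_vector[of v] l by (simp add: sum.remove[OF finite_S])
  also have "(\<Sum>r\<in>S - {l}. P r *v v) = 0" by (rule sum.neutral) (use 0 in auto)
  finally show ?thesis using 0 assms(4) by auto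
qed

text \<open>Apply M - l repeatedly: the last nonzero vector is an eigenvector, and the one before
  it, if any, forms a chain with it. The exponent k is exposed because w must remain a polynomial in
  M applied to u when commuting matrices come in.\<close>

lemma generalized_eigenvector_reach:
  assumes "poly_mat ([:- l, 1:] ^ m) M *v u = 0" "u \<noteq> 0"
  shows "\<exists>k w. w = poly_mat ([:- l, 1:] ^ k) M *v u \<and> w \<noteq> 0 \<and> M *v w = l *s w \<and>
    ((M - mat l) *v u \<noteq> 0 \<longrightarrow> (\<exists>v. M *v v = l *s v + w))"
proof -
  define x where "x k = poly_mat ([:- l, 1:] ^ k) M *v u" for k
  have x0: "x 0 = u" by (simp add: x_def)
  have xS: "x (Suc k) = (M - mat l) *v x k" for k
    unfolding x_def power_Suc poly_mat_mult poly_mat_linear matrix_vector_mul_assoc ..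
  define j where "j = (LEAST k. x k = 0)"
  have j: "x j = 0" unfolding j_def by (rule LeastI[of _ m]) (use assms in \<open>simp add: x_def\<close>)
  have jmin: "x k \<noteq> 0" if "k < j" for k using that not_less_Least unfolding j_def by blast
  obtain i where i: "j = Suc i" using j assms(2) x0 by (cases j) auto
  show ?thesis
  proof (rule exI[of _ i], rule exI[of _ "x i"], intro conjI impI)
    show "x i = poly_mat ([:- l, 1:] ^ i) M *v u" by (simp add: x_def)
    show "x i \<noteq> 0" using jmin[of i] i by simp
    have "(M - mat l) *v x i = 0" using j i xS by simp
    then show "M *v x i = l *s x i" by (simp add: matrix_vector_mult_diff_rdistrib mat_vector)
    assume nz: "(M - mat l) *v u \<noteq> 0"
    have "i \<noteq> 0"
    proof
      assume "i = 0"
      then have "x (Suc 0) = 0" using j i by simp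
      with xS[of 0] x0 nz show False by simp
    qed
    then obtain i' where "i = Suc i'" by (cases i) auto
    then have "(M - mat l) *v x i' = x i" using xS by simp
    then have "M *v x i' = l *s x i' + x i"
      by (simp add: matrix_vector_mult_diff_rdistrib mat_vector diff_eq_eq add.commute)
    then show "\<exists>v. M *v v = l *s v + x i" by blast
  qed
qed

lemma P_semisimple:
  assumes "\<And>l w v. \<lbrakk>M *v w = l *s w; M *v v = l *s v + w\<rbrakk> \<Longrightarrow> w = 0" "l \<in> S"
  shows "M *v (P l *v v) = l *s (P l *v v)"
proof (rule ccontr)
  let ?u = "P l *v v"
  assume *: "M *v ?u \<noteq> l *s ?u"
  then have "?u \<noteq> 0" by auto
  from generalized_eigenvector_reach[OF P_nilpotent[OF assms(2)] this]
  obtain k w where w: "w \<noteq> 0" "M *v w = l *s w" and ex: "(M - mat l) *v ?u \<noteq> 0 \<longrightarrow> (\<exists>v. M *v v = l *s v + w)"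
    by (elim exE conjE)
  have "(M - mat l) *v ?u \<noteq> 0" using * by (simp add: matrix_vector_mult_diff_rdistrib mat_vector)
  with ex obtain v' where "M *v v' = l *s v' + w" by (elim impE exE)
  from assms(1)[OF w(2) this] w(1) show False by simp
qed

text \<open>Some component P l u is nonzero; it and all its images under polynomials in M satisfy
  the eigenvalue equation of R, including the eigenvector of M reached from it.\<close>

lemma commuting_eigenvector:
  assumes "R ** M = M ** R" "R *v u = a *s u" "u \<noteq> 0"
  obtains l w where "w \<noteq> 0" "M *v w = l *s w" "R *v w = a *s w"
proof -
  have "\<exists>l\<in>S. P l *v u \<noteq> 0"
  proof (rule ccontr)
    assume "\<not> ?thesis"
    then have "(\<Sum>l\<in>S. P l *v u) = 0" by (intro sum.neutral) auto
    with sum_P_vector[of u] assms(3) show False by simp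
  qed
  then obtain l where l: "l \<in> S" "P l *v u \<noteq> 0" by (elim bexE)
  obtain k w where w: "w = poly_mat ([:- l, 1:] ^ k) M *v (P l *v u)" "w \<noteq> 0" "M *v w = l *s w"
    using generalized_eigenvector_reach[OF P_nilpotent[OF l(1)] l(2)] by (elim exE conjE)
  have "R *v w = poly_mat ([:- l, 1:] ^ k) M *v (P l *v (R *v u))"
    unfolding w(1) using poly_mat_commute[OF assms(1)] by (metis matrix_vector_mul_assoc)
  also have "\<dots> = a *s w" by (simp add: assms(2) w(1) vector_scalar_commute)
  finally show ?thesis by (rule that[OF w(2,3)])
qed

end

section \<open>Real powers and the Floquet matrix\<close>

text \<open>Treats both kinds of points of T at once: a derivative at 0 when the graininess m
  vanishes, mere continuity at m / p when it does not.\<close>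

lemma holomorphic_difference_quotient_limit:
  assumes F: "F holomorphic_on UNIV" and p: "0 < p" and m: "0 \<le> (m::real)" and d: "m = 0 \<Longrightarrow> F 0 = d"
  shows "((\<lambda>s. (F (of_real (s / p)) - d) / of_real s) \<longlongrightarrow>
     (if m = 0 then deriv F 0 / of_real p else (F (of_real (m / p)) - d) / of_real m)) (at_right m)"
proof (cases "m = 0")
  case True
  have "(F has_field_derivative deriv F 0) (at 0)"
    using F by (simp add: holomorphic_derivI)
  then have "((\<lambda>h. (F h - F 0) / h) \<longlongrightarrow> deriv F 0) (at 0)"
    by (simp add: has_field_derivative_iff)
  moreover have "filterlim (\<lambda>s. of_real (s / p) :: complex) (at 0) (at_right 0)"
    unfolding filterlim_at
  proof
    have "((\<lambda>s. of_real (s / p) :: complex) \<longlongrightarrow> of_real (0 / p)) (at_right 0)"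
      using p by (intro tendsto_intros) auto
    then show "((\<lambda>s. of_real (s / p) :: complex) \<longlongrightarrow> 0) (at_right 0)" by simp
    show "\<forall>\<^sub>F s in at_right 0. of_real (s / p) \<in> UNIV \<and> of_real (s / p) \<noteq> (0::complex)"
      using p by (auto simp: eventually_at_right_field intro!: exI[of _ 1])
  qed
  ultimately have "((\<lambda>s. (F (of_real (s / p)) - F 0) / of_real (s / p)) \<longlongrightarrow> deriv F 0) (at_right 0)"
    by (rule filterlim_compose)
  then have "((\<lambda>s. (F (of_real (s / p)) - F 0) / of_real (s / p) / of_real p) \<longlongrightarrow> deriv F 0 / of_real p) (at_right 0)"
    using p by (intro tendsto_intros) auto
  then show ?thesis using True d p by simp
next
  case False
  have "isCont F (of_real (m / p))"
    using holomorphic_on_imp_continuous_on[OF F] by (simp add: continuous_on_eq_continuous_at)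
  moreover have "((\<lambda>s. of_real (s / p) :: complex) \<longlongrightarrow> of_real (m / p)) (at_right m)"
    using p by (intro tendsto_intros) auto
  ultimately have "((\<lambda>s. F (of_real (s / p))) \<longlongrightarrow> F (of_real (m / p))) (at_right m)"
    by (rule isCont_tendsto_compose)
  then have "((\<lambda>s. (F (of_real (s / p)) - d) / of_real s) \<longlongrightarrow> (F (of_real (m / p)) - d) / of_real m) (at_right m)"
    using False by (intro tendsto_intros) auto
  then show ?thesis using False by simp
qed

definition floquet_exponent :: "real \<Rightarrow> real \<Rightarrow> complex \<Rightarrow> complex" where
  "floquet_exponent p m l = (if m = 0 then Ln l / of_real p else (l powr of_real (m / p) - 1) / of_real m)"

lemma floquet_exponent_limit:
  assumes "l \<noteq> 0" "0 < p" "0 \<le> m"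
  shows "((\<lambda>s. (l powr of_real (s / p) - 1) / of_real s) \<longlongrightarrow> floquet_exponent p m l) (at_right m)"
proof -
  have "((\<lambda>z. exp (z * Ln l)) has_field_derivative Ln l) (at 0)"
    by (auto intro!: derivative_eq_intros)
  then have "deriv (\<lambda>z. exp (z * Ln l)) 0 = Ln l" by (rule DERIV_imp_deriv)
  then show ?thesis
    using holomorphic_difference_quotient_limit[of "\<lambda>z. exp (z * Ln l)" p m 1] assms
    by (simp add: powr_def floquet_exponent_def holomorphic_intros cong: if_cong)
qed

lemma norm_powr_of_real: "l \<noteq> 0 \<Longrightarrow> cmod (l powr of_real x) = cmod l powr x"
  by (simp add: powr_def)

text \<open>Real powers satisfy cmod (l powr x) = cmod l powr x, so the sign is that of a difference
  quotient of a real power, or of a real logarithm. The three matching cases exclude each other,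
  which turns the implications into equivalences.\<close>

lemma hilger_Re_floquet_exponent:
  assumes "l \<noteq> 0" "0 < p" "0 \<le> mu T t"
  shows "hilger_Re T t (floquet_exponent p (mu T t) l) < 0 \<longleftrightarrow> cmod l < 1"
    and "hilger_Re T t (floquet_exponent p (mu T t) l) = 0 \<longleftrightarrow> cmod l = 1"
    and "hilger_Re T t (floquet_exponent p (mu T t) l) > 0 \<longleftrightarrow> cmod l > 1"
proof -
  let ?m = "mu T t"
  define h where "h = hilger_Re T t (floquet_exponent p ?m l)"
  have l: "0 < cmod l" using assms by simp
  have "h < 0 \<and> cmod l < 1 \<or> h = 0 \<and> cmod l = 1 \<or> h > 0 \<and> cmod l > 1"
  proof (cases "?m = 0")
    case True
    then have "h = ln (cmod l) / p" using assms by (simp add: h_def hilger_Re_def floquet_exponent_def)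
    then show ?thesis using l assms(2)
      by (cases "cmod l" "1::real" rule: linorder_cases) (auto simp: divide_neg_pos)
  next
    case False
    then have m: "0 < ?m" using assms by simp
    then have "1 + of_real ?m * floquet_exponent p ?m l = l powr of_real (?m / p)"
      by (simp add: floquet_exponent_def)
    then have h: "h = (cmod l powr (?m / p) - 1) / ?m"
      using m norm_powr_of_real[OF assms(1), of "?m / p"] by (simp add: h_def hilger_Re_def del: of_real_divide)
    have mp: "0 < ?m / p" using m assms by simp
    show ?thesis
    proof (cases "cmod l" "1::real" rule: linorder_cases)
      case less
      then have "cmod l powr (?m / p) < 1 powr (?m / p)" using l mp by (intro powr_less_mono2) auto
      then show ?thesis using less m by (simp add: h divide_neg_pos)
    next
      case equal then show ?thesis by (simp add: h)
    next
      case greater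
      then have "1 powr (?m / p) < cmod l powr (?m / p)" using l mp by (intro powr_less_mono2) auto
      then show ?thesis using greater m by (simp add: h)
    qed
  qed
  then show "hilger_Re T t (floquet_exponent p (mu T t) l) < 0 \<longleftrightarrow> cmod l < 1"
    and "hilger_Re T t (floquet_exponent p (mu T t) l) = 0 \<longleftrightarrow> cmod l = 1"
    and "hilger_Re T t (floquet_exponent p (mu T t) l) > 0 \<longleftrightarrow> cmod l > 1"
    unfolding h_def by auto
qed

lemma tendsto_matrix_mult_right:
  fixes B :: "complex^'n^'n"
  assumes "(Q \<longlongrightarrow> R) F" shows "((\<lambda>s. Q s ** B) \<longlongrightarrow> R ** B) F"
  unfolding matrix_matrix_mult_def
  by (rule vec_tendstoI, rule vec_tendstoI, unfold vec_lambda_beta)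
    (intro tendsto_sum tendsto_mult tendsto_const tendsto_vec_nth assms)

lemma tendsto_matrix_mult_left:
  fixes B :: "complex^'n^'n"
  assumes "(Q \<longlongrightarrow> R) F" shows "((\<lambda>s. B ** Q s) \<longlongrightarrow> B ** R) F"
  unfolding matrix_matrix_mult_def
  by (rule vec_tendstoI, rule vec_tendstoI, unfold vec_lambda_beta)
    (intro tendsto_sum tendsto_mult tendsto_const tendsto_vec_nth assms)

lemma tendsto_matrix_vector:
  fixes v :: "complex^'n"
  assumes "(Q \<longlongrightarrow> R) F" shows "((\<lambda>s. Q s *v v) \<longlongrightarrow> R *v v) F"
  unfolding matrix_vector_mult_def
  by (rule vec_tendstoI, unfold vec_lambda_beta)
    (intro tendsto_sum tendsto_mult tendsto_const tendsto_vec_nth assms)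

lemma commute_mult:
  assumes "B ** Y = Y ** B" "B ** Z = Z ** (B :: complex^'n^'n)"
  shows "B ** (Y ** Z) = (Y ** Z) ** B"
proof -
  have "B ** (Y ** Z) = (Y ** B) ** Z" by (simp only: matrix_mul_assoc assms(1))
  also have "\<dots> = Y ** (Z ** B)" by (simp only: matrix_mul_assoc[symmetric] assms(2))
  finally show ?thesis by (simp only: matrix_mul_assoc)
qed

lemma mat_mult_shift: "(A :: complex^'n^'n) ** (mat a ** B) = mat a ** (A ** B)"
  by (simp only: matrix_mul_assoc mat_commute[of a A])

section \<open>Real powers on eigenvectors and chains, and convergence of the quotient defining
  R\<close>

context spectral begin

abbreviation c where "c \<equiv> charpoly M"

definition N where "N l = mat (1 / l) ** (M - mat l)"

definition X where "X l r = mat (l powr of_real r) **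
    (\<Sum>j<order l c. mat (of_real (r gchoose j)) ** matpow (N l) j)"

lemma real_matpow_eq: "real_matpow M r = (\<Sum>l\<in>S. P l ** X l r)"
  by (simp add: real_matpow_def Let_def S_def spectral_proj X_def N_def)

lemma N_commute: "B ** M = M ** B \<Longrightarrow> B ** N l = N l ** B"
  unfolding N_def
  by (intro commute_mult mat_commute[symmetric]) (simp add: matrix_diff_mult matrix_mult_diff mat_commute)

lemma X_commute: assumes "B ** M = M ** B" shows "B ** X l r = X l r ** B"
proof -
  have "B ** (mat a ** matpow (N l) j) = (mat a ** matpow (N l) j) ** B" for a j
    by (intro commute_mult mat_commute[symmetric] matpow_commute N_commute assms)
  then have "B ** (\<Sum>j<order l c. mat (of_real (r gchoose j)) ** matpow (N l) j) =
     (\<Sum>j<order l c. mat (of_real (r gchoose j)) ** matpow (N l) j) ** B"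
    by (simp add: matrix_sum_mult matrix_mult_sum)
  then show ?thesis unfolding X_def by (intro commute_mult mat_commute[symmetric])
qed

lemma X_P_commute: "P k ** X l r = X l r ** P k"
  by (rule X_commute) (rule poly_mat_commute[OF refl, symmetric])

lemma real_matpow_commute:
  assumes "B ** M = M ** B" shows "B ** real_matpow M r = real_matpow M r ** B"
  unfolding real_matpow_eq matrix_sum_mult matrix_mult_sum
  by (intro sum.cong refl commute_mult X_commute poly_mat_commute assms)

lemma real_matpow_vector: "real_matpow M r *v v = (\<Sum>l\<in>S. X l r *v (P l *v v))"
  unfolding real_matpow_eq matrix_sum_vector
  by (intro sum.cong refl) (simp add: X_P_commute matrix_vector_mul_assoc)

lemma N_vector: "N l *v v = (1 / l) *s (M *v v - l *s v)"
  by (simp add: N_def matrix_vector_mul_assoc[symmetric] mat_vector matrix_vector_mult_diff_rdistrib)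

lemma X_vector: "X l r *v v = (l powr of_real r) *s (\<Sum>j<order l c. of_real (r gchoose j) *s (matpow (N l) j *v v))"
  by (simp add: X_def matrix_vector_mul_assoc[symmetric] mat_vector matrix_sum_vector)

lemma matpow_N_eigenvector:
  assumes "M *v w = l *s w" shows "matpow (N l) j *v w = (if j = 0 then w else 0)"
proof (cases j)
  case (Suc i)
  have "N l *v w = 0" by (simp add: N_vector assms)
  then show ?thesis unfolding Suc matpow_vector by (simp del: funpow.simps add: funpow_Suc_right funpow_swap1[symmetric])
      (simp add: matpow_vector[symmetric])
qed simp

lemma real_matpow_eigenvector:
  assumes "M *v w = l *s w" "w \<noteq> 0"
  shows "real_matpow M r *v w = (l powr of_real r) *s w"
proof -
  have l: "l \<in> S" using eigenvector_charpoly_root[OF assms] by (simp add: S_def)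
  have "real_matpow M r *v w = (\<Sum>k\<in>S. if k = l then X l r *v w else 0)"
    unfolding real_matpow_vector using P_eigenvector[OF assms(1) l] by (intro sum.cong refl) auto
  also have "\<dots> = X l r *v w" using l finite_S by simp
  also have "(\<Sum>j<order l c. of_real (r gchoose j) *s (matpow (N l) j *v w)) =
      (\<Sum>j<order l c. if j = 0 then w else 0)"
    by (intro sum.cong refl) (simp add: matpow_N_eigenvector[OF assms(1)])
  then have "X l r *v w = (l powr of_real r) *s w"
    using order_pos[OF l] by (simp add: X_vector)
  finally show ?thesis .
qed

lemma real_matpow_chain:
  assumes "M *v w = l *s w" "w \<noteq> 0" "M *v v = l *s v + w"
  shows "real_matpow M r *v v = (l powr of_real r) *s (v + (of_real r / l) *s w)"
proof -
  have l: "l \<in> S" using eigenvector_charpoly_root[OF assms(1,2)] by (simp add: S_def)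
  have "real_matpow M r *v v = (\<Sum>k\<in>S. if k = l then X l r *v v else 0)"
    unfolding real_matpow_vector using P_chain[OF assms] by (intro sum.cong refl) auto
  also have "\<dots> = X l r *v v" using l finite_S by simp
  also have "X l r *v v = (l powr of_real r) *s (v + (of_real r / l) *s w)"
  proof -
    have Nv: "N l *v v = (1 / l) *s w" by (simp add: N_vector assms(3))
    have pow: "matpow (N l) (Suc j) *v v = (1 / l) *s (matpow (N l) j *v w)" for j
    proof -
      have "matpow (N l) (Suc j) *v v = matpow (N l) j *v (N l *v v)"
        unfolding matpow_vector by (simp add: funpow_swap1)
      then show ?thesis by (simp add: Nv vector_scalar_commute)
    qed
    \<comment> \<open>The truncated binomial series must contain the terms j = 0 and j = 1; all
      later ones vanish since N annihilates w.\<close>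
    obtain m where m: "order l c = Suc (Suc m)"
      using chain_charpoly_order[OF assms] by (metis add_2_eq_Suc le_Suc_ex)
    have "(\<Sum>j<order l c. of_real (r gchoose j) *s (matpow (N l) j *v v)) =
      v + (\<Sum>j<Suc m. of_real (r gchoose Suc j) *s (matpow (N l) (Suc j) *v v))"
      unfolding m by (subst sum.lessThan_Suc_shift) simp
    also have "(\<Sum>j<Suc m. of_real (r gchoose Suc j) *s (matpow (N l) (Suc j) *v v)) =
       (\<Sum>j<Suc m. if j = 0 then (of_real r / l) *s w else 0)"
      by (intro sum.cong refl)
        (simp only: pow matpow_N_eigenvector[OF assms(1)], simp)
    also have "\<dots> = (of_real r / l) *s w" by simp
    finally show ?thesis by (simp add: X_vector)
  qed
  finally show ?thesis .
qed

text \<open>An eigenvalue 0 must be excluded because \<open>0 powr 0\<close> is 0.\<close>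

lemma real_matpow_0: "0 \<notin> S \<Longrightarrow> real_matpow M 0 = mat 1"
proof -
  assume 0: "0 \<notin> S"
  have "X l 0 = mat 1" if l: "l \<in> S" for l
  proof -
    have "(\<Sum>j<order l c. mat (of_real (0 gchoose j)) ** matpow (N l) j) = (\<Sum>j<order l c. if j = 0 then mat 1 else 0)"
    proof (intro sum.cong refl)
      fix j
      show "mat (of_real (0 gchoose j)) ** matpow (N l) j = (if j = 0 then mat 1 else 0)"
        by (cases j) (simp_all add: vec_eq_iff mat_mult_component gbinomial_0)
    qed
    then show ?thesis using 0 l order_pos[OF l] by (auto simp: X_def)
  qed
  then show ?thesis by (simp add: real_matpow_eq sum_P)
qed

definition floquet_quotient where "floquet_quotient p s = (1 / s) *\<^sub>R (real_matpow M (s / p) - mat 1)"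

lemma floquet_quotient_converges:
  assumes 0: "0 \<notin> S" and p: "0 < p" and m: "0 \<le> m"
  shows "\<exists>R. (floquet_quotient p \<longlongrightarrow> R) (at_right m)"
proof -
  \<comment> \<open>The entries of the real power, extended to complex exponents: exponentials times
    polynomials in z, hence entire.\<close>
  define F where "F i k z = (\<Sum>l\<in>S. \<Sum>j<order l c. exp (z * Ln l) *
    ((\<Prod>a = 0..<j. z - of_nat a) / fact j) * (P l ** matpow (N l) j) $ i $ k)" for i k z
  have F: "real_matpow M r $ i $ k = F i k (of_real r)" for r i k
  proof -
    have "P l ** X l r = (\<Sum>j<order l c. mat (exp (of_real r * Ln l) *
      ((\<Prod>a = 0..<j. of_real r - of_nat a) / fact j)) ** (P l ** matpow (N l) j))" if l: "l \<in> S" for l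
    proof -
      have "l \<noteq> 0" using l 0 by auto
      have g: "of_real (r gchoose j) = (\<Prod>a = 0..<j. of_real r - of_nat a :: complex) / fact j" for j
        by (simp add: gbinomial_prod_rev)
      have "P l ** X l r = mat (l powr of_real r) ** (\<Sum>j<order l c. P l ** (mat (of_real (r gchoose j)) ** matpow (N l) j))"
        by (simp only: X_def mat_mult_shift[of "P l"] matrix_mult_sum)
      also have "\<dots> = (\<Sum>j<order l c. mat (l powr of_real r * of_real (r gchoose j)) ** (P l ** matpow (N l) j))"
        unfolding matrix_mult_sum
        by (intro sum.cong refl) (simp only: mat_mult_shift[of "P l"] mat_mult matrix_mul_assoc[symmetric])
      finally show ?thesis using \<open>l \<noteq> 0\<close> by (simp add: g powr_def)
    qed
    then show ?thesis by (simp add: real_matpow_eq F_def mat_mult_component)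
  qed
  have hol: "F i k holomorphic_on UNIV" for i k
    unfolding F_def by (intro holomorphic_intros) auto
  have F0: "F i k 0 = mat 1 $ i $ k" for i k
    using F[of 0 i k] real_matpow_0[OF 0] by simp
  define R where "R = (\<chi> i k. if m = 0 then deriv (F i k) 0 / of_real p
    else (F i k (of_real (m / p)) - mat 1 $ i $ k) / of_real m)"
  have "(floquet_quotient p \<longlongrightarrow> R) (at_right m)"
  proof (intro vec_tendstoI)
    fix i k
    have "floquet_quotient p s $ i $ k = (F i k (of_real (s / p)) - mat 1 $ i $ k) / of_real s" for s
      by (simp add: floquet_quotient_def F scaleR_conv_of_real[where 'a = complex])
    then show "((\<lambda>s. floquet_quotient p s $ i $ k) \<longlongrightarrow> R $ i $ k) (at_right m)"
      unfolding R_def using holomorphic_difference_quotient_limit[of "F i k" p m "mat 1 $ i $ k"] hol p m F0 by simp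
  qed
  then show ?thesis ..
qed

section \<open>Transfer of eigenvectors and chains to the limit R, and back\<close>

context
  fixes p m :: real and R
  assumes S0: "0 \<notin> S" and p: "0 < p" and m: "0 \<le> m" and R: "(floquet_quotient p \<longlongrightarrow> R) (at_right m)"
begin

lemma R_commute: assumes "B ** M = M ** B" shows "B ** R = R ** B"
proof -
  have "B ** floquet_quotient p s = floquet_quotient p s ** B" for s
  proof -
    have "B ** (a *\<^sub>R Y) = a *\<^sub>R (B ** Y)" "(a *\<^sub>R Y) ** B = a *\<^sub>R (Y ** B)" for a and Y :: "complex^'n^'n"
      by (simp_all add: vec_eq_iff matrix_matrix_mult_def scaleR_sum_right)
    then show ?thesis
      unfolding floquet_quotient_def using real_matpow_commute[OF assms] by (simp add: matrix_diff_mult matrix_mult_diff)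
  qed
  then have "((\<lambda>s. B ** floquet_quotient p s) \<longlongrightarrow> R ** B) (at_right m)" using tendsto_matrix_mult_right[OF R, of B] by simp
  with tendsto_matrix_mult_left[OF R, of B] show ?thesis by (intro tendsto_unique[of "at_right m"]) auto
qed

lemma eventually_pos: "\<forall>\<^sub>F s in at_right m. 0 < s"
  using m by (auto simp: eventually_at_right_field intro!: exI[of _ "m + 1"])

lemma floquet_quotient_vector: "floquet_quotient p s *v v = (1 / of_real s) *s (real_matpow M (s / p) *v v - v)"
proof -
  have "(a *\<^sub>R Y) *v v = of_real a *s (Y *v v)" for a and Y :: "complex^'n^'n"
    by (simp add: vec_eq_iff matrix_vector_mult_def scaleR_conv_of_real[where 'a = complex]
        sum_distrib_left mult.assoc)
  then show ?thesis by (simp add: floquet_quotient_def matrix_vector_mult_diff_rdistrib)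
qed

lemma R_eigenvector:
  assumes "M *v w = l *s w" shows "R *v w = floquet_exponent p m l *s w"
proof (cases "w = 0")
  case False
  have "l \<noteq> 0" using eigenvector_charpoly_root[OF assms False] S0 by (auto simp: S_def)
  have "floquet_quotient p s *v w = ((l powr of_real (s / p) - 1) / of_real s) *s w" for s
    by (simp add: floquet_quotient_vector real_matpow_eigenvector[OF assms False] vec_eq_iff algebra_simps
        diff_divide_distrib)
  moreover have "((\<lambda>s. ((l powr of_real (s / p) - 1) / of_real s) *s w) \<longlongrightarrow> floquet_exponent p m l *s w) (at_right m)"
    by (intro vec_tendstoI; simp only: vector_smult_component)
      (intro tendsto_intros floquet_exponent_limit \<open>l \<noteq> 0\<close> p m)
  ultimately show ?thesis using tendsto_matrix_vector[OF R, of w]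
    by (intro tendsto_unique[of "at_right m"]) auto
qed simp

text \<open>In the quotient the coefficient of w is l^(s/p) (s/p) / (l s). The s cancels, so its
  limit is finite and nonzero even when m = 0.\<close>

lemma R_chain:
  assumes "M *v w = l *s w" "w \<noteq> 0" "M *v v = l *s v + w"
  shows "\<exists>a\<noteq>0. R *v v = floquet_exponent p m l *s v + a *s w"
proof -
  have "l \<noteq> 0" using eigenvector_charpoly_root[OF assms(1,2)] S0 by (auto simp: S_def)
  define a where "a = l powr of_real (m / p) / (of_real p * l)"
  have "a \<noteq> 0" using \<open>l \<noteq> 0\<close> p by (simp add: a_def)
  have eq: "\<forall>\<^sub>F s in at_right m. ((l powr of_real (s / p) - 1) / of_real s) *s v + (l powr of_real (s / p) / (of_real p * l)) *s w = floquet_quotient p s *v v"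
    using eventually_pos
  proof eventually_elim
    case (elim s)
    then show ?case using \<open>l \<noteq> 0\<close> p
      by (simp add: floquet_quotient_vector real_matpow_chain[OF assms] vec_eq_iff field_simps)
  qed
  have pw: "((\<lambda>s. l powr of_real (s / p)) \<longlongrightarrow> l powr of_real (m / p)) (at_right m)"
    using \<open>l \<noteq> 0\<close> p by (simp add: powr_def) (intro tendsto_intros, auto)
  have "((\<lambda>s. ((l powr of_real (s / p) - 1) / of_real s) *s v + (l powr of_real (s / p) / (of_real p * l)) *s w)
      \<longlongrightarrow> floquet_exponent p m l *s v + a *s w) (at_right m)"
    unfolding a_def
    by (intro vec_tendstoI; simp only: vector_smult_component vector_add_component)
      (intro tendsto_intros floquet_exponent_limit \<open>l \<noteq> 0\<close> p m pw, use \<open>l \<noteq> 0\<close> p in auto)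
  then have "((\<lambda>s. floquet_quotient p s *v v) \<longlongrightarrow> floquet_exponent p m l *s v + a *s w) (at_right m)"
    by (rule Lim_transform_eventually) (rule eq)
  then have "R *v v = floquet_exponent p m l *s v + a *s w"
    using tendsto_matrix_vector[OF R, of v] by (intro tendsto_unique[of "at_right m"]) auto
  with \<open>a \<noteq> 0\<close> show ?thesis by blast
qed

lemma R_eigenvalue:
  assumes "R *v u = g *s u" "u \<noteq> 0"
  obtains l w where "w \<noteq> 0" "M *v w = l *s w" "g = floquet_exponent p m l"
proof -
  obtain l w where w: "w \<noteq> 0" "M *v w = l *s w" "R *v w = g *s w"
    by (rule commuting_eigenvector[OF R_commute[OF refl, symmetric] assms])
  have "(g - floquet_exponent p m l) *s w = 0"
    using R_eigenvector[OF w(2)] w(3) by (simp add: vector_sub_rdistrib)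
  then have "g = floquet_exponent p m l" using w(1) by (auto simp: vec_eq_iff)
  with w that show ?thesis by blast
qed

text \<open>Without chains M is scalar on the range of each P l, hence so is R. Projecting the chain
  of R to that range gives two equations for the scalar difference d: d P_l v = P_l w and d P_l w =
  0; either way P_l w = 0.\<close>

lemma R_chain_imp_chain:
  assumes no_chain: "\<And>l w v. \<lbrakk>M *v w = l *s w; M *v v = l *s v + w\<rbrakk> \<Longrightarrow> w = 0"
    and "R *v w = g *s w" "R *v v = g *s v + w"
  shows "w = 0"
proof -
  have "P l *v w = 0" if l: "l \<in> S" for l
  proof -
    have R1: "R *v (P l *v x) = P l *v (R *v x)" for x
      by (rule P_commute) (rule R_commute[OF refl, symmetric])
    have R2: "R *v (P l *v x) = floquet_exponent p m l *s (P l *v x)" for x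
      by (rule R_eigenvector) (rule P_semisimple[OF no_chain l])
    let ?d = "floquet_exponent p m l - g"
    have v: "?d *s (P l *v v) = P l *v w"
      using R1[of v] R2[of v] assms(3)
      by (simp add: matrix_vector_right_distrib vector_scalar_commute vector_sub_rdistrib)
    have w: "?d *s (P l *v w) = 0"
      using R1[of w] R2[of w] assms(2)
      by (simp add: vector_scalar_commute vector_sub_rdistrib)
    show ?thesis
    proof (cases "?d = 0")
      case True then show ?thesis using v by simp
    next
      case False then show ?thesis using w by (auto simp: vec_eq_iff)
    qed
  qed
  then show ?thesis using sum_P_vector[of w] by simp
qed

end

end

section \<open>Growth of matrix powers\<close>

lemma matrix_vector_norm_bound:
  fixes X :: "complex^'n^'n"
  shows "\<exists>B\<ge>0. \<forall>v. norm (X *v v) \<le> B * norm v"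
proof -
  have "linear ((*v) X)" by (rule matrix_vector_mul_linear)
  then have "bounded_linear ((*v) X)" by (simp add: linear_conv_bounded_linear)
  then obtain B where "0 < B" "\<And>v. norm (X *v v) \<le> norm v * B" using bounded_linear.pos_bounded by blast
  then show ?thesis by (intro exI[of _ B]) (auto simp: mult.commute)
qed

lemma norm_vector_scale: "norm (a *s v) = cmod a * norm (v :: complex^'n)"
  by (simp add: norm_vec_def norm_mult L2_set_right_distrib)

context spectral begin

lemma power_vector: "((*v) M ^^ j) v = poly_mat ([:0, 1:] ^ j) M *v v"
proof -
  have "poly_mat [:0, 1:] M = M" using poly_mat_linear[of 0 M] by (simp add: vec_eq_iff mat_def)
  then show ?thesis by (simp add: poly_mat_power matpow_vector)
qed

lemma power_generalized_eigenvector: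
  assumes "poly_mat ([:- l, 1:] ^ m) M *v u = 0"
  shows "((*v) M ^^ j) u = (\<Sum>i<m. (of_nat (j choose i) * l ^ (j - i)) *s (poly_mat ([:- l, 1:] ^ i) M *v u))"
proof -
  let ?g = "\<lambda>i. (of_nat (j choose i) * l ^ (j - i)) *s (poly_mat ([:- l, 1:] ^ i) M *v u)"
  have nil: "poly_mat ([:- l, 1:] ^ i) M *v u = 0" if "m \<le> i" for i
  proof -
    have "[:- l, 1:] ^ i = [:- l, 1:] ^ (i - m) * [:- l, 1:] ^ m" using that by (simp add: power_add[symmetric])
    then show ?thesis using assms by (simp only: poly_mat_mult matrix_vector_mul_assoc[symmetric] matrix_vector_mult_0_right)
  qed
  have const: "[:l:] ^ k = [:l ^ k:]" for k by (induction k) (simp_all add: one_pCons)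
  have "[:0, 1:] ^ j = ([:- l, 1:] + [:l:]) ^ j" by simp
  also have "\<dots> = (\<Sum>i\<le>j. of_nat (j choose i) * [:- l, 1:] ^ i * [:l:] ^ (j - i))" by (rule binomial_ring)
  also have "\<dots> = (\<Sum>i\<le>j. Polynomial.smult (of_nat (j choose i) * l ^ (j - i)) ([:- l, 1:] ^ i))"
    unfolding const by (intro sum.cong refl) (simp add: of_nat_poly ac_simps)
  finally have "((*v) M ^^ j) u = (\<Sum>i\<le>j. ?g i)"
    by (simp only: power_vector poly_mat_sum poly_mat_smult matrix_sum_vector matrix_vector_mul_assoc[symmetric] mat_vector)
  \<comment> \<open>Terms with i \<ge> m vanish by nilpotence. Those with i > j vanish because the
    binomial coefficient is 0, so the truncated exponent j - i does no harm.\<close>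
  also have "\<dots> = (\<Sum>i\<in>{..j} \<inter> {..<m}. ?g i)"
    by (rule sum.mono_neutral_right) (use nil in auto)
  also have "\<dots> = (\<Sum>i<m. ?g i)"
    by (rule sum.mono_neutral_left) auto
  finally show ?thesis .
qed

lemma power_growth:
  obtains B :: "complex \<Rightarrow> nat \<Rightarrow> real" where "\<And>l i. 0 \<le> B l i"
    "\<And>j v. norm (((*v) M ^^ j) v) \<le> (\<Sum>l\<in>S. \<Sum>i<CARD('n). real (j choose i) * cmod l ^ (j - i) * B l i) * norm v"
proof -
  define Y where "Y l i = poly_mat ([:- l, 1:] ^ i) M ** P l" for l i
  define B where "B l i = (SOME B. 0 \<le> B \<and> (\<forall>v. norm (Y l i *v v) \<le> B * norm v))" for l i
  have B: "0 \<le> B l i" "norm (Y l i *v v) \<le> B l i * norm v" for l i v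
    using someI_ex[OF matrix_vector_norm_bound[of "Y l i"]] by (auto simp: B_def)
  show ?thesis
  proof (rule that[of B, OF B(1)])
    fix j v
    have lin: "linear ((*v) M ^^ j)" by (induction j) (auto intro: linear_compose[unfolded o_def] simp: linear_id id_def[symmetric] o_def)
    have one: "norm (((*v) M ^^ j) (P l *v v)) \<le> (\<Sum>i<CARD('n). real (j choose i) * cmod l ^ (j - i) * B l i) * norm v"
      if l: "l \<in> S" for l
    proof -
      have "((*v) M ^^ j) (P l *v v) = (\<Sum>i<order l c. (of_nat (j choose i) * l ^ (j - i)) *s (Y l i *v v))"
        unfolding power_generalized_eigenvector[OF P_nilpotent[OF l]] Y_def by (simp add: matrix_vector_mul_assoc)
      also have "norm \<dots> \<le> (\<Sum>i<order l c. real (j choose i) * cmod l ^ (j - i) * (B l i * norm v))"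
        by (rule order_trans[OF norm_sum], rule sum_mono)
          (simp add: norm_vector_scale norm_mult norm_power B(2) mult_left_mono)
      also have "\<dots> \<le> (\<Sum>i<CARD('n). real (j choose i) * cmod l ^ (j - i) * (B l i * norm v))"
        \<comment> \<open>A multiplicity is at most the dimension, which gives one summation range
          for all eigenvalues.\<close>
        by (rule sum_mono2) (use degree_b[OF l] charpoly_monic(2)[of M] B(1) in auto)
      finally show ?thesis by (simp add: sum_distrib_right mult.assoc)
    qed
    have "((*v) M ^^ j) v = (\<Sum>l\<in>S. ((*v) M ^^ j) (P l *v v))"
      by (subst (1) sum_P_vector[of v, symmetric]) (rule linear_sum[OF lin])
    also have "norm \<dots> \<le> (\<Sum>l\<in>S. (\<Sum>i<CARD('n). real (j choose i) * cmod l ^ (j - i) * B l i) * norm v)"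
      by (rule order_trans[OF norm_sum], rule sum_mono) (rule one)
    finally show "norm (((*v) M ^^ j) v) \<le> (\<Sum>l\<in>S. \<Sum>i<CARD('n). real (j choose i) * cmod l ^ (j - i) * B l i) * norm v"
      by (simp add: sum_distrib_right)
  qed
qed

lemma power_growth_unit:
  assumes "\<And>l. l \<in> S \<Longrightarrow> cmod l \<le> 1"
  obtains C :: "nat \<Rightarrow> real" where "\<And>i. 0 \<le> C i"
    "\<And>j v. norm (((*v) M ^^ j) v) \<le> (\<Sum>i<CARD('n). real (j choose i) * C i) * norm v"
proof -
  obtain B :: "complex \<Rightarrow> nat \<Rightarrow> real" where B: "\<And>l i. 0 \<le> B l i"
    "\<And>j v. norm (((*v) M ^^ j) v) \<le> (\<Sum>l\<in>S. \<Sum>i<CARD('n). real (j choose i) * cmod l ^ (j - i) * B l i) * norm v"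
    by (rule power_growth; rule that; assumption)
  show ?thesis
  proof (rule that[of "\<lambda>i. \<Sum>l\<in>S. B l i"])
    show "0 \<le> (\<Sum>l\<in>S. B l i)" for i by (intro sum_nonneg B)
    fix j v
    have "(\<Sum>l\<in>S. \<Sum>i<CARD('n). real (j choose i) * cmod l ^ (j - i) * B l i)
        \<le> (\<Sum>l\<in>S. \<Sum>i<CARD('n). real (j choose i) * 1 * B l i)"
      using assms B(1) by (intro sum_mono mult_right_mono mult_left_mono power_le_one) auto
    also have "\<dots> = (\<Sum>i<CARD('n). real (j choose i) * (\<Sum>l\<in>S. B l i))"
      by (subst sum.swap) (simp add: sum_distrib_left)
    finally show "norm (((*v) M ^^ j) v) \<le> (\<Sum>i<CARD('n). real (j choose i) * (\<Sum>l\<in>S. B l i)) * norm v"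
      by (rule order_trans[OF B(2) mult_right_mono]) simp
  qed
qed

lemma power_decay:
  assumes "\<And>l. l \<in> S \<Longrightarrow> cmod l < 1"
  obtains C r where "0 \<le> C" "1 / 2 \<le> r" "r < 1" "\<And>j v. norm (((*v) M ^^ j) v) \<le> C * r ^ j * norm v"
proof -
  obtain B :: "complex \<Rightarrow> nat \<Rightarrow> real" where B: "\<And>l i. 0 \<le> B l i"
    "\<And>j v. norm (((*v) M ^^ j) v) \<le> (\<Sum>l\<in>S. \<Sum>i<CARD('n). real (j choose i) * cmod l ^ (j - i) * B l i) * norm v"
    by (rule power_growth; rule that; assumption)
  define m where "m = Max (insert 0 (cmod ` S))"
  have m: "0 \<le> m" "m < 1" "\<And>l. l \<in> S \<Longrightarrow> cmod l \<le> m"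
    using finite_S assms by (auto simp: m_def Max_ge)
  \<comment> \<open>Any rate strictly between the spectral radius m and 1 absorbs the binomial
    factors. This choice is also at least 1/2, so r can later be divided by and equated with 1 - a
    p.\<close>
  define r where "r = (1 + m) / 2"
  have r: "1 / 2 \<le> r" "r < 1" "m < r" using m by (auto simp: r_def)
  have binom_le: "real (j choose i) * cmod l ^ (j - i) \<le> r ^ j * (1 / (r - m) ^ i)" if "l \<in> S" for l i j
  proof (cases "i \<le> j")
    case True
    have "real (j choose i) * cmod l ^ (j - i) * (r - m) ^ i \<le> real (j choose i) * m ^ (j - i) * (r - m) ^ i"
      using m(3)[OF that] r by (intro mult_right_mono mult_left_mono power_mono) auto
    also have "\<dots> = real (j choose i) * (r - m) ^ i * m ^ (j - i)" by simp
    \<comment> \<open>A single term of the binomial expansion of ((r - m) + m)^j = r^j.\<close>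
    also have "\<dots> \<le> (\<Sum>i\<le>j. real (j choose i) * (r - m) ^ i * m ^ (j - i))"
      by (rule member_le_sum) (use True m r in auto)
    also have "\<dots> = r ^ j" using binomial_ring[of "r - m" m j] by simp
    finally show ?thesis using r by (simp add: field_simps)
  next
    case False
    then show ?thesis using r m by (simp add: binomial_eq_0)
  qed
  define C where "C = (\<Sum>l\<in>S. \<Sum>i<CARD('n). 1 / (r - m) ^ i * B l i)"
  show ?thesis
  proof (rule that[of C r])
    show "0 \<le> C" unfolding C_def using B(1) r by (intro sum_nonneg mult_nonneg_nonneg) auto
    fix j v
    have "(\<Sum>l\<in>S. \<Sum>i<CARD('n). real (j choose i) * cmod l ^ (j - i) * B l i)
      \<le> (\<Sum>l\<in>S. \<Sum>i<CARD('n). r ^ j * (1 / (r - m) ^ i) * B l i)"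
      by (intro sum_mono mult_right_mono binom_le B(1))
    also have "\<dots> = C * r ^ j" unfolding C_def by (simp add: sum_distrib_left sum_distrib_right mult.commute mult.left_commute)
    finally show "norm (((*v) M ^^ j) v) \<le> C * r ^ j * norm v"
      by (rule order_trans[OF B(2) mult_right_mono]) simp
  qed (use r in auto)
qed

text \<open>Without chains each P l v is an honest eigenvector, so no binomial factors arise and
  powers of l of modulus at most 1 remain.\<close>

lemma power_bounded_semisimple:
  assumes "\<And>l. l \<in> S \<Longrightarrow> cmod l \<le> 1"
    and "\<And>l w v. \<lbrakk>M *v w = l *s w; M *v v = l *s v + w\<rbrakk> \<Longrightarrow> w = 0"
  obtains C where "0 \<le> C" "\<And>j v. norm (((*v) M ^^ j) v) \<le> C * norm v"
proof -
  define B where "B l = (SOME B. 0 \<le> B \<and> (\<forall>v. norm (P l *v v) \<le> B * norm v))" for l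
  have B: "0 \<le> B l" "norm (P l *v v) \<le> B l * norm v" for l v
    using someI_ex[OF matrix_vector_norm_bound[of "P l"]] by (auto simp: B_def)
  show ?thesis
  proof (rule that[of "\<Sum>l\<in>S. B l"])
    show "0 \<le> (\<Sum>l\<in>S. B l)" by (intro sum_nonneg B)
    fix j v
    have lin: "linear ((*v) M ^^ j)" by (induction j) (auto intro: linear_compose[unfolded o_def] simp: linear_id id_def[symmetric] o_def)
    have ss: "M *v (P l *v x) = l *s (P l *v x)" if "l \<in> S" for l x
      by (rule P_semisimple[OF assms(2) that])
    have pw: "((*v) M ^^ j) (P l *v v) = l ^ j *s (P l *v v)" if "l \<in> S" for l
      by (induction j) (simp_all add: vector_scalar_commute ss[OF that] mult.commute)
    have "((*v) M ^^ j) v = (\<Sum>l\<in>S. ((*v) M ^^ j) (P l *v v))"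
      by (subst (1) sum_P_vector[of v, symmetric]) (rule linear_sum[OF lin])
    also have "norm \<dots> \<le> (\<Sum>l\<in>S. B l * norm v)"
    proof (rule order_trans[OF norm_sum], rule sum_mono)
      fix l assume l: "l \<in> S"
      have "norm (((*v) M ^^ j) (P l *v v)) = cmod l ^ j * norm (P l *v v)"
        by (simp add: pw[OF l] norm_vector_scale norm_power)
      also have "\<dots> \<le> 1 * (B l * norm v)"
        using B assms(1)[OF l] by (intro mult_mono power_le_one) auto
      finally show "norm (((*v) M ^^ j) (P l *v v)) \<le> B l * norm v" by simp
    qed
    finally show "norm (((*v) M ^^ j) v) \<le> (\<Sum>l\<in>S. B l) * norm v" by (simp add: sum_distrib_right)
  qed
qed

lemma power_unbounded_eigenvector:
  assumes "M *v w = l *s w" "w \<noteq> 0" "1 < cmod l"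
  shows "\<exists>j. K < norm (((*v) M ^^ j) w)"
proof -
  have "((*v) M ^^ j) w = l ^ j *s w" for j
    by (induction j) (simp_all add: vector_scalar_commute assms(1) mult.commute)
  then have n: "norm (((*v) M ^^ j) w) = cmod l ^ j * norm w" for j
    by (simp add: norm_vector_scale norm_power)
  obtain j where "K / norm w < cmod l ^ j" using real_arch_pow[OF assms(3)] by blast
  then show ?thesis using assms(2) by (intro exI[of _ j]) (simp add: n field_simps)
qed

lemma power_unbounded_chain:
  assumes "M *v w = l *s w" "w \<noteq> 0" "M *v v = l *s v + w" "cmod l = 1"
  shows "\<exists>j. K < norm (((*v) M ^^ j) v)"
proof -
  have w: "((*v) M ^^ j) w = l ^ j *s w" for j
    by (induction j) (simp_all add: vector_scalar_commute assms(1) mult.commute)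
  have v: "((*v) M ^^ Suc j) v = l ^ Suc j *s v + (of_nat (Suc j) * l ^ j) *s w" for j
  proof (induction j)
    case (Suc j)
    have "((*v) M ^^ Suc (Suc j)) v = M *v (l ^ Suc j *s v + (of_nat (Suc j) * l ^ j) *s w)"
      using Suc by simp
    then show ?case
      by (simp add: matrix_vector_right_distrib vector_scalar_commute assms vec_eq_iff algebra_simps)
  qed (simp add: assms)
  \<comment> \<open>The linear term in w has norm (j + 1) norm w and must exceed K even after
    subtracting the bounded term of norm norm v.\<close>
  obtain j where j: "(K + norm v) / norm w < real j" using reals_Archimedean2 by blast
  have "K + norm v < real j * norm w" using j assms(2) by (simp add: field_simps)
  also have "\<dots> \<le> real (Suc j) * norm w" by (intro mult_right_mono) auto
  also have "\<dots> = norm ((of_nat (Suc j) * l ^ j) *s w)"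
    using assms(4) by (simp only: norm_vector_scale norm_mult norm_power norm_of_nat) simp
  also have "\<dots> \<le> norm (((*v) M ^^ Suc j) v) + norm (l ^ Suc j *s v)"
    unfolding v by (metis add_diff_cancel_left' norm_triangle_ineq4)
  also have "norm (l ^ Suc j *s v) = norm v" using assms(4) by (simp only: norm_vector_scale norm_power) simp
  finally show ?thesis by (intro exI[of _ "Suc j"]) simp
qed

end

section \<open>Complexification: from complex orbits to real ones\<close>

definition cvec :: "real^'n \<Rightarrow> complex^'n" where "cvec x = (\<chi> i. of_real (x $ i))"

lemma norm_cvec: "norm (cvec x) = norm x"
  by (simp add: cvec_def norm_vec_def)

lemma map_matrix_cvec:
  fixes A :: "real^'n^'n" shows "map_matrix of_real A *v cvec x = cvec (A *v x)"
  by (simp add: cvec_def map_matrix_def matrix_vector_mult_def vec_eq_iff)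

lemma power_cvec:
  fixes A :: "real^'n^'n" shows "((*v) (map_matrix of_real A) ^^ j) (cvec x) = cvec (((*v) A ^^ j) x)"
  by (induction j) (simp_all add: map_matrix_cvec)

lemma cvec_decompose: "w = cvec (\<chi> i. Re (w $ i)) + \<i> *s cvec (\<chi> i. Im (w $ i))"
  by (simp add: cvec_def vec_eq_iff complex_eq)

text \<open>If all real orbits were bounded, those of the real and imaginary parts of w would bound
  the orbit of w.\<close>

lemma real_unbounded_of_complex_unbounded:
  fixes A :: "real^'n^'n" and w :: "complex^'n"
  assumes "\<And>b. \<exists>j. b < norm (((*v) (map_matrix of_real A) ^^ j) w)"
  shows "\<exists>u. \<forall>b. \<exists>j. b < norm (((*v) A ^^ j) u)"
proof (rule ccontr)
  assume "\<not> ?thesis"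
  then have bd: "\<exists>b. \<forall>j. norm (((*v) A ^^ j) u) \<le> b" for u by (auto simp: not_less)
  define x y where "x = (\<chi> i. Re (w $ i))" and "y = (\<chi> i. Im (w $ i))"
  obtain b1 b2 where b: "\<And>j. norm (((*v) A ^^ j) x) \<le> b1" "\<And>j. norm (((*v) A ^^ j) y) \<le> b2"
    using bd by metis
  let ?N = "map_matrix of_real A :: complex^'n^'n"
  have "((*v) ?N ^^ j) (u + a *s v) = ((*v) ?N ^^ j) u + a *s ((*v) ?N ^^ j) v" for j u v a
    by (induction j) (simp_all add: matrix_vector_right_distrib vector_scalar_commute)
  then have "((*v) ?N ^^ j) w = cvec (((*v) A ^^ j) x) + \<i> *s cvec (((*v) A ^^ j) y)" for j
    using cvec_decompose[of w] by (metis power_cvec x_def y_def)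
  then have "norm (((*v) ?N ^^ j) w) \<le> b1 + b2" for j
    using norm_triangle_le[of "cvec (((*v) A ^^ j) x)" "\<i> *s cvec (((*v) A ^^ j) y)" "b1 + b2"] b[of j]
    by (simp add: norm_vector_scale norm_cvec)
  with assms[of "b1 + b2"] show False by (auto simp: not_less[symmetric])
qed

lemma map_matrix_kernel:
  fixes A :: "real^'n^'n"
  assumes "\<And>v. A *v v = 0 \<Longrightarrow> v = 0" "map_matrix of_real A *v (w :: complex^'n) = 0"
  shows "w = 0"
proof -
  define x y where "x = (\<chi> i. Re (w $ i))" and "y = (\<chi> i. Im (w $ i))"
  have w: "w = cvec x + \<i> *s cvec y" unfolding x_def y_def by (rule cvec_decompose)
  have "cvec (A *v x) + \<i> *s cvec (A *v y) = 0"
    using assms(2) unfolding w by (simp add: matrix_vector_right_distrib vector_scalar_commute map_matrix_cvec)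
  then have "A *v x = 0 \<and> A *v y = 0"
    by (simp add: cvec_def vec_eq_iff complex_eq_iff)
  then have "x = 0" "y = 0" using assms(1) by auto
  then show ?thesis unfolding w by (simp add: cvec_def vec_eq_iff)
qed

section \<open>Stability\<close>

theorem theorem7p9:
  fixes p t0 :: real and T :: "real set" and A :: "real \<Rightarrow> real^'n^'n"
    and \<gamma> :: "'n \<Rightarrow> real \<Rightarrow> complex"
  assumes "p > 0"
    and "periodic_time_scale p T"
    and "t0 \<in> T"
    and "regressive T A"
    and "periodic_on p T A"
    and "\<And>t. t \<in> T \<Longrightarrow> charpoly (floquet_R T A p t0 t) = (\<Prod>i\<in>UNIV. [:- \<gamma> i t, 1:])"
  shows
    "((\<forall>t\<in>T. \<forall>i. hilger_Re T t (\<gamma> i t) < 0) \<longrightarrow> dyn_exp_stable T A)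
     \<and>
     ((\<forall>t\<in>T. \<forall>i. hilger_Re T t (\<gamma> i t) = 0) \<longrightarrow>
        ((\<forall>t\<in>T. \<forall>i k. has_jordan_block (floquet_R T A p t0 t) (\<gamma> i t) k \<longrightarrow> k = 1) \<longrightarrow>
           dyn_stable T A) \<and>
        ((\<exists>t\<in>T. \<exists>i k. has_jordan_block (floquet_R T A p t0 t) (\<gamma> i t) k \<and> k > 1) \<longrightarrow>
           dyn_unstable T A \<and>
           (\<exists>x. is_solution T A x \<and> \<not> bounded (x ` (T \<inter> {t0..}))) \<and>
           (\<forall>x. is_solution T A x \<longrightarrow>
              (\<exists>N c. \<forall>t\<in>T. t0 \<le> t \<longrightarrow> norm (x t) \<le> (\<Sum>k\<le>N. c k * gen_poly T k t t0)))))
     \<and>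
     ((\<exists>i. \<exists>t\<in>T. hilger_Re T t (\<gamma> i t) > 0) \<longrightarrow> dyn_unstable T A)"
proof -
  interpret periodic_system p T t0 A
    using assms(1-5) by unfold_locales
  let ?N = "map_matrix of_real Phi :: complex^'n^'n"
  interpret N: spectral ?N .
  define R where "R t = floquet_R T A p t0 t" for t
  define G where "G l t = floquet_exponent p (mu T t) l" for l t
  have S_eig: "\<exists>w. w \<noteq> 0 \<and> ?N *v w = l *s w" if "l \<in> N.S" for l
    using that charpoly_root_eigenvector[of ?N l] unfolding N.S_def by blast
  have S0: "0 \<notin> N.S"
  proof
    assume "0 \<in> N.S"
    then obtain w where w: "w \<noteq> 0" "?N *v w = 0" using S_eig[of 0] by auto
    have "w = 0" by (rule map_matrix_kernel[OF _ w(2)]) (rule Phi_injective)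
    with w(1) show False by simp
  qed
  \<comment> \<open>\<open>Lim\<close> has its intended meaning only for a convergent quotient, so
    convergence comes first.\<close>
  have R_lim: "(N.floquet_quotient p \<longlongrightarrow> R t) (at_right (mu T t))" if t: "t \<in> T" for t
  proof -
    obtain X where X: "(N.floquet_quotient p \<longlongrightarrow> X) (at_right (mu T t))"
      using N.floquet_quotient_converges[OF S0 p_pos mu_nonneg[OF t]] by blast
    then have "Lim (at_right (mu T t)) (N.floquet_quotient p) = X" by (intro tendsto_Lim) auto
    moreover have "R t = Lim (at_right (mu T t)) (N.floquet_quotient p)"
      unfolding R_def floquet_R_def by (simp only: Phi_def[symmetric] N.floquet_quotient_def[symmetric])
    ultimately show ?thesis using X by simp
  qed
  note R_eigenvector = N.R_eigenvector[OF S0 p_pos mu_nonneg R_lim]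
    and R_eigenvalue = N.R_eigenvalue[OF S0 p_pos mu_nonneg R_lim]
    and R_chain = N.R_chain[OF S0 p_pos mu_nonneg R_lim]
    and R_chain_imp_chain = N.R_chain_imp_chain[OF S0 p_pos mu_nonneg R_lim]
  have charpoly_R: "charpoly (R t) = (\<Prod>i\<in>UNIV. [:- \<gamma> i t, 1:])" if "t \<in> T" for t
    unfolding R_def by (rule assms(6)[OF that])
  have root_R: "poly (charpoly (R t)) z = 0 \<longleftrightarrow> (\<exists>i. z = \<gamma> i t)" if "t \<in> T" for t z
    unfolding charpoly_R[OF that] poly_prod by auto
  have eig_gamma: "\<exists>i. \<gamma> i t = G l t" if l: "l \<in> N.S" and t: "t \<in> T" for l t
  proof -
    obtain w where w: "w \<noteq> 0" "?N *v w = l *s w" using S_eig[OF l] by blast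
    have "R t *v w = G l t *s w" unfolding G_def by (rule R_eigenvector[OF t t w(2)])
    from eigenvector_charpoly_root[OF this w(1)] show ?thesis using root_R[OF t] by metis
  qed
  have gamma_eig: "\<exists>l\<in>N.S. \<gamma> i t = G l t" if t: "t \<in> T" for i t
  proof -
    have "poly (charpoly (R t)) (\<gamma> i t) = 0" using root_R[OF t] by blast
    then obtain u where u: "u \<noteq> 0" "R t *v u = \<gamma> i t *s u" by (rule charpoly_root_eigenvector)
    obtain l w where w: "w \<noteq> 0" "?N *v w = l *s w" "\<gamma> i t = G l t"
      unfolding G_def by (rule R_eigenvalue[OF t t u(2,1)])
    then show ?thesis using eigenvector_charpoly_root[OF w(2,1)] unfolding N.S_def by blast
  qed
  have hilger: "hilger_Re T t (G l t) < 0 \<longleftrightarrow> cmod l < 1"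
      "hilger_Re T t (G l t) = 0 \<longleftrightarrow> cmod l = 1"
      "hilger_Re T t (G l t) > 0 \<longleftrightarrow> cmod l > 1" if "l \<in> N.S" "t \<in> T" for l t
  proof -
    have "l \<noteq> 0" using that S0 by auto
    from hilger_Re_floquet_exponent[OF this p_pos mu_nonneg[OF that(2)]]
    show "hilger_Re T t (G l t) < 0 \<longleftrightarrow> cmod l < 1"
      "hilger_Re T t (G l t) = 0 \<longleftrightarrow> cmod l = 1"
      "hilger_Re T t (G l t) > 0 \<longleftrightarrow> cmod l > 1" unfolding G_def by auto
  qed
  have norm_power: "norm (((*v) Phi ^^ j) u) = norm (((*v) ?N ^^ j) (cvec u))" for j u
    by (simp add: power_cvec norm_cvec)
  obtain D where D: "1 \<le> D"
    and D0: "\<And>x t. \<lbrakk>V.flow x; t \<in> T; t0 \<le> t\<rbrakk> \<Longrightarrow>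
      \<exists>j. t0 + real j * p \<le> t \<and> norm (x t) \<le> D * norm (((*v) Phi ^^ j) (x t0))"
    and D1: "\<And>x \<tau> t. \<lbrakk>V.flow x; \<tau> \<in> T; t \<in> T; \<tau> \<le> t\<rbrakk> \<Longrightarrow>
      \<exists>j u. norm (x t) \<le> D * norm (((*v) Phi ^^ j) u) \<and> norm u \<le> D * norm (x \<tau>) \<and> t \<le> \<tau> + real (j + 2) * p"
    by (rule growth_bound; rule that; assumption)
  have unstable: "dyn_unstable T A \<and> (\<exists>x. is_solution T A x \<and> \<not> bounded (x ` (T \<inter> {t0..})))"
    if unb: "\<And>b. \<exists>j. b < norm (((*v) ?N ^^ j) w)" for w
  proof -
    from real_unbounded_of_complex_unbounded[OF unb] obtain u
      where u: "\<forall>b. \<exists>j. b < norm (((*v) Phi ^^ j) u)" by blast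
    obtain x where x: "V.flow x" "x t0 = u" using V.flow_exists[OF t0_in] by blast
    have big: "\<exists>t\<in>T. t0 \<le> t \<and> b < norm (x t)" for b
    proof -
      from u obtain j where "b < norm (((*v) Phi ^^ j) u)" by blast
      then show ?thesis using monodromy_power[OF x(1), of j] x(2) shift_nat_in[OF t0_in, of j] p_pos
        by (intro bexI[of _ "t0 + real j * p"]) auto
    qed
    have "\<not> bounded (x ` (T \<inter> {t0..}))"
    proof
      assume "bounded (x ` (T \<inter> {t0..}))"
      then obtain b where "\<forall>y\<in>x ` (T \<inter> {t0..}). norm y \<le> b" by (auto simp: bounded_iff)
      with big[of b] show False by force
    qed
    moreover have "dyn_unstable T A"
    proof
      assume "dyn_stable T A"
      then obtain C where C: "\<forall>\<tau>\<in>T. \<forall>x. is_solution T A x \<longrightarrow>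
        (\<forall>t\<in>T. \<tau> \<le> t \<longrightarrow> norm (x t) \<le> C * norm (x \<tau>))" unfolding dyn_stable_def by blast
      from big[of "C * norm (x t0)"] obtain t where t: "t \<in> T" "t0 \<le> t" "C * norm (x t0) < norm (x t)" by blast
      have "norm (x t) \<le> C * norm (x t0)" using C t0_in t(1,2) x(1) is_solution_iff by blast
      with t(3) show False by simp
    qed
    ultimately show ?thesis using x(1) is_solution_iff by blast
  qed
  have i: "dyn_exp_stable T A" if neg: "\<forall>t\<in>T. \<forall>i. hilger_Re T t (\<gamma> i t) < 0"
  proof -
    \<comment> \<open>The sign of the Hilger real part is decided by cmod l alone, so evaluation at
      t0 suffices.\<close>
    have small: "cmod l < 1" if l: "l \<in> N.S" for l
      using eig_gamma[OF l t0_in] neg t0_in hilger(1)[OF l t0_in] by metis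
    obtain C r where C: "0 \<le> C" and r: "1 / 2 \<le> r" "r < 1"
      and decay: "\<And>j v. norm (((*v) ?N ^^ j) v) \<le> C * r ^ j * norm v"
    proof (rule N.power_decay)
      show "cmod l < 1" if "l \<in> N.S" for l using that by (rule small)
    qed (rule that)
    \<comment> \<open>Chosen so that the factor 1 - a p lost by the exponential per period is
      exactly the decay rate r.\<close>
    define a where "a = (1 - r) / p"
    have a: "0 < a" "a * p = 1 - r" using r p_pos by (simp_all add: a_def)
    \<comment> \<open>One D for reaching the grid and one for leaving it; r ^ 2 pays for the two
      incomplete periods, and C + 1 keeps \<open>E\<close> positive.\<close>
    define E where "E = D * D * (C + 1) / r ^ 2"
    have E: "0 < E" using D C r by (simp add: E_def)
    show ?thesis unfolding dyn_exp_stable_def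
    proof (rule exI[of _ E], intro conjI E, rule exI[of _ a], intro conjI a(1) ballI allI impI)
      fix t assume t: "t \<in> T"
      have "a * mu T t \<le> a * p" using a mu_le[OF t] by (intro mult_left_mono) auto
      then show "0 < 1 - a * mu T t" using a r by linarith
    next
      fix \<tau> x t assume \<tau>: "\<tau> \<in> T" and x: "is_solution T A x" and t: "t \<in> T" "\<tau> \<le> t"
      from D1[OF x[unfolded is_solution_iff] \<tau> t] obtain j u
        where ju: "norm (x t) \<le> D * norm (((*v) Phi ^^ j) u)" "norm u \<le> D * norm (x \<tau>)"
          "t \<le> \<tau> + real (j + 2) * p" by blast
      have "(1 - a * p) ^ (j + 2) \<le> ts_exp T (- a) t \<tau>"
        using a r by (intro ts_exp_lower_bound[OF a(1) _ \<tau> t ju(3)]) auto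
      then have e: "r ^ j * r ^ 2 \<le> ts_exp T (- a) t \<tau>" using a
        by (simp add: power2_eq_square ac_simps)
      have "norm (x t) \<le> D * (C * r ^ j * norm u)"
        using ju(1) decay[of j "cvec u"] D
        by (intro order_trans[OF ju(1)] mult_left_mono) (simp_all add: norm_power norm_cvec)
      also have "\<dots> \<le> D * ((C + 1) * r ^ j * (D * norm (x \<tau>)))"
        using D C r ju(2) by (intro mult_left_mono mult_mono) auto
      also have "\<dots> = E * (r ^ j * r ^ 2) * norm (x \<tau>)" using r by (simp add: E_def field_simps)
      also have "\<dots> \<le> E * ts_exp T (- a) t \<tau> * norm (x \<tau>)"
        using e E by (intro mult_right_mono mult_left_mono) auto
      finally show "norm (x t) \<le> E * ts_exp T (- a) t \<tau> * norm (x \<tau>)" .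
    qed
  qed
  have ii_stable: "dyn_stable T A"
    if unit: "\<And>l. l \<in> N.S \<Longrightarrow> cmod l = 1"
      and simple: "\<forall>t\<in>T. \<forall>i k. has_jordan_block (floquet_R T A p t0 t) (\<gamma> i t) k \<longrightarrow> k = 1"
  proof -
    have no_chain_R: "w = 0" if "R t0 *v w = g *s w" "R t0 *v v = g *s v + w" for g w v
    proof (rule simple_jordan_blocks_imp_no_chain[OF _ that])
      fix a k assume "poly (charpoly (R t0)) a = 0" and block: "has_jordan_block (R t0) a k"
      then obtain i where "a = \<gamma> i t0" using root_R[OF t0_in, of a] by blast
      then show "k = 1" using simple[rule_format, OF t0_in, of i k] block by (simp add: R_def)
    qed
    have no_chain: "w = 0" if wv: "?N *v w = l *s w" "?N *v v = l *s v + w" for l w v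
    proof (rule ccontr)
      \<comment> \<open>A chain of the monodromy matrix becomes one of R(t0) after rescaling w by
        the nonzero factor a, which the simple blocks forbid.\<close>
      assume w: "w \<noteq> 0"
      from R_chain[OF t0_in t0_in wv(1) w wv(2)] obtain a
        where a: "a \<noteq> 0" "R t0 *v v = G l t0 *s v + a *s w" unfolding G_def by blast
      have "R t0 *v (a *s w) = G l t0 *s (a *s w)"
        using R_eigenvector[OF t0_in t0_in wv(1)] by (simp add: G_def vector_scalar_commute mult.commute)
      from no_chain_R[OF this a(2)] a(1) w show False by (auto simp: Finite_Cartesian_Product.vec_eq_iff)
    qed
    obtain C where C: "0 \<le> C" "\<And>j v. norm (((*v) ?N ^^ j) v) \<le> C * norm v"
      by (rule N.power_bounded_semisimple[OF _ no_chain]) (use unit in auto)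
    define E where "E = D * (C + 1) * D"
    show ?thesis unfolding dyn_stable_def
    proof (rule exI[of _ E], intro conjI ballI allI impI)
      show "0 < E" using D C by (simp add: E_def)
      fix \<tau> x t assume \<tau>: "\<tau> \<in> T" and x: "is_solution T A x" and t: "t \<in> T" "\<tau> \<le> t"
      from D1[OF x[unfolded is_solution_iff] \<tau> t] obtain j u
        where ju: "norm (x t) \<le> D * norm (((*v) Phi ^^ j) u)" "norm u \<le> D * norm (x \<tau>)" by blast
      have "norm (x t) \<le> D * (C * norm u)"
        using C(2)[of j "cvec u"] D
        by (intro order_trans[OF ju(1)] mult_left_mono) (simp_all add: norm_power norm_cvec)
      also have "\<dots> \<le> D * ((C + 1) * (D * norm (x \<tau>)))"
        using D C ju(2) by (intro mult_left_mono mult_mono) auto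
      finally show "norm (x t) \<le> E * norm (x \<tau>)" by (simp add: E_def mult.assoc)
    qed
  qed
  have ii_unstable: "dyn_unstable T A \<and> (\<exists>x. is_solution T A x \<and> \<not> bounded (x ` (T \<inter> {t0..})))"
    if unit: "\<And>l. l \<in> N.S \<Longrightarrow> cmod l = 1"
      and multiple: "\<exists>t\<in>T. \<exists>i k. has_jordan_block (floquet_R T A p t0 t) (\<gamma> i t) k \<and> k > 1"
  proof -
    from multiple obtain t i k where t: "t \<in> T" and "has_jordan_block (R t) (\<gamma> i t) k" "1 < k"
      unfolding R_def by blast
    then obtain v w where vw: "w \<noteq> 0" "R t *v w = \<gamma> i t *s w" "R t *v v = \<gamma> i t *s v + w"
      by (elim multiple_jordan_block_imp_chain)
    have "\<not> (\<forall>l w v. ?N *v w = l *s w \<longrightarrow> ?N *v v = l *s v + w \<longrightarrow> w = 0)"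
    proof
      assume *: "\<forall>l w v. ?N *v w = l *s w \<longrightarrow> ?N *v v = l *s v + w \<longrightarrow> w = 0"
      have "w = 0"
        by (rule R_chain_imp_chain[OF t t _ vw(2,3)]) (use * in blast)
      with vw(1) show False by simp
    qed
    then obtain l w v where c: "?N *v w = l *s w" "?N *v v = l *s v + w" "w \<noteq> 0" by blast
    have "l \<in> N.S" using eigenvector_charpoly_root[OF c(1,3)] by (simp add: N.S_def)
    then show ?thesis
      by (intro unstable[of v] N.power_unbounded_chain[OF c(1,3,2)] unit)
  qed
  have ii_growth: "\<exists>N c. \<forall>t\<in>T. t0 \<le> t \<longrightarrow> norm (x t) \<le> (\<Sum>k\<le>N. c k * gen_poly T k t t0)"
    if unit: "\<And>l. l \<in> N.S \<Longrightarrow> cmod l = 1" and x: "is_solution T A x" for x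
  proof -
    obtain C :: "nat \<Rightarrow> real" where C: "\<And>i. 0 \<le> C i"
      "\<And>j v. norm (((*v) ?N ^^ j) v) \<le> (\<Sum>i<CARD('n). real (j choose i) * C i) * norm v"
      by (rule N.power_growth_unit) (use unit in auto)
    \<comment> \<open>The division by p ^ k undoes the factor in the lower bound of h_k by binomial
      coefficients.\<close>
    define c where "c k = D * C k * norm (x t0) / p ^ k" for k
    have c0: "0 \<le> c k" for k using D C(1) p_pos by (simp add: c_def)
    have "norm (x t) \<le> (\<Sum>k\<le>CARD('n) - 1. c k * gen_poly T k t t0)" if t: "t \<in> T" "t0 \<le> t" for t
    proof -
      from D0[OF x[unfolded is_solution_iff] t] obtain j
        where j: "t0 + real j * p \<le> t" "norm (x t) \<le> D * norm (((*v) Phi ^^ j) (x t0))" by blast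
      have "norm (x t) \<le> D * ((\<Sum>i<CARD('n). real (j choose i) * C i) * norm (x t0))"
        using C(2)[of j "cvec (x t0)"] D
        by (intro order_trans[OF j(2)] mult_left_mono) (simp_all add: norm_power norm_cvec)
      also have "\<dots> = (\<Sum>k<CARD('n). c k * (p ^ k * real (j choose k)))"
        using p_pos by (simp add: c_def sum_distrib_left sum_distrib_right ac_simps)
      also have "\<dots> \<le> (\<Sum>k<CARD('n). c k * gen_poly T k t t0)"
      proof (intro sum_mono mult_left_mono c0)
        fix k
        have "p ^ k * real (j choose k) \<le> gen_poly T k (t0 + real j * p) t0"
          by (rule gen_poly_ge_binomial[OF t0_in]) (use p_pos shift_nat_in[OF t0_in] in auto)
        also have "\<dots> \<le> gen_poly T k t t0"
          using gen_poly_mono[OF t0_in shift_nat_in[OF t0_in, of j] t(1) _ j(1), of k] p_pos by simp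
        finally show "p ^ k * real (j choose k) \<le> gen_poly T k t t0" .
      qed
      also have "{..<CARD('n)} = {..CARD('n) - 1}"
        by (metis Suc_diff_1 lessThan_Suc_atMost zero_less_card_finite)
      finally show ?thesis .
    qed
    then show ?thesis by blast
  qed
  have ii: "cmod l = 1" if "\<forall>t\<in>T. \<forall>i. hilger_Re T t (\<gamma> i t) = 0" "l \<in> N.S" for l
    using eig_gamma[OF that(2) t0_in] that(1) t0_in hilger(2)[OF that(2) t0_in] by metis
  have iii: "dyn_unstable T A" if pos: "\<exists>i. \<exists>t\<in>T. hilger_Re T t (\<gamma> i t) > 0"
  proof -
    from pos obtain i t where t: "t \<in> T" "hilger_Re T t (\<gamma> i t) > 0" by blast
    \<comment> \<open>The given \<gamma> i t must come from some eigenvalue l; its modulus no longer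
      depends on t.\<close>
    obtain l where l: "l \<in> N.S" "\<gamma> i t = G l t" using gamma_eig[OF t(1)] by blast
    then have big: "1 < cmod l" using hilger(3)[OF l(1) t(1)] t(2) by simp
    obtain w where w: "w \<noteq> 0" "?N *v w = l *s w" using S_eig[OF l(1)] by blast
    show ?thesis
      by (rule conjunct1[OF unstable[OF N.power_unbounded_eigenvector[OF w(2,1) big]]])
  qed
  show ?thesis
    using i ii ii_stable ii_unstable ii_growth iii by (intro conjI impI allI) blast+
qed

end
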